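(* Let $M$ be a closed subspace of $\mathcal H^2(\mathbb T)$ and let $p,q\in M$ be unit vectors such that $$M\cap p^\perp=S(M\cap q^\perp).$$ (i) Then $q=\theta p$ for some inner function $\theta$. (ii) Assume in addition that for every $f\in\operatorname{Ran}H_\theta\cap\mathcal H^\infty(\mathbb T)$ the following implication holds: if $pf\in M$ and $f\perp\mathbbm 1$, then $pf\perp p$. Then $p$ is an isometric multiplier on $\operatorname{Ran}H_\theta$ and $M=p\operatorname{Ran}H_\theta$.
   Context: $\mathcal H^2=\mathcal H^2(\mathbb T)$, $S$ the shift $Sf=zf$, $\mathbbm 1$ the constant function $1$, $x^\perp$ the orthogonal complement of a vector $x$. For inner $\theta$, $\operatorname{Ran}H_\theta=\mathcal H^2\ominus z\theta\mathcal H^2=\{f\in\mathcal H^2:\theta\overline f\in\mathcal H^2\}$. A holomorphic $p$ on $\mathbb D$ is an isometric multiplier on a closed subspace $F\subset\mathcal H^2$ if $pf\in\mathcal H^2$ and $\|pf\|=\|f\|$ for all $f\in F$; $pF=\{pf:f\in F\}$. *)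

theory Defs
  imports "HOL-Analysis.Analysis"
begin

text \<open>Elements of the Hardy space H2 are represented as holomorphic functions on the
open unit disc D, extended by 0 outside D (canonical representatives), whose Taylor
coefficients at 0 are square summable.\<close>

abbreviation D :: "complex set" where "D \<equiv> ball 0 1"

definition tcoeff :: "(complex \<Rightarrow> complex) \<Rightarrow> nat \<Rightarrow> complex" where
  "tcoeff f n = (deriv ^^ n) f 0 / of_nat (fact n)"

definition H2 :: "(complex \<Rightarrow> complex) set" where
  "H2 = {f. f holomorphic_on D \<and> (\<forall>z. z \<notin> D \<longrightarrow> f z = 0)
            \<and> summable (\<lambda>n. (cmod (tcoeff f n))\<^sup>2)}"

definition h2inner :: "(complex \<Rightarrow> complex) \<Rightarrow> (complex \<Rightarrow> complex) \<Rightarrow> complex" where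
  "h2inner f g = (\<Sum>n. tcoeff f n * cnj (tcoeff g n))"

definition h2norm :: "(complex \<Rightarrow> complex) \<Rightarrow> real" where
  "h2norm f = sqrt (\<Sum>n. (cmod (tcoeff f n))\<^sup>2)"

definition pmul :: "(complex \<Rightarrow> complex) \<Rightarrow> (complex \<Rightarrow> complex) \<Rightarrow> (complex \<Rightarrow> complex)" where
  "pmul p f = (\<lambda>z. if z \<in> D then p z * f z else 0)"

definition shift :: "(complex \<Rightarrow> complex) \<Rightarrow> (complex \<Rightarrow> complex)" where
  "shift f = pmul (\<lambda>z. z) f"

definition one_H2 :: "complex \<Rightarrow> complex" where
  "one_H2 = (\<lambda>z. if z \<in> D then 1 else 0)"

definition Hinf :: "(complex \<Rightarrow> complex) set" where
  "Hinf = {f. f holomorphic_on D \<and> (\<exists>B. \<forall>z\<in>D. cmod (f z) \<le> B)}"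

definition inner_fun :: "(complex \<Rightarrow> complex) \<Rightarrow> bool" where
  "inner_fun \<theta> \<longleftrightarrow> \<theta> \<in> Hinf \<and>
     (AE t in lborel. \<exists>l. cmod l = 1 \<and>
        ((\<lambda>r. \<theta> (complex_of_real r * cis t)) \<longlongrightarrow> l) (at_left 1))"

definition closed_subspace_H2 :: "(complex \<Rightarrow> complex) set \<Rightarrow> bool" where
  "closed_subspace_H2 M \<longleftrightarrow> M \<subseteq> H2 \<and> (\<lambda>z. 0) \<in> M
     \<and> (\<forall>f\<in>M. \<forall>g\<in>M. (\<lambda>z. f z + g z) \<in> M)
     \<and> (\<forall>c. \<forall>f\<in>M. (\<lambda>z. c * f z) \<in> M)
     \<and> (\<forall>x f. (\<forall>n. x n \<in> M) \<and> f \<in> H2 \<and>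
          (\<lambda>n. h2norm (\<lambda>z. x n z - f z)) \<longlonglongrightarrow> 0 \<longrightarrow> f \<in> M)"

definition perp_in :: "(complex \<Rightarrow> complex) set \<Rightarrow> (complex \<Rightarrow> complex) \<Rightarrow> (complex \<Rightarrow> complex) set" where
  "perp_in M p = {f \<in> M. h2inner f p = 0}"

definition RanH :: "(complex \<Rightarrow> complex) \<Rightarrow> (complex \<Rightarrow> complex) set" where
  "RanH \<theta> = {f \<in> H2. \<forall>g\<in>H2. h2inner f (shift (pmul \<theta> g)) = 0}"

definition isometric_multiplier :: "(complex \<Rightarrow> complex) \<Rightarrow> (complex \<Rightarrow> complex) set \<Rightarrow> bool" where
  "isometric_multiplier p F \<longleftrightarrow> p holomorphic_on D \<and>
     (\<forall>f\<in>F. pmul p f \<in> H2 \<and> h2norm (pmul p f) = h2norm f)"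

end

theory Submission
  imports Defs "HOL-Complex_Analysis.Complex_Analysis"
begin

text \<open>Each \<open>f \<in> M\<close> is \<open>\<langle>f, p\<rangle> p + S (V f)\<close> with \<open>V f \<in> M\<close> orthogonal to \<open>q\<close>. Iterating, \<open>f = p c\<^sub>f\<close> with
  \<open>c\<^sub>f = \<Sum>\<^sub>n \<langle>V\<^sup>n f, p\<rangle> z\<^sup>n\<close>, and \<open>\<parallel>f\<parallel>\<^sup>2 - \<parallel>c\<^sub>f\<parallel>\<^sup>2\<close> is the limit of \<open>\<parallel>V\<^sup>n f\<parallel>\<^sup>2\<close>. In particular \<open>q = \<theta> p\<close> for
  \<open>\<theta> = c\<^sub>q\<close>. The Neumann series \<open>x = (1 - w V)\<^sup>-\<^sup>1 q\<close> satisfies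
  \<open>\<bar>w \<theta>(w)\<bar>\<^sup>2 = 1 - (1 - \<bar>w\<bar>\<^sup>2) \<parallel>x\<parallel>\<^sup>2\<close>, so \<open>\<bar>\<theta>\<bar> \<le> 1\<close> by the Schwarz lemma. As \<open>\<theta>\<close> preserves the norm of \<open>p\<close>,
  a Beurling-type argument gives \<open>\<parallel>\<theta>\<parallel> = 1\<close>, and then the radial limits of \<open>\<theta>\<close> are unimodular.
  They exist almost everywhere by an \<open>L\<^sup>2\<close> bound for the radial maximal function, obtained by linearizing
  it and applying the \<open>T T\<^sup>*\<close> method to the Poisson kernel.

  From \<open>\<parallel>\<theta>\<parallel> = \<parallel>q\<parallel>\<close> it follows that \<open>V\<^sup>n q\<close> tends to 0, hence \<open>\<langle>c\<^sub>f, \<theta>\<rangle> = \<langle>f, q\<rangle>\<close> and all \<open>c\<^sub>f\<close> are orthogonal to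
  \<open>z \<theta> H\<^sup>2\<close>. Conversely, with \<open>W = V\<^sup>*\<close>, that is \<open>W g = S (g - \<langle>g, q\<rangle> q)\<close>, the vectors \<open>W\<^sup>n p\<close> are mapped
  isometrically by \<open>f \<mapsto> c\<^sub>f\<close> to the projections of the monomials \<open>z\<^sup>n\<close>, which span the orthogonal complement
  of \<open>z \<theta> H\<^sup>2\<close>.\<close>

section \<open>The Hardy space\<close>

lemma tcoeff_sums:
  assumes "f holomorphic_on D" "z \<in> D"
  shows "(\<lambda>n. tcoeff f n * z ^ n) sums f z"
  using holomorphic_power_series[OF assms] by (simp add: tcoeff_def)

text \<open>By uniqueness of the expansion at 0; coefficients are thus read off from a series
  instead of from derivatives.\<close>

lemma tcoeff_eqI:
  assumes "\<And>z. z \<in> D \<Longrightarrow> (\<lambda>n. a n * z ^ n) sums f z"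
  shows "tcoeff f n = a n"
proof -
  have "f has_fps_expansion Abs_fps a"
    by (rule has_fps_expansionI) (use assms in \<open>auto intro!: eventually_nhds_in_open[of D, THEN eventually_mono]\<close>)
  from fps_nth_fps_expansion[OF this] show ?thesis by (simp add: tcoeff_def)
qed

text \<open>Cut off outside \<open>D\<close> to give the canonical representatives that
  \<open>H2\<close> consists of.\<close>

definition pseries :: "(nat \<Rightarrow> complex) \<Rightarrow> complex \<Rightarrow> complex" where
  "pseries a = (\<lambda>z. if z \<in> D then \<Sum>n. a n * z ^ n else 0)"

lemma cmod_add_power2_le: "(cmod (x + y))\<^sup>2 \<le> 2 * (cmod x)\<^sup>2 + 2 * (cmod y)\<^sup>2"
proof -
  have "(cmod (x + y))\<^sup>2 \<le> (cmod x + cmod y)\<^sup>2"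
    by (intro power_mono norm_triangle_ineq) auto
  moreover have "0 \<le> (cmod x - cmod y)\<^sup>2" by simp
  ultimately show ?thesis by (simp add: power2_eq_square algebra_simps)
qed

lemma summable_sq_add:
  assumes "summable (\<lambda>n. (cmod (a n))\<^sup>2)" "summable (\<lambda>n. (cmod (b n))\<^sup>2)"
  shows "summable (\<lambda>n. (cmod (a n + b n))\<^sup>2)"
proof (rule summable_comparison_test'[where N=0])
  show "summable (\<lambda>n. 2 * (cmod (a n))\<^sup>2 + 2 * (cmod (b n))\<^sup>2)"
    by (intro summable_add summable_mult assms)
qed (use cmod_add_power2_le in auto)

lemma summable_sq_mult:
  assumes "summable (\<lambda>n. (cmod (a n))\<^sup>2)" "summable (\<lambda>n. (cmod (b n))\<^sup>2)"
  shows "summable (\<lambda>n. cmod (a n) * cmod (b n))"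
proof (rule summable_comparison_test'[where N=0])
  show "summable (\<lambda>n. (cmod (a n))\<^sup>2 + (cmod (b n))\<^sup>2)"
    by (intro summable_add assms)
  show "norm (cmod (a n) * cmod (b n)) \<le> (cmod (a n))\<^sup>2 + (cmod (b n))\<^sup>2" for n
    using sum_squares_bound[of "cmod (a n)" "cmod (b n)"] by (simp add: mult.assoc)
      (smt (verit) zero_le_mult_iff norm_ge_zero)
qed

lemma power_swap: "((x::real) ^ m) ^ n = (x ^ n) ^ m"
  by (metis power_mult mult.commute)

text \<open>Square summability suffices for convergence in \<open>D\<close>, because the powers of
  \<open>z\<close> are square summable there as well.\<close>

lemma pseries_sums:
  assumes "summable (\<lambda>n. (cmod (a n))\<^sup>2)" "z \<in> D"
  shows "(\<lambda>n. a n * z ^ n) sums pseries a z"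
proof -
  have "(cmod z)\<^sup>2 < 1" using assms(2) by (simp add: abs_square_less_1)
  then have "summable (\<lambda>n. (cmod (z ^ n))\<^sup>2)"
    by (simp add: norm_power power_swap[of _ _ 2] summable_geometric)
  from summable_sq_mult[OF assms(1) this] have "summable (\<lambda>n. norm (a n * z ^ n))"
    by (simp add: norm_mult)
  from summable_sums[OF summable_norm_cancel[OF this]] show ?thesis
    using assms(2) by (simp add: pseries_def)
qed

lemma tcoeff_pseries: "summable (\<lambda>n. (cmod (a n))\<^sup>2) \<Longrightarrow> tcoeff (pseries a) n = a n"
  by (rule tcoeff_eqI) (rule pseries_sums)

lemma pseries_H2: "summable (\<lambda>n. (cmod (a n))\<^sup>2) \<Longrightarrow> pseries a \<in> H2"
  unfolding H2_def
  using power_series_holomorphic[of 0 1 a "pseries a"] pseries_sums[of a]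
  by (auto simp: tcoeff_pseries) (simp add: pseries_def)

lemma H2_holo: "f \<in> H2 \<Longrightarrow> f holomorphic_on D"
  and H2_off: "f \<in> H2 \<Longrightarrow> z \<notin> D \<Longrightarrow> f z = 0"
  and H2_summable: "f \<in> H2 \<Longrightarrow> summable (\<lambda>n. (cmod (tcoeff f n))\<^sup>2)"
  by (auto simp: H2_def)

lemma H2_sums: "f \<in> H2 \<Longrightarrow> z \<in> D \<Longrightarrow> (\<lambda>n. tcoeff f n * z ^ n) sums f z"
  by (rule tcoeff_sums[OF H2_holo])

lemma H2I:
  assumes "\<And>z. z \<in> D \<Longrightarrow> (\<lambda>n. a n * z ^ n) sums f z" "\<And>z. z \<notin> D \<Longrightarrow> f z = 0"
    "summable (\<lambda>n. (cmod (a n))\<^sup>2)"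
  shows "f \<in> H2"
proof -
  have "f = pseries a"
    using assms(1,2) pseries_sums[OF assms(3)] by (metis (full_types) pseries_def sums_unique2 ext)
  then show ?thesis using pseries_H2 assms(3) by simp
qed

lemma H2_eqI:
  assumes "f \<in> H2" "g \<in> H2" "\<And>n. tcoeff f n = tcoeff g n"
  shows "f = g"
proof
  fix z show "f z = g z"
    using H2_sums[OF assms(1), of z] H2_sums[OF assms(2), of z] H2_off[OF assms(1), of z]
      H2_off[OF assms(2), of z] assms(3) by (cases "z \<in> D") (auto dest: sums_unique2)
qed

lemma tcoeff_add: "f \<in> H2 \<Longrightarrow> g \<in> H2 \<Longrightarrow> tcoeff (\<lambda>z. f z + g z) n = tcoeff f n + tcoeff g n"
  by (rule tcoeff_eqI) (auto simp: distrib_right intro!: sums_add H2_sums)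

lemma tcoeff_diff: "f \<in> H2 \<Longrightarrow> g \<in> H2 \<Longrightarrow> tcoeff (\<lambda>z. f z - g z) n = tcoeff f n - tcoeff g n"
  by (rule tcoeff_eqI) (auto simp: left_diff_distrib intro!: sums_diff H2_sums)

lemma tcoeff_cmult: "f \<in> H2 \<Longrightarrow> tcoeff (\<lambda>z. c * f z) n = c * tcoeff f n"
  by (rule tcoeff_eqI) (auto simp: mult.assoc intro!: sums_mult H2_sums)

lemma tcoeff_zero [simp]: "tcoeff (\<lambda>z. 0) n = 0"
  by (rule tcoeff_eqI) auto

lemma H2_add [simp, intro]:
  assumes "f \<in> H2" "g \<in> H2" shows "(\<lambda>z. f z + g z) \<in> H2"
  using assms summable_sq_add[OF H2_summable[OF assms(1)] H2_summable[OF assms(2)]]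
  by (auto simp: H2_off H2_holo distrib_right intro!: sums_add H2_sums
      H2I[where a = "\<lambda>n. tcoeff f n + tcoeff g n"])

lemma H2_cmult [simp, intro]:
  assumes "f \<in> H2" shows "(\<lambda>z. c * f z) \<in> H2"
  using assms summable_mult[OF H2_summable[OF assms], of "(cmod c)\<^sup>2"]
  by (auto simp: H2_off mult.assoc norm_mult power_mult_distrib intro!: sums_mult H2_sums
      H2I[where a = "\<lambda>n. c * tcoeff f n"])

lemma H2_diff [simp, intro]:
  assumes "f \<in> H2" "g \<in> H2" shows "(\<lambda>z. f z - g z) \<in> H2"
  using H2_add[OF assms(1) H2_cmult[OF assms(2), of "-1"]] by simp

lemma H2_zero [simp, intro]: "(\<lambda>z. 0) \<in> H2"
  by (rule H2I[where a = "\<lambda>n. 0"]) auto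

section \<open>The shift, the backward shift and the monomials\<close>

lemma shift_apply: "shift f z = (if z \<in> D then z * f z else 0)"
  by (simp add: shift_def pmul_def)

lemma shift_series:
  assumes "f \<in> H2" "z \<in> D"
  shows "(\<lambda>n. (case n of 0 \<Rightarrow> 0 | Suc m \<Rightarrow> tcoeff f m) * z ^ n) sums shift f z"
  using sums_Suc[of "\<lambda>n. (case n of 0 \<Rightarrow> 0 | Suc m \<Rightarrow> tcoeff f m) * z ^ n" "z * f z"]
    sums_mult[OF H2_sums[OF assms], of z] assms by (simp add: shift_apply mult_ac)

lemma tcoeff_shift: "f \<in> H2 \<Longrightarrow> tcoeff (shift f) n = (case n of 0 \<Rightarrow> 0 | Suc m \<Rightarrow> tcoeff f m)"
  by (rule tcoeff_eqI) (rule shift_series)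

lemma shift_H2 [simp, intro]: "f \<in> H2 \<Longrightarrow> shift f \<in> H2"
  by (rule H2I[OF shift_series]) (auto simp: shift_apply summable_Suc_iff[symmetric, where f = "\<lambda>n. (cmod (case n of 0 \<Rightarrow> 0 | Suc m \<Rightarrow> tcoeff f m))\<^sup>2"] H2_summable simp del: summable_Suc_iff)

lemma tcoeff_0: "f \<in> H2 \<Longrightarrow> tcoeff f 0 = f 0"
  by (simp add: tcoeff_def)

text \<open>The adjoint of \<open>shift\<close> (see \<open>h2inner_shift_right\<close>). Working on
  coefficients avoids division by \<open>z\<close> at 0 and covers the case of nonzero
  \<open>f 0\<close>.\<close>

definition bshift :: "(complex \<Rightarrow> complex) \<Rightarrow> complex \<Rightarrow> complex" where
  "bshift f = pseries (\<lambda>n. tcoeff f (Suc n))"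

lemma
  assumes "f \<in> H2"
  shows bshift_H2 [simp, intro]: "bshift f \<in> H2" and tcoeff_bshift: "tcoeff (bshift f) n = tcoeff f (Suc n)"
  using H2_summable[OF assms] unfolding bshift_def
  by (auto intro!: pseries_H2 tcoeff_pseries simp: summable_Suc_iff[where f = "\<lambda>n. (cmod (tcoeff f n))\<^sup>2"])

lemma shift_bshift: "f \<in> H2 \<Longrightarrow> f 0 = 0 \<Longrightarrow> shift (bshift f) = f"
  by (rule H2_eqI) (auto simp: tcoeff_shift tcoeff_bshift bshift_H2 tcoeff_0 split: nat.split)

lemma bshift_shift: "f \<in> H2 \<Longrightarrow> bshift (shift f) = f"
  by (rule H2_eqI) (auto simp: tcoeff_shift tcoeff_bshift bshift_H2 shift_H2)

lemma bshift_add: "f \<in> H2 \<Longrightarrow> g \<in> H2 \<Longrightarrow> bshift (\<lambda>z. f z + g z) = (\<lambda>z. bshift f z + bshift g z)"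
  by (rule H2_eqI) (auto simp: tcoeff_add tcoeff_bshift bshift_H2)

lemma bshift_cmult: "f \<in> H2 \<Longrightarrow> bshift (\<lambda>z. c * f z) = (\<lambda>z. c * bshift f z)"
  by (rule H2_eqI) (auto simp: tcoeff_cmult tcoeff_bshift bshift_H2)

text \<open>The monomial \<open>z ^ k\<close>, cut off outside \<open>D\<close>; as an iterate of
  \<open>shift\<close> it fits the inductions that split off one factor \<open>z\<close>.\<close>

definition zpow :: "nat \<Rightarrow> complex \<Rightarrow> complex" where
  "zpow k = (shift ^^ k) one_H2"

lemma one_H2_sums:
  assumes "z \<in> D"
  shows "(\<lambda>n. (if n = 0 then 1 else 0) * z ^ n) sums one_H2 z"
proof -
  have "(\<lambda>n. (if n = 0 then 1 else 0) * z ^ n) = (\<lambda>n. if n \<in> {0} then z ^ n else 0)" by auto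
  then show ?thesis
    using assms sums_If_finite_set[of "{0}" "\<lambda>n. z ^ n"] by (simp add: one_H2_def)
qed

lemma tcoeff_one: "tcoeff one_H2 n = (if n = 0 then 1 else 0)"
  by (rule tcoeff_eqI[OF one_H2_sums])

lemma one_H2_H2 [simp, intro]: "one_H2 \<in> H2"
proof (rule H2I[OF one_H2_sums])
  show "summable (\<lambda>n. (cmod (if n = 0 then 1 else 0))\<^sup>2)"
    by (rule summable_finite[of "{0}"]) auto
qed (auto simp: one_H2_def)

lemma zpow_0: "zpow 0 = one_H2" and zpow_Suc: "zpow (Suc k) = shift (zpow k)"
  by (auto simp: zpow_def)

lemma zpow_H2 [simp, intro]: "zpow k \<in> H2"
  by (induction k) (auto simp: zpow_0 zpow_Suc)

lemma zpow_apply: "zpow k z = (if z \<in> D then z ^ k else 0)"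
  by (induction k) (auto simp: zpow_0 zpow_Suc one_H2_def shift_apply)

lemma tcoeff_zpow: "tcoeff (zpow k) n = (if n = k then 1 else 0)"
  by (induction k arbitrary: n) (auto simp: zpow_0 zpow_Suc tcoeff_one tcoeff_shift split: nat.split)

lemma H2_sum [simp, intro]:
  assumes "\<And>i. i \<in> I \<Longrightarrow> f i \<in> H2"
  shows "(\<lambda>z. \<Sum>i\<in>I. f i z) \<in> H2"
  using assms by (induction I rule: infinite_finite_induct) auto

lemma tcoeff_sum:
  assumes "\<And>i. i \<in> I \<Longrightarrow> f i \<in> H2"
  shows "tcoeff (\<lambda>z. \<Sum>i\<in>I. f i z) n = (\<Sum>i\<in>I. tcoeff (f i) n)"
  using assms by (induction I rule: infinite_finite_induct) (auto simp: tcoeff_add H2_sum)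

section \<open>The inner product\<close>

lemma h2norm_nonneg [simp]: "f \<in> H2 \<Longrightarrow> 0 \<le> h2norm f"
  by (simp add: h2norm_def suminf_nonneg H2_summable)

lemma h2norm_sq_sums: "f \<in> H2 \<Longrightarrow> (\<lambda>n. (cmod (tcoeff f n))\<^sup>2) sums (h2norm f)\<^sup>2"
  using H2_summable[of f] by (simp add: h2norm_def suminf_nonneg[OF H2_summable] summable_sums)

lemma h2inner_sums:
  assumes "f \<in> H2" "g \<in> H2"
  shows "(\<lambda>n. tcoeff f n * cnj (tcoeff g n)) sums h2inner f g"
proof -
  have "summable (\<lambda>n. norm (tcoeff f n * cnj (tcoeff g n)))"
    using summable_sq_mult[OF H2_summable[OF assms(1)] H2_summable[OF assms(2)]]
    by (simp add: norm_mult)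
  then show ?thesis unfolding h2inner_def by (rule summable_sums[OF summable_norm_cancel])
qed

lemma h2inner_eqI: "(\<lambda>n. tcoeff f n * cnj (tcoeff g n)) sums x \<Longrightarrow> h2inner f g = x"
  unfolding h2inner_def by (simp add: sums_iff)

lemma h2inner_add_left: "f \<in> H2 \<Longrightarrow> g \<in> H2 \<Longrightarrow> h \<in> H2 \<Longrightarrow>
    h2inner (\<lambda>z. f z + g z) h = h2inner f h + h2inner g h"
  by (rule h2inner_eqI) (auto simp: tcoeff_add distrib_right intro!: sums_add h2inner_sums)

lemma h2inner_diff_left: "f \<in> H2 \<Longrightarrow> g \<in> H2 \<Longrightarrow> h \<in> H2 \<Longrightarrow>
    h2inner (\<lambda>z. f z - g z) h = h2inner f h - h2inner g h"
  by (rule h2inner_eqI) (auto simp: tcoeff_diff left_diff_distrib intro!: sums_diff h2inner_sums)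

lemma h2inner_cmult_left: "f \<in> H2 \<Longrightarrow> h \<in> H2 \<Longrightarrow> h2inner (\<lambda>z. c * f z) h = c * h2inner f h"
  by (rule h2inner_eqI) (auto simp: tcoeff_cmult mult.assoc intro!: sums_mult h2inner_sums)

lemma h2inner_commute: "f \<in> H2 \<Longrightarrow> g \<in> H2 \<Longrightarrow> h2inner g f = cnj (h2inner f g)"
  by (rule h2inner_eqI) (use sums_cnj[THEN iffD2, OF h2inner_sums[of f g]] in \<open>simp add: mult.commute\<close>)

lemma h2inner_add_right: "f \<in> H2 \<Longrightarrow> g \<in> H2 \<Longrightarrow> h \<in> H2 \<Longrightarrow>
    h2inner h (\<lambda>z. f z + g z) = h2inner h f + h2inner h g"
  by (subst (1 2 3) h2inner_commute) (auto simp: h2inner_add_left)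

lemma h2inner_diff_right: "f \<in> H2 \<Longrightarrow> g \<in> H2 \<Longrightarrow> h \<in> H2 \<Longrightarrow>
    h2inner h (\<lambda>z. f z - g z) = h2inner h f - h2inner h g"
  by (subst (1 2 3) h2inner_commute) (auto simp: h2inner_diff_left)

lemma h2inner_cmult_right: "f \<in> H2 \<Longrightarrow> h \<in> H2 \<Longrightarrow> h2inner h (\<lambda>z. c * f z) = cnj c * h2inner h f"
  by (subst (1 2) h2inner_commute) (auto simp: h2inner_cmult_left)

lemma h2inner_zero_left [simp]: "h2inner (\<lambda>z. 0) f = 0"
  by (simp add: h2inner_def)

lemma h2inner_self: "f \<in> H2 \<Longrightarrow> h2inner f f = of_real ((h2norm f)\<^sup>2)"
  by (rule h2inner_eqI) (use sums_of_real[OF h2norm_sq_sums[of f]] in \<open>simp flip: complex_norm_square of_real_power\<close>)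

lemma h2inner_shift: "f \<in> H2 \<Longrightarrow> g \<in> H2 \<Longrightarrow> h2inner (shift f) (shift g) = h2inner f g"
  using sums_Suc[of "\<lambda>n. tcoeff (shift f) n * cnj (tcoeff (shift g) n)" "h2inner f g"] h2inner_sums[of f g]
  by (auto simp: tcoeff_shift intro: h2inner_eqI)

lemma h2norm_eqI: "f \<in> H2 \<Longrightarrow> g \<in> H2 \<Longrightarrow> h2inner f f = h2inner g g \<Longrightarrow> h2norm f = h2norm g"
  by (simp add: h2inner_self power2_eq_iff_nonneg flip: of_real_power)

lemma h2norm_shift: "f \<in> H2 \<Longrightarrow> h2norm (shift f) = h2norm f"
  by (rule h2norm_eqI) (auto simp: h2inner_shift)

lemma h2norm_add_sq:
  assumes "f \<in> H2" "g \<in> H2"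
  shows "(h2norm (\<lambda>z. f z + g z))\<^sup>2 = (h2norm f)\<^sup>2 + (h2norm g)\<^sup>2 + 2 * Re (h2inner f g)"
proof -
  have "h2inner (\<lambda>z. f z + g z) (\<lambda>z. f z + g z) = h2inner f f + h2inner g g + h2inner f g + cnj (h2inner f g)"
    using assms by (simp add: h2inner_add_left h2inner_add_right H2_add flip: h2inner_commute[OF assms])
  from arg_cong[where f = Re, OF this] show ?thesis
    using assms by (simp add: h2inner_self H2_add del: of_real_power)
qed

lemma h2norm_diff_sq:
  assumes "f \<in> H2" "g \<in> H2"
  shows "(h2norm (\<lambda>z. f z - g z))\<^sup>2 = (h2norm f)\<^sup>2 + (h2norm g)\<^sup>2 - 2 * Re (h2inner f g)"
proof -
  have "h2inner (\<lambda>z. f z - g z) (\<lambda>z. f z - g z) = h2inner f f + h2inner g g - h2inner f g - cnj (h2inner f g)"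
    using assms by (simp add: h2inner_diff_left h2inner_diff_right H2_diff flip: h2inner_commute[OF assms])
  from arg_cong[where f = Re, OF this] show ?thesis
    using assms by (simp add: h2inner_self H2_diff del: of_real_power)
qed

text \<open>The finite inequality \<open>L2_set_mult_ineq\<close> applies to partial sums, whose
  \<open>L2_set\<close> norms are at most the full norms.\<close>

lemma h2_cauchy_schwarz:
  assumes "f \<in> H2" "g \<in> H2"
  shows "cmod (h2inner f g) \<le> h2norm f * h2norm g"
proof -
  let ?a = "\<lambda>n. cmod (tcoeff f n)" and ?b = "\<lambda>n. cmod (tcoeff g n)"
  have s: "summable (\<lambda>n. ?a n * ?b n)"
    by (intro summable_sq_mult H2_summable assms)
  have L: "L2_set (\<lambda>n. cmod (tcoeff h n)) {..<n} \<le> h2norm h" if "h \<in> H2" for h n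
    unfolding L2_set_def h2norm_def
    by (intro real_sqrt_le_mono sum_le_suminf H2_summable that) auto
  have "cmod (h2inner f g) \<le> (\<Sum>n. ?a n * ?b n)"
    unfolding h2inner_def using summable_norm[of "\<lambda>n. tcoeff f n * cnj (tcoeff g n)"] s
    by (simp add: norm_mult)
  also have "\<dots> \<le> h2norm f * h2norm g"
  proof (rule suminf_le_const[OF s])
    fix n
    have "(\<Sum>i<n. ?a i * ?b i) \<le> L2_set ?a {..<n} * L2_set ?b {..<n}"
      using L2_set_mult_ineq[of ?a ?b "{..<n}"] by simp
    also have "\<dots> \<le> h2norm f * h2norm g"
      by (intro mult_mono L assms) (auto simp: assms)
    finally show "(\<Sum>i<n. ?a i * ?b i) \<le> h2norm f * h2norm g" .
  qed
  finally show ?thesis .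
qed

lemma h2norm_triangle:
  assumes "f \<in> H2" "g \<in> H2"
  shows "h2norm (\<lambda>z. f z + g z) \<le> h2norm f + h2norm g"
proof (rule power2_le_imp_le)
  have "Re (h2inner f g) \<le> h2norm f * h2norm g"
    using h2_cauchy_schwarz[OF assms] complex_Re_le_cmod order_trans by blast
  then show "(h2norm (\<lambda>z. f z + g z))\<^sup>2 \<le> (h2norm f + h2norm g)\<^sup>2"
    by (simp add: h2norm_add_sq[OF assms] power2_sum)
qed (simp add: assms)

lemma h2norm_cmult: "f \<in> H2 \<Longrightarrow> h2norm (\<lambda>z. c * f z) = cmod c * h2norm f"
  unfolding h2norm_def
  by (simp add: tcoeff_cmult norm_mult power_mult_distrib suminf_mult H2_summable real_sqrt_mult)

lemma h2norm_minus_commute: "f \<in> H2 \<Longrightarrow> g \<in> H2 \<Longrightarrow> h2norm (\<lambda>z. f z - g z) = h2norm (\<lambda>z. g z - f z)"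
  unfolding h2norm_def by (simp add: tcoeff_diff norm_minus_commute)

lemma h2norm_diff_ge:
  assumes "f \<in> H2" "g \<in> H2"
  shows "\<bar>h2norm f - h2norm g\<bar> \<le> h2norm (\<lambda>z. f z - g z)"
  using h2norm_triangle[OF H2_diff[OF assms] assms(2)] h2norm_triangle[OF H2_diff[OF assms(2,1)] assms(1)]
    h2norm_minus_commute[OF assms] by simp

lemma h2norm_diff_triangle:
  assumes "f \<in> H2" "g \<in> H2" "h \<in> H2"
  shows "h2norm (\<lambda>z. f z - h z) \<le> h2norm (\<lambda>z. f z - g z) + h2norm (\<lambda>z. g z - h z)"
  using h2norm_triangle[OF H2_diff[OF assms(1,2)] H2_diff[OF assms(2,3)]] by simp

lemma h2norm_zero_iff: "f \<in> H2 \<Longrightarrow> h2norm f = 0 \<longleftrightarrow> f = (\<lambda>z. 0)"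
proof
  assume f: "f \<in> H2" and "h2norm f = 0"
  then have "(\<Sum>n. (cmod (tcoeff f n))\<^sup>2) = 0" by (simp add: h2norm_def)
  then have "\<forall>n. (cmod (tcoeff f n))\<^sup>2 = 0"
    using suminf_eq_zero_iff[OF H2_summable[OF f]] by simp
  then show "f = (\<lambda>z. 0)" by (intro H2_eqI f) auto
qed (simp add: h2norm_def)

lemma h2norm_ge_coeff: "f \<in> H2 \<Longrightarrow> cmod (tcoeff f n) \<le> h2norm f"
  unfolding h2norm_def using sum_le_suminf[OF H2_summable, of f "{n}"]
  by (intro real_le_rsqrt) auto

lemma h2norm_one: "h2norm one_H2 = 1"
proof -
  have "(\<lambda>n. (cmod (tcoeff one_H2 n))\<^sup>2) = (\<lambda>n. if n \<in> {0} then 1 else 0)"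
    by (auto simp: tcoeff_one)
  then have "(\<lambda>n. (cmod (tcoeff one_H2 n))\<^sup>2) sums 1"
    using sums_If_finite_set[of "{0::nat}" "\<lambda>n. 1::real"] by simp
  then show ?thesis by (simp add: h2norm_def sums_iff)
qed

text \<open>Cauchy-Schwarz against the Szego kernel \<open>k\<close> at \<open>z\<close>, which
  reproduces \<open>f z\<close> and has norm \<open>1 / sqrt (1 - (cmod z)\<^sup>2)\<close>.\<close>

lemma H2_point_bound:
  assumes "f \<in> H2" "z \<in> D"
  shows "cmod (f z) \<le> h2norm f / sqrt (1 - (cmod z)\<^sup>2)"
proof -
  have z: "(cmod z)\<^sup>2 < 1" using assms(2) by (simp add: abs_square_less_1)
  define k where "k = pseries (\<lambda>n. cnj z ^ n)"
  have g: "(\<lambda>n. (cmod (cnj z ^ n))\<^sup>2) sums (1 / (1 - (cmod z)\<^sup>2))"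
    using geometric_sums[of "(cmod z)\<^sup>2"] z by (simp add: norm_power power_swap[of _ _ 2])
  have k: "k \<in> H2" "\<And>n. tcoeff k n = cnj z ^ n"
    unfolding k_def using g by (auto intro!: pseries_H2 tcoeff_pseries simp: sums_iff)
  have "h2norm k = 1 / sqrt (1 - (cmod z)\<^sup>2)"
    unfolding h2norm_def using g by (simp add: k sums_iff real_sqrt_divide)
  moreover have "h2inner f k = f z"
    by (rule h2inner_eqI) (use H2_sums[OF assms] in \<open>simp add: k\<close>)
  ultimately show ?thesis using h2_cauchy_schwarz[OF assms(1) k(1)] by simp
qed

lemma H2_pointwise_limit:
  assumes "\<And>n. x n \<in> H2" "f \<in> H2" "(\<lambda>n. h2norm (\<lambda>z. x n z - f z)) \<longlonglongrightarrow> 0"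
  shows "(\<lambda>n. x n z) \<longlonglongrightarrow> f z"
proof (cases "z \<in> D")
  case True
  have "(\<lambda>n. h2norm (\<lambda>z. x n z - f z) / sqrt (1 - (cmod z)\<^sup>2)) \<longlonglongrightarrow> 0 / sqrt (1 - (cmod z)\<^sup>2)"
    using True abs_square_eq_1[of "cmod z"] by (intro tendsto_intros assms(3)) auto
  then have "(\<lambda>n. x n z - f z) \<longlonglongrightarrow> 0"
    by (intro Lim_null_comparison[where f = "\<lambda>n. x n z - f z"])
       (use H2_point_bound[OF H2_diff[OF assms(1,2)] True] in auto)
  then show ?thesis by (simp flip: Lim_null)
qed (simp add: H2_off assms)

lemma tendsto_h2norm:
  assumes "\<And>n. x n \<in> H2" "f \<in> H2" "(\<lambda>n. h2norm (\<lambda>z. x n z - f z)) \<longlonglongrightarrow> 0"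
  shows "(\<lambda>n. h2norm (x n)) \<longlonglongrightarrow> h2norm f"
proof -
  have "(\<lambda>n. h2norm (x n) - h2norm f) \<longlonglongrightarrow> 0"
    by (rule Lim_null_comparison[OF _ assms(3)]) (use h2norm_diff_ge[OF assms(1,2)] in auto)
  then show ?thesis by (simp flip: Lim_null)
qed

text \<open>Coefficients are bounded by the norm, so each coefficient sequence is Cauchy; the series
  with the limiting coefficients \<open>a\<close> is the candidate.\<close>

theorem H2_complete:
  assumes x: "\<And>n. x n \<in> H2"
    and cau: "\<And>e. e > 0 \<Longrightarrow> \<exists>N. \<forall>m\<ge>N. \<forall>n\<ge>N. h2norm (\<lambda>z. x m z - x n z) < e"
  obtains f where "f \<in> H2" "(\<lambda>n. h2norm (\<lambda>z. x n z - f z)) \<longlonglongrightarrow> 0"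
proof -
  have "Cauchy (\<lambda>n. tcoeff (x n) k)" for k
  proof (rule metric_CauchyI)
    fix e :: real assume "e > 0"
    from cau[OF this] obtain N where N: "\<forall>m\<ge>N. \<forall>n\<ge>N. h2norm (\<lambda>z. x m z - x n z) < e" by blast
    have "dist (tcoeff (x m) k) (tcoeff (x n) k) < e" if "m \<ge> N" "n \<ge> N" for m n
      using h2norm_ge_coeff[OF H2_diff[OF x[of m] x[of n]], of k] N that
      by (force simp: tcoeff_diff x dist_norm)
    then show "\<exists>M. \<forall>m\<ge>M. \<forall>n\<ge>M. dist (tcoeff (x m) k) (tcoeff (x n) k) < e" by blast
  qed
  then have "\<forall>k. \<exists>l. (\<lambda>n. tcoeff (x n) k) \<longlonglongrightarrow> l"
    using Cauchy_convergent convergent_def by blast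
  then obtain a where a: "\<And>k. (\<lambda>n. tcoeff (x n) k) \<longlonglongrightarrow> a k" by metis
  \<comment> \<open>A finite section of the squared norm of \<open>x n - x m\<close> is continuous
    in the coefficients, so \<open>m\<close> may tend to infinity there. The bound does not depend
    on \<open>K\<close>, hence holds for the full series.\<close>
  have fin: "(\<Sum>k<K. (cmod (tcoeff (x n) k - a k))\<^sup>2) \<le> e\<^sup>2"
    if "\<forall>m\<ge>N. \<forall>n\<ge>N. h2norm (\<lambda>z. x m z - x n z) < e" "n \<ge> N" for e N n K
  proof (rule tendsto_upperbound)
    show "(\<lambda>m. \<Sum>k<K. (cmod (tcoeff (x n) k - tcoeff (x m) k))\<^sup>2) \<longlonglongrightarrow> (\<Sum>k<K. (cmod (tcoeff (x n) k - a k))\<^sup>2)"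
      by (intro tendsto_intros a)
    have "(\<Sum>k<K. (cmod (tcoeff (x n) k - tcoeff (x m) k))\<^sup>2) \<le> e\<^sup>2" if "m \<ge> N" for m
    proof -
      have "(\<Sum>k<K. (cmod (tcoeff (x n) k - tcoeff (x m) k))\<^sup>2) \<le> (h2norm (\<lambda>z. x n z - x m z))\<^sup>2"
        using sum_le_suminf[OF H2_summable[OF H2_diff[OF x[of n] x[of m]]], of "{..<K}"]
          h2norm_sq_sums[OF H2_diff[OF x[of n] x[of m]]] by (simp add: tcoeff_diff x sums_iff)
      also have "\<dots> \<le> e\<^sup>2" using that \<open>n \<ge> N\<close> \<open>\<forall>m\<ge>N. \<forall>n\<ge>N. _ m n\<close> by (intro power_mono) (auto intro: less_imp_le simp: x)
      finally show ?thesis .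
    qed
    then show "\<forall>\<^sub>F m in sequentially. (\<Sum>k<K. (cmod (tcoeff (x n) k - tcoeff (x m) k))\<^sup>2) \<le> e\<^sup>2"
      by (auto simp: eventually_sequentially)
  qed auto
  have sm: "summable (\<lambda>k. (cmod (tcoeff (x n) k - a k))\<^sup>2)" and
    le: "(\<Sum>k. (cmod (tcoeff (x n) k - a k))\<^sup>2) \<le> e\<^sup>2"
    if "\<forall>m\<ge>N. \<forall>n\<ge>N. h2norm (\<lambda>z. x m z - x n z) < e" "n \<ge> N" for e N n
  proof -
    show "summable (\<lambda>k. (cmod (tcoeff (x n) k - a k))\<^sup>2)"
      by (rule summableI_nonneg_bounded[where x = "e\<^sup>2"]) (use fin[OF that] in auto)
    then show "(\<Sum>k. (cmod (tcoeff (x n) k - a k))\<^sup>2) \<le> e\<^sup>2"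
      by (rule suminf_le_const) (use fin[OF that] in auto)
  qed
  from cau[of 1] obtain N where "\<forall>m\<ge>N. \<forall>n\<ge>N. h2norm (\<lambda>z. x m z - x n z) < 1" by auto
  from sm[OF this order_refl] have "summable (\<lambda>k. (cmod (a k - tcoeff (x N) k))\<^sup>2)"
    by (simp add: norm_minus_commute)
  from summable_sq_add[OF this H2_summable[OF x[of N]]]
  have sa: "summable (\<lambda>k. (cmod (a k))\<^sup>2)" by simp
  define f where "f = pseries a"
  have f: "f \<in> H2" "\<And>k. tcoeff f k = a k"
    unfolding f_def using sa by (auto simp: pseries_H2 tcoeff_pseries)
  have "(\<lambda>n. h2norm (\<lambda>z. x n z - f z)) \<longlonglongrightarrow> 0"
  proof (rule LIMSEQ_I)
    fix r :: real assume "r > 0"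
    from cau[of "r/2"] this obtain N where N: "\<forall>m\<ge>N. \<forall>n\<ge>N. h2norm (\<lambda>z. x m z - x n z) < r/2" by auto
    have "h2norm (\<lambda>z. x n z - f z) \<le> r/2" if "n \<ge> N" for n
      unfolding h2norm_def using le[OF N that] \<open>r > 0\<close>
      by (intro real_le_lsqrt) (simp_all add: tcoeff_diff x f)
    then have "norm (h2norm (\<lambda>z. x n z - f z) - 0) < r" if "n \<ge> N" for n
      using that \<open>r > 0\<close> h2norm_nonneg[OF H2_diff[OF x[of n] f(1)]] by fastforce
    then show "\<exists>N. \<forall>n\<ge>N. norm (h2norm (\<lambda>z. x n z - f z) - 0) < r" by blast
  qed
  with f(1) show ?thesis by (rule that)
qed

section \<open>Circle means\<close>

text \<open>Angles on the circle, unnormalized: the total mass is \<open>2 * pi\<close>, whence the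
  factors \<open>2 * pi\<close> below. The doubled endpoint is a null set.\<close>

definition circ :: "real measure" where
  "circ = restrict_space lborel {0..2*pi}"

lemma space_circ [simp]: "space circ = {0..2*pi}"
  by (simp add: circ_def space_restrict_space)

lemma emeasure_circ_space: "emeasure circ {0..2*pi} = ennreal (2*pi)"
  by (simp add: circ_def emeasure_restrict_space)

interpretation circ: finite_measure circ
  by standard (simp add: emeasure_circ_space)

lemma measurable_circ [measurable_dest]: "f \<in> borel_measurable borel \<Longrightarrow> f \<in> borel_measurable circ"
  unfolding circ_def by (rule measurable_restrict_space1) simp

lemma measurable_circ_cont: "continuous_on UNIV f \<Longrightarrow> f \<in> borel_measurable circ"
  by (rule measurable_circ) (rule borel_measurable_continuous_onI)

lemma integrable_circ_cont:
  fixes f :: "real \<Rightarrow> 'a::{banach, second_countable_topology}"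
  assumes "continuous_on UNIV f"
  shows "integrable circ f"
proof -
  have "bounded (f ` {0..2*pi})"
    using assms by (intro compact_imp_bounded compact_continuous_image) (auto intro: continuous_on_subset)
  then obtain B where "\<And>t. t \<in> {0..2*pi} \<Longrightarrow> norm (f t) \<le> B"
    unfolding bounded_iff by (metis imageI)
  then show ?thesis
    by (intro circ.integrable_const_bound[where B = B] measurable_circ_cont assms) auto
qed

lemma circ_has_integral:
  fixes f :: "real \<Rightarrow> 'a::euclidean_space"
  assumes "continuous_on UNIV f"
  shows "(f has_integral integral\<^sup>L circ f) {0..2*pi}"
proof -
  have "integrable lborel (\<lambda>t. indicator {0..2*pi} t *\<^sub>R f t)"
    using integrable_circ_cont[OF assms] unfolding circ_def
    by (subst (asm) integrable_restrict_space) auto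
  from has_integral_integral_lborel[OF this]
  have "((\<lambda>t. indicator {0..2*pi} t *\<^sub>R f t) has_integral integral\<^sup>L circ f) UNIV"
    unfolding circ_def by (subst integral_restrict_space) auto
  moreover have "(\<lambda>t. indicator {0..2*pi} t *\<^sub>R f t) = (\<lambda>t. if t \<in> {0..2*pi} then f t else 0)"
    by (auto simp: indicator_def)
  ultimately show ?thesis by (simp only: has_integral_restrict_UNIV)
qed

lemma circ_integral_cis: "integral\<^sup>L circ (\<lambda>t. cis (of_int k * t)) = (if k = 0 then 2 * pi else 0)"
proof (cases "k = 0")
  case True
  have "((\<lambda>t. 1::complex) has_integral of_real (2 * pi)) {0..2*pi}"
    using has_integral_const_real[of "1::complex" 0 "2*pi"] by (simp add: scaleR_conv_of_real)
  with circ_has_integral[of "\<lambda>t. 1::complex"] have "integral\<^sup>L circ (\<lambda>t. 1::complex) = of_real (2 * pi)"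
    by (auto intro: has_integral_unique)
  then show ?thesis using True by simp
next
  case False
  have ii: "- (\<i> * (x * \<i>)) = x" for x
    by (simp add: mult.left_commute[of \<i> x])
  define F where "F = (\<lambda>t. cis (of_int k * t) / (\<i> * of_int k))"
  have "((\<lambda>t. cis (of_int k * t)) has_integral F (2*pi) - F 0) {0..2*pi}"
  proof (rule fundamental_theorem_of_calculus)
    fix t :: real
    have "((\<lambda>z. exp (\<i> * (of_int k * z)) / (\<i> * of_int k)) has_field_derivative exp (\<i> * (of_int k * of_real t))) (at (of_real t))"
      using False by (auto intro!: derivative_eq_intros simp: ii)
    from has_vector_derivative_real_field[OF this]
    show "(F has_vector_derivative cis (of_int k * t)) (at t within {0..2*pi})"
      by (simp add: F_def cis_conv_exp)
  qed auto
  moreover have "F (2*pi) = F 0"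
    using cis_multiple_2pi[of "of_int k"] by (simp add: F_def mult_ac)
  moreover have "continuous_on UNIV (\<lambda>t. cis (of_int k * t))"
    by (auto simp: cis_conv_exp intro!: continuous_intros)
  ultimately show ?thesis
    using False circ_has_integral[of "\<lambda>t. cis (of_int k * t)"] by (auto dest: has_integral_unique)
qed

text \<open>Absolute summability of \<open>c\<close> and the common bound \<open>B\<close> dominate
  the series, so that \<open>sums_integral\<close> interchanges sum and integral.\<close>

lemma circ_integral_series:
  fixes u :: "nat \<Rightarrow> real \<Rightarrow> complex"
  assumes c: "summable (\<lambda>n. norm (c n))" and u: "\<And>n. continuous_on UNIV (u n)"
    and B: "\<And>n t. t \<in> {0..2*pi} \<Longrightarrow> norm (u n t) \<le> B"
  shows "(\<lambda>n. c n * integral\<^sup>L circ (u n)) sums integral\<^sup>L circ (\<lambda>t. \<Sum>n. c n * u n t)"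
proof -
  have B0: "B \<ge> 0" using order_trans[OF norm_ge_zero B[of 0 0]] by simp
  have 1: "integrable circ (\<lambda>t. c n * u n t)" for n
    by (intro integrable_mult_right integrable_circ_cont u)
  have s: "summable (\<lambda>n. norm (c n) * B)" by (intro summable_mult2 c)
  have 2: "AE t in circ. summable (\<lambda>n. norm (c n * u n t))"
  proof (rule AE_I2)
    fix t assume "t \<in> space circ"
    then show "summable (\<lambda>n. norm (c n * u n t))"
      by (intro summable_comparison_test'[OF s, of 0]) (auto simp: norm_mult intro!: mult_left_mono B)
  qed
  have 3: "summable (\<lambda>n. \<integral>t. norm (c n * u n t) \<partial>circ)"
  proof (rule summable_comparison_test'[where N = 0])
    show "summable (\<lambda>n. norm (c n) * B * (2 * pi))" by (intro summable_mult2 s)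
    fix n
    have "(\<integral>t. norm (c n * u n t) \<partial>circ) \<le> (\<integral>t. norm (c n) * B \<partial>circ)"
      by (intro integral_mono integrable_norm 1) (auto simp: norm_mult intro!: mult_left_mono B)
    also have "\<dots> = norm (c n) * B * (2 * pi)"
      using emeasure_circ_space by (simp add: measure_def)
    finally show "norm (\<integral>t. norm (c n * u n t) \<partial>circ) \<le> norm (c n) * B * (2 * pi)"
      by (simp add: integral_nonneg_AE)
  qed
  have "(\<lambda>n. \<integral>t. c n * u n t \<partial>circ) sums (\<integral>t. (\<Sum>n. c n * u n t) \<partial>circ)"
    by (rule sums_integral[OF 1 2 3])
  then show ?thesis by simp
qed

section \<open>Means over circles of radius below 1\<close>

lemma holo_abs_summable:
  assumes "f holomorphic_on D" "0 \<le> r" "r < 1"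
  shows "summable (\<lambda>n. norm (tcoeff f n * of_real r ^ n))"
proof (rule powser_insidea)
  \<comment> \<open>Convergence at the larger radius \<open>(r + 1) / 2\<close>, still below 1,
    forces absolute convergence at \<open>r\<close>.\<close>
  show "summable (\<lambda>n. tcoeff f n * of_real ((r + 1) / 2) ^ n)"
    using tcoeff_sums[OF assms(1), of "of_real ((r + 1) / 2)"] assms
    by (auto simp: sums_iff simp del: of_real_add of_real_divide)
qed (use assms in \<open>auto simp del: of_real_add of_real_divide\<close>)

lemma continuous_circle:
  assumes "f holomorphic_on D" "0 \<le> r" "r < 1"
  shows "continuous_on UNIV (\<lambda>t. f (of_real r * cis t))"
proof (rule continuous_on_compose2[of D f])
  show "continuous_on D f" using assms holomorphic_on_imp_continuous_on by blast
qed (use assms in \<open>auto simp: norm_mult cis_conv_exp intro!: continuous_intros\<close>)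

text \<open>Parseval's identity. Orthogonality of the exponentials gives the Fourier coefficients of
  \<open>g\<close> (\<open>coef\<close>). Then \<open>cnj g * g\<close> is integrated with only
  \<open>cnj g\<close> expanded, so that every term is again a Fourier coefficient of
  \<open>g\<close>.\<close>

lemma circle_mean:
  assumes f: "f holomorphic_on D" and r: "0 \<le> r" "r < 1"
  shows "(\<lambda>n. (cmod (tcoeff f n))\<^sup>2 * r ^ (2*n)) sums ((\<integral>t. (cmod (f (of_real r * cis t)))\<^sup>2 \<partial>circ) / (2*pi))"
proof -
  define c where "c n = tcoeff f n * of_real r ^ n" for n
  define g where "g t = f (of_real r * cis t)" for t
  have c: "summable (\<lambda>n. norm (c n))" unfolding c_def by (rule holo_abs_summable[OF assms])
  have g: "continuous_on UNIV g" unfolding g_def by (rule continuous_circle[OF assms])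
  have gs: "(\<lambda>n. c n * cis (of_int (int n) * t)) sums g t" for t
    using tcoeff_sums[OF f, of "of_real r * cis t"] r
    by (simp add: c_def g_def norm_mult power_mult_distrib mult.assoc Complex.DeMoivre)
  have cc: "continuous_on UNIV (\<lambda>t. cis (of_int k * t))" for k
    by (auto simp: cis_conv_exp intro!: continuous_intros)
  have coef: "(\<integral>t. cis (- of_int (int n) * t) * g t \<partial>circ) = 2 * pi * c n" for n
  proof -
    have "(\<lambda>m. c m * (\<integral>t. cis (of_int (int m - int n) * t) \<partial>circ)) sums
      (\<integral>t. (\<Sum>m. c m * cis (of_int (int m - int n) * t)) \<partial>circ)"
      by (rule circ_integral_series[OF c cc, where B = 1]) auto
    moreover have "(\<Sum>m. c m * cis (of_int (int m - int n) * t)) = cis (- of_int (int n) * t) * g t" for t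
    proof -
      have "c m * cis (of_int (int m - int n) * t) = cis (- of_int (int n) * t) * (c m * cis (of_int (int m) * t))" for m
        by (simp add: mult.left_commute[of _ "c m"] cis_mult del: mult_cancel_left) (simp add: algebra_simps)
      then show ?thesis using sums_mult[OF gs[of t], of "cis (- of_int (int n) * t)"] by (simp only: sums_iff)
    qed
    moreover have "(\<lambda>m. c m * (\<integral>t. cis (of_int (int m - int n) * t) \<partial>circ)) sums (2 * pi * c n)"
    proof -
      have "(\<lambda>m. c m * (\<integral>t. cis (of_int (int m - int n) * t) \<partial>circ)) = (\<lambda>m. if m \<in> {n} then 2 * pi * c m else 0)"
        by (rule ext) (simp only: circ_integral_cis, simp)
      then show ?thesis using sums_If_finite_set[of "{n}" "\<lambda>m. 2 * pi * c m"] by simp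
    qed
    ultimately show ?thesis by (auto dest: sums_unique2)
  qed
  have "bounded (g ` {0..2*pi})"
    using g by (intro compact_imp_bounded compact_continuous_image) (auto intro: continuous_on_subset)
  then obtain B where B: "\<And>t. t \<in> {0..2*pi} \<Longrightarrow> norm (g t) \<le> B"
    unfolding bounded_iff by (metis imageI)
  have "(\<lambda>n. cnj (c n) * (\<integral>t. cis (- of_int (int n) * t) * g t \<partial>circ)) sums
      (\<integral>t. (\<Sum>n. cnj (c n) * (cis (- of_int (int n) * t) * g t)) \<partial>circ)"
    by (rule circ_integral_series[where B = B])
       (use c B g in \<open>auto simp: norm_mult cis_conv_exp intro!: continuous_intros\<close>)
  moreover have "(\<Sum>n. cnj (c n) * (cis (- of_int (int n) * t) * g t)) = of_real ((cmod (g t))\<^sup>2)" for t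
  proof -
    have "(\<lambda>n. cnj (c n * cis (of_int (int n) * t)) * g t) sums (cnj (g t) * g t)"
      by (intro sums_mult2) (use gs[of t] in \<open>simp only: sums_cnj\<close>)
    moreover have "cnj (c n * cis (of_int (int n) * t)) * g t = cnj (c n) * (cis (- of_int (int n) * t) * g t)" for n
      by (simp add: cis_cnj)
    moreover have "cnj (g t) * g t = of_real ((cmod (g t))\<^sup>2)"
      by (subst complex_norm_square) (simp add: mult.commute)
    ultimately show ?thesis by (simp only: sums_iff)
  qed
  moreover have "cnj (c n) * (\<integral>t. cis (- of_int (int n) * t) * g t \<partial>circ) = of_real (2 * pi * (cmod (c n))\<^sup>2)" for n
    unfolding coef by (simp add: complex_norm_square mult_ac del: of_real_power flip: of_real_power)
  ultimately have "(\<lambda>n. complex_of_real (2 * pi * (cmod (c n))\<^sup>2)) sums of_real (\<integral>t. (cmod (g t))\<^sup>2 \<partial>circ)"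
    by (simp only: integral_complex_of_real)
  then have "(\<lambda>n. 2 * pi * (cmod (c n))\<^sup>2) sums (\<integral>t. (cmod (g t))\<^sup>2 \<partial>circ)"
    by (simp only: sums_of_real_iff)
  from sums_divide[OF this, of "2*pi"]
  have "(\<lambda>n. (cmod (c n))\<^sup>2) sums ((\<integral>t. (cmod (g t))\<^sup>2 \<partial>circ) / (2*pi))" by simp
  moreover have "(cmod (c n))\<^sup>2 = (cmod (tcoeff f n))\<^sup>2 * r ^ (2*n)" for n
    using r by (simp add: c_def norm_mult norm_power power_mult_distrib power_mult power_swap[of _ n 2])
  ultimately show ?thesis by (simp add: g_def)
qed

lemma circle_mean_le:
  assumes "f \<in> H2" "0 \<le> r" "r < 1"
  shows "(\<integral>t. (cmod (f (of_real r * cis t)))\<^sup>2 \<partial>circ) \<le> 2 * pi * (h2norm f)\<^sup>2"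
proof -
  have "(\<integral>t. (cmod (f (of_real r * cis t)))\<^sup>2 \<partial>circ) / (2*pi) \<le> (h2norm f)\<^sup>2"
  proof (rule sums_le[OF _ circle_mean[OF H2_holo[OF assms(1)] assms(2,3)] h2norm_sq_sums[OF assms(1)]])
    show "(cmod (tcoeff f n))\<^sup>2 * r ^ (2 * n) \<le> (cmod (tcoeff f n))\<^sup>2" for n
      using power_le_one[of r "2*n"] assms by (intro mult_left_le) auto
  qed
  then show ?thesis by (simp add: field_simps)
qed

text \<open>By Parseval, each finite partial sum with weights \<open>r ^ (2*n)\<close> is at most
  the bound; letting \<open>r\<close> tend to 1 removes the weights.\<close>

lemma H2_of_circle_means:
  assumes f: "f holomorphic_on D" and off: "\<And>z. z \<notin> D \<Longrightarrow> f z = 0" and "0 \<le> B"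
    and le: "\<And>r. 0 \<le> r \<Longrightarrow> r < 1 \<Longrightarrow> (\<integral>t. (cmod (f (of_real r * cis t)))\<^sup>2 \<partial>circ) \<le> 2 * pi * B\<^sup>2"
  shows "f \<in> H2" "h2norm f \<le> B"
proof -
  have fin: "(\<Sum>n<N. (cmod (tcoeff f n))\<^sup>2) \<le> B\<^sup>2" for N
  proof (rule tendsto_upperbound)
    show "((\<lambda>r::real. \<Sum>n<N. (cmod (tcoeff f n))\<^sup>2 * r ^ (2*n)) \<longlongrightarrow> (\<Sum>n<N. (cmod (tcoeff f n))\<^sup>2)) (at_left 1)"
      by (rule tendsto_eq_intros | simp)+
    have "(\<Sum>n<N. (cmod (tcoeff f n))\<^sup>2 * r ^ (2*n)) \<le> B\<^sup>2" if "r \<in> {0<..<1}" for r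
    proof -
      have *: "(\<lambda>n. (cmod (tcoeff f n))\<^sup>2 * r ^ (2*n)) sums ((\<integral>t. (cmod (f (of_real r * cis t)))\<^sup>2 \<partial>circ) / (2*pi))"
        using that by (intro circle_mean f) auto
      have "(\<Sum>n<N. (cmod (tcoeff f n))\<^sup>2 * r ^ (2*n)) \<le> (\<integral>t. (cmod (f (of_real r * cis t)))\<^sup>2 \<partial>circ) / (2*pi)"
        using * that by (subst sums_unique[OF *], intro sum_le_suminf) (auto simp: sums_iff)
      also have "\<dots> \<le> B\<^sup>2" using le[of r] that by (simp add: field_simps)
      finally show ?thesis .
    qed
    then show "\<forall>\<^sub>F r in at_left 1. (\<Sum>n<N. (cmod (tcoeff f n))\<^sup>2 * r ^ (2*n)) \<le> B\<^sup>2"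
      by (rule eventually_mono[OF eventually_at_left_real[of 0 1], rotated]) auto
  qed auto
  have s: "summable (\<lambda>n. (cmod (tcoeff f n))\<^sup>2)"
    by (rule summableI_nonneg_bounded[where x = "B\<^sup>2"]) (use fin in auto)
  then show "f \<in> H2" using f off by (simp add: H2_def)
  show "h2norm f \<le> B" unfolding h2norm_def
    by (rule real_le_lsqrt) (use suminf_le_const[OF s fin] \<open>0 \<le> B\<close> in auto)
qed

section \<open>Multiplication by bounded functions\<close>

lemma pmul_holo: "u holomorphic_on D \<Longrightarrow> f holomorphic_on D \<Longrightarrow> pmul u f holomorphic_on D"
  by (rule holomorphic_transform[of "\<lambda>z. u z * f z"]) (auto simp: pmul_def intro: holomorphic_on_mult)

text \<open>The pointwise bound passes to the circle means, which \<open>H2_of_circle_means\<close>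
  turns back into membership and a norm bound.\<close>

lemma pmul_bounded:
  assumes u: "u holomorphic_on D" "\<And>z. z \<in> D \<Longrightarrow> cmod (u z) \<le> d" and "d \<ge> 0" and f: "f \<in> H2"
  shows "pmul u f \<in> H2" "h2norm (pmul u f) \<le> d * h2norm f"
proof -
  have "(\<integral>t. (cmod (pmul u f (of_real r * cis t)))\<^sup>2 \<partial>circ) \<le> 2 * pi * (d * h2norm f)\<^sup>2"
    if r: "0 \<le> r" "r < 1" for r
  proof -
    have "(\<integral>t. (cmod (pmul u f (of_real r * cis t)))\<^sup>2 \<partial>circ) \<le> (\<integral>t. d\<^sup>2 * (cmod (f (of_real r * cis t)))\<^sup>2 \<partial>circ)"
    proof (rule integral_mono)
      show "integrable circ (\<lambda>t. (cmod (pmul u f (of_real r * cis t)))\<^sup>2)"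
        by (intro integrable_circ_cont continuous_intros continuous_circle pmul_holo u H2_holo f r)
      show "integrable circ (\<lambda>t. d\<^sup>2 * (cmod (f (of_real r * cis t)))\<^sup>2)"
        by (intro integrable_circ_cont continuous_intros continuous_circle H2_holo f r)
      fix t
      have "cmod (pmul u f (of_real r * cis t)) \<le> d * cmod (f (of_real r * cis t))"
        using r u(2)[of "of_real r * cis t"] by (auto simp: pmul_def norm_mult intro: mult_right_mono)
      then show "(cmod (pmul u f (of_real r * cis t)))\<^sup>2 \<le> d\<^sup>2 * (cmod (f (of_real r * cis t)))\<^sup>2"
        by (metis norm_ge_zero power_mono power_mult_distrib)
    qed
    also have "\<dots> \<le> d\<^sup>2 * (2 * pi * (h2norm f)\<^sup>2)"
      using circle_mean_le[OF f r] by (simp add: mult_left_mono)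
    finally show ?thesis by (simp add: power_mult_distrib mult_ac)
  qed
  from H2_of_circle_means[OF _ _ _ this] show "pmul u f \<in> H2" "h2norm (pmul u f) \<le> d * h2norm f"
    using assms by (auto simp: pmul_holo H2_holo, simp_all add: pmul_def)
qed

section \<open>The Poisson kernel\<close>

definition poisson :: "complex \<Rightarrow> real \<Rightarrow> real" where
  "poisson z s = (1 - (cmod z)\<^sup>2) / (cmod (cis s - z))\<^sup>2"

lemma continuous_cis: "continuous_on S cis"
  by (auto simp: cis_conv_exp[abs_def] intro!: continuous_intros)

lemma cis_measurable [measurable]: "cis \<in> borel_measurable borel"
  by (rule borel_measurable_continuous_onI) (rule continuous_cis)

lemma cis_minus_neq_0: "cmod z < 1 \<Longrightarrow> cis s - z \<noteq> 0"
  by (metis eq_iff_diff_eq_0 less_irrefl norm_cis)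

lemma poisson_nonneg: "cmod z < 1 \<Longrightarrow> 0 \<le> poisson z s"
  by (auto simp: poisson_def abs_square_le_1 intro!: divide_nonneg_nonneg)

lemma continuous_poisson: "cmod z < 1 \<Longrightarrow> continuous_on UNIV (poisson z)"
  unfolding poisson_def using cis_minus_neq_0[of z] continuous_cis[of UNIV]
  by (auto intro!: continuous_intros)

text \<open>Cauchy's formula at \<open>z\<close> is applied to \<open>g u / (1 - cnj z * u)\<close>
  instead of \<open>g\<close>. On the circle \<open>1 - cnj z * u = u * cnj (u - z)\<close>, which
  produces the Poisson kernel, while at \<open>u = z\<close> the denominator cancels the numerator
  of the kernel.\<close>

lemma poisson_formula:
  fixes g :: "complex \<Rightarrow> complex"
  assumes g: "g holomorphic_on ball 0 R" "R > 1" and z: "cmod z < 1"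
  shows "(\<integral>s. of_real (poisson z s) * g (cis s) \<partial>circ) = 2 * pi * g z"
proof -
  define h where "h u = g u / (1 - cnj z * u)" for u
  have nz: "1 - cnj z * u \<noteq> 0" if "cmod u \<le> 1" for u
  proof
    assume "1 - cnj z * u = 0"
    then have "cmod (cnj z * u) = 1" by (metis eq_iff_diff_eq_0 norm_one)
    then show False using z that mult_mono[of "cmod z" "cmod z" "cmod u" 1] by (simp add: norm_mult)
  qed
  have "g holomorphic_on cball 0 1"
    using g by (auto intro: holomorphic_on_subset)
  then have "h holomorphic_on cball 0 1"
    unfolding h_def using nz by (auto intro!: holomorphic_intros)
  from Cauchy_integral_circlepath_simple[OF this, of z] z
  have "((\<lambda>u. h u / (u - z)) has_contour_integral 2 * of_real pi * \<i> * h z) (part_circlepath 0 1 0 (2*pi))"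
    by (simp add: circlepath_def)
  from this[unfolded has_contour_integral_part_circlepath_iff[OF pi_gt_zero[THEN mult_pos_pos[OF zero_less_numeral[of "num.Bit0 num.One"]]]]]
  have "((\<lambda>t. h (cis t) / (cis t - z) * \<i> * cis t) has_integral 2 * pi * \<i> * h z) {0..2*pi}"
    by simp
  from has_integral_mult_right[OF this, of "(1 - (cmod z)\<^sup>2) / \<i>"]
  have "((\<lambda>t. (1 - (cmod z)\<^sup>2) / \<i> * (h (cis t) / (cis t - z) * \<i> * cis t)) has_integral 
      (1 - (cmod z)\<^sup>2) / \<i> * (2 * pi * \<i> * h z)) {0..2*pi}" .
  moreover have "(1 - (cmod z)\<^sup>2) / \<i> * (h (cis t) / (cis t - z) * \<i> * cis t) = of_real (poisson z t) * g (cis t)" for t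
  proof -
    have alg: "k / \<i> * (G / (W * E) / d * \<i> * W) = k / (d * E) * G"
      if "W \<noteq> 0" "d \<noteq> 0" "E \<noteq> 0" for k G W E d :: complex
      using that by (simp add: field_simps)
    define d where "d = cis t - z"
    have 1: "1 - cnj z * cis t = cis t * cnj d"
      by (simp add: d_def algebra_simps cis_cnj cis_mult)
    have 2: "of_real (poisson z t) = complex_of_real (1 - (cmod z)\<^sup>2) / (d * cnj d)"
      unfolding poisson_def of_real_divide d_def by (subst complex_norm_square) simp
    have "d \<noteq> 0" "cnj d \<noteq> 0"
      using cis_minus_neq_0[OF z, of t] by (auto simp: d_def)
    then show ?thesis
      unfolding h_def 1 2 d_def[symmetric] by (intro alg cis_neq_zero)
  qed
  moreover have "(1 - (cmod z)\<^sup>2) / \<i> * (2 * pi * \<i> * h z) = 2 * pi * g z"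
  proof -
    have K: "1 - cnj z * z = complex_of_real (1 - (cmod z)\<^sup>2)"
      using complex_norm_square[of z] by (simp add: mult.commute)
    have "K / \<i> * (c * \<i> * (G / K)) = c * G" if "K \<noteq> 0" for K G c :: complex
      using that by (simp add: field_simps)
    from this[OF nz[OF less_imp_le[OF z]]] show ?thesis
      unfolding h_def K .
  qed
  ultimately have "((\<lambda>t. of_real (poisson z t) * g (cis t)) has_integral 2 * pi * g z) {0..2*pi}"
    by (simp only:)
  moreover have "continuous_on UNIV (\<lambda>t. of_real (poisson z t) * g (cis t))"
  proof (intro continuous_on_mult continuous_on_of_real continuous_poisson z)
    show "continuous_on UNIV (\<lambda>t. g (cis t))"
      by (rule continuous_on_compose2[of "ball 0 R" g])
         (use g holomorphic_on_imp_continuous_on in \<open>auto intro: continuous_cis\<close>)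
  qed
  ultimately show ?thesis using circ_has_integral has_integral_unique by blast
qed

text \<open>For \<open>c = cnj w * u\<close> with \<open>u\<close> on the unit circle, this exhibits
  the Poisson kernel as the real part of a holomorphic function.\<close>

lemma Re_cayley: "c \<noteq> 1 \<Longrightarrow> Re ((1 + c) / (1 - c)) = (1 - (cmod c)\<^sup>2) / (cmod (1 - c))\<^sup>2"
  unfolding cmod_power2 by (simp add: Re_divide power2_eq_square algebra_simps)

text \<open>On the unit circle \<open>poisson w\<close> is the real part of \<open>h\<close>, which
  is holomorphic past the closed disc. The Poisson formula for \<open>h\<close> at \<open>z\<close>
  therefore evaluates the integral.\<close>

lemma poisson_convolution:
  assumes z: "cmod z < 1" and w: "cmod w < 1"
  shows "(\<integral>s. poisson z s * poisson w s \<partial>circ) = 2 * pi * ((1 - (cmod w * cmod z)\<^sup>2) / (cmod (1 - cnj w * z))\<^sup>2)"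
proof -
  define h where "h u = (1 + cnj w * u) / (1 - cnj w * u)" for u
  \<comment> \<open>Lies beyond 1 and still satisfies \<open>cmod w * R < 1\<close>, so
    \<open>h\<close> has no pole in \<open>ball 0 R\<close>.\<close>
  define R where "R = 2 / (1 + cmod w)"
  have "1 + cmod w > 0" by (simp add: add_pos_nonneg)
  then have R: "R > 1" using w by (simp add: R_def less_divide_eq)
  have "cmod w * R < 1"
    using w \<open>1 + cmod w > 0\<close> by (simp add: R_def divide_less_eq)
  then have nz: "cnj w * u \<noteq> 1" if "cmod u < R" for u
    using that mult_left_mono[of "cmod u" R "cmod w"] by (metis complex_mod_cnj norm_ge_zero norm_mult norm_one order.strict_trans1 less_imp_le less_irrefl)
  have h: "h holomorphic_on ball 0 R"
    unfolding h_def using nz by (auto intro!: holomorphic_intros)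
  have Re_h: "Re (h u) = (1 - (cmod w * cmod u)\<^sup>2) / (cmod (1 - cnj w * u))\<^sup>2" if "cmod u < R" for u
    unfolding h_def by (subst Re_cayley[OF nz[OF that]]) (simp add: norm_mult)
  have p: "poisson w s = Re (h (cis s))" for s
  proof -
    have "cmod (1 - cnj w * cis s) = cmod (cis s * cnj (cis s - w))"
      by (simp add: algebra_simps cis_cnj cis_mult)
    also have "\<dots> = cmod (cis s - w)" by (simp only: norm_mult complex_mod_cnj norm_cis)
    finally show ?thesis using R by (simp add: Re_h poisson_def)
  qed
  have "continuous_on UNIV (\<lambda>s. h (cis s))"
    by (rule continuous_on_compose2[of "ball 0 R" h])
       (use h R holomorphic_on_imp_continuous_on in \<open>auto intro: continuous_cis\<close>)
  then have int: "integrable circ (\<lambda>s. of_real (poisson z s) * h (cis s))"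
    by (intro integrable_circ_cont continuous_on_mult continuous_on_of_real continuous_poisson z)
  have "(\<integral>s. poisson z s * poisson w s \<partial>circ) = (\<integral>s. Re (of_real (poisson z s) * h (cis s)) \<partial>circ)"
    by (simp add: p)
  also have "\<dots> = Re (2 * pi * h z)"
    using integral_Re[OF int] poisson_formula[OF h R z] by simp
  also have "\<dots> = 2 * pi * Re (h z)" by simp
  also have "Re (h z) = (1 - (cmod w * cmod z)\<^sup>2) / (cmod (1 - cnj w * z))\<^sup>2"
    using z R by (intro Re_h) simp
  finally show ?thesis .
qed

text \<open>The left side is a Poisson kernel at radius \<open>a * b\<close>. Passing to the smaller
  of the two radii, \<open>a\<close>, costs a factor 2 in the numerator and 4 in the denominator;
  the latter because \<open>a - a * b\<close> is at most \<open>1 - a * b\<close>, hence at most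
  \<open>cmod (1 - of_real (a * b) * e)\<close>.\<close>

lemma poisson_compare_aux:
  assumes "0 \<le> a" "a \<le> b" "b < 1"
  shows "(1 - (b * a)\<^sup>2) / (cmod (1 - cnj (of_real b * cis u) * (of_real a * cis t)))\<^sup>2 \<le> 8 * poisson (of_real a * cis t) u"
proof -
  define e where "e = cis (t - u)"
  have A: "cmod (1 - cnj (of_real b * cis u) * (of_real a * cis t)) = cmod (1 - of_real (a * b) * e)"
  proof -
    have "cnj (of_real b * cis u) * (of_real a * cis t) = of_real (a * b) * (cis t * cis (- u))"
      by (simp add: cis_cnj mult_ac)
    then show ?thesis by (simp only: cis_mult e_def diff_conv_add_uminus)
  qed
  have "cmod (cis u - of_real a * cis t) = cmod (cis u * (1 - of_real a * e))"
  proof -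
    have "cis t = cis u * e" by (simp add: e_def cis_mult)
    then show ?thesis by (simp add: algebra_simps)
  qed
  also have "\<dots> = cmod (1 - of_real a * e)" by (simp add: norm_mult)
  finally have B: "cmod (cis u - of_real a * cis t) = cmod (1 - of_real a * e)" .
  have ab: "a * b < 1" "a < 1" using assms mult_mono[of a 1 b b] by auto
  have pos: "cmod (1 - of_real c * e) \<ge> 1 - c" if "0 \<le> c" for c
    using norm_triangle_ineq2[of 1 "of_real c * e"] that by (simp add: norm_mult e_def)
  have "cmod (1 - of_real a * e) \<le> cmod (1 - of_real (a * b) * e) + cmod (of_real (a * b - a) * e)"
    using norm_triangle_ineq[of "1 - of_real (a * b) * e" "of_real (a * b - a) * e"]
    by (simp add: algebra_simps)
  also have "cmod (of_real (a * b - a) * e) = a - a * b"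
    using assms mult_left_le[of b a] by (simp only: norm_mult norm_of_real) (simp add: e_def)
  also have "a - a * b \<le> cmod (1 - of_real (a * b) * e)"
    using pos[of "a * b"] assms by simp
  finally have le: "cmod (1 - of_real a * e) \<le> 2 * cmod (1 - of_real (a * b) * e)" by simp
  have p: "cmod (1 - of_real a * e) > 0" using pos[of a] assms by linarith
  \<comment> \<open>As \<open>a \<le> b\<close>, the left side is at most \<open>1 - a ^ 4\<close>,
    which falls short of \<open>2 * (1 - a\<^sup>2)\<close> by the square of
    \<open>1 - a\<^sup>2\<close>.\<close>
  have n: "1 - (b * a)\<^sup>2 \<le> 2 * (1 - a\<^sup>2)"
  proof -
    have "a\<^sup>2 * a\<^sup>2 \<le> (b * a)\<^sup>2" 
      using mult_right_mono[OF power_mono[OF assms(2,1), of 2], of "a\<^sup>2"] by (simp add: power_mult_distrib)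
    moreover have "a\<^sup>2 \<le> 1" using assms by (simp add: abs_square_le_1)
    moreover have "0 \<le> (1 - a\<^sup>2) * (1 - a\<^sup>2)" by simp
    ultimately show ?thesis by (simp add: algebra_simps)
  qed
  have a1: "0 \<le> 1 - a\<^sup>2" using assms by (simp add: abs_square_le_1)
  have "(1 - (b * a)\<^sup>2) / (cmod (1 - of_real (a * b) * e))\<^sup>2 \<le> (2 * (1 - a\<^sup>2)) / (cmod (1 - of_real a * e) / 2)\<^sup>2"
    using n a1 p le by (intro frac_le power_mono) auto
  also have "\<dots> = 8 * ((1 - a\<^sup>2) / (cmod (1 - of_real a * e))\<^sup>2)"
    by (simp add: power_divide)
  finally show ?thesis
    unfolding A poisson_def B using assms by (simp add: norm_mult)
qed

text \<open>The kernel with the smaller radius dominates; the sum of both covers the two cases and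
  is symmetric. The constant is \<open>2 * pi * 8\<close>.\<close>

lemma poisson_compare:
  assumes "0 \<le> a" "a < 1" "0 \<le> b" "b < 1"
  shows "(\<integral>s. poisson (of_real a * cis t) s * poisson (of_real b * cis u) s \<partial>circ)
    \<le> 16 * pi * (poisson (of_real a * cis t) u + poisson (of_real b * cis u) t)"
proof -
  define z where "z = of_real a * cis t"
  define w where "w = of_real b * cis u"
  have zw: "cmod z = a" "cmod w = b" using assms by (auto simp: z_def w_def norm_mult)
  have p: "0 \<le> poisson z u" "0 \<le> poisson w t" using zw assms by (auto intro: poisson_nonneg)
  have "(1 - (b * a)\<^sup>2) / (cmod (1 - cnj w * z))\<^sup>2 \<le> 8 * (poisson z u + poisson w t)"
  proof (cases "a \<le> b")
    case True
    then show ?thesis using poisson_compare_aux[of a b u t] assms p by (simp add: z_def w_def)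
  next
    case False
    have "1 - cnj w * z = cnj (1 - cnj z * w)" by simp
    then have eq: "cmod (1 - cnj w * z) = cmod (1 - cnj z * w)" by (simp only: complex_mod_cnj)
    have "(1 - (a * b)\<^sup>2) / (cmod (1 - cnj z * w))\<^sup>2 \<le> 8 * poisson w t"
      unfolding z_def w_def using False assms by (intro poisson_compare_aux) auto
    then show ?thesis using p unfolding eq mult.commute[of b a] by argo
  qed
  then have "2 * pi * ((1 - (b * a)\<^sup>2) / (cmod (1 - cnj w * z))\<^sup>2) \<le> 2 * pi * (8 * (poisson z u + poisson w t))"
    by (intro mult_left_mono) auto
  moreover have "(\<integral>s. poisson z s * poisson w s \<partial>circ) = 2 * pi * ((1 - (b * a)\<^sup>2) / (cmod (1 - cnj w * z))\<^sup>2)"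
    using poisson_convolution[of z w, unfolded zw, OF assms(2,4)] .
  ultimately show ?thesis
    unfolding z_def[symmetric] w_def[symmetric] by linarith
qed

text \<open>A crude bound that degenerates as \<open>R\<close> tends to 1; it serves to prove
  finiteness.\<close>

lemma poisson_le:
  assumes "cmod z \<le> R" "R < 1"
  shows "poisson z s \<le> 1 / (1 - R)\<^sup>2"
proof -
  have "1 - R \<le> cmod (cis s - z)"
    using norm_triangle_ineq2[of "cis s" z] assms by simp
  then show ?thesis unfolding poisson_def using assms
    by (intro frac_le power_mono) auto
qed

lemma ident_circ [measurable]: "(\<lambda>t. t) \<in> borel_measurable circ"
  by (rule measurable_circ) simp

lemma cis_circ [measurable]: "cis \<in> borel_measurable circ"
  by (rule measurable_circ) simp

interpretation circ2: pair_sigma_finite circ circ ..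

text \<open>The kernel \<open>\<integral> K(t,s) K(u,s) ds\<close> of \<open>T T\<^sup>*\<close> is dominated by \<open>K(t,u) + K(u,t)\<close>, so
  \<open>\<parallel>T\<^sup>* \<psi>\<parallel>\<^sup>2 \<le> C \<langle>\<psi>, T\<^sup>* \<psi>\<rangle>\<close>, which bounds the norm of \<open>T\<^sup>*\<close> independently of the choice of radii.\<close>

lemma poisson_dual_bound:
  fixes \<rho> \<psi> :: "real \<Rightarrow> real"
  assumes [measurable]: "\<rho> \<in> borel_measurable circ" "\<psi> \<in> borel_measurable circ"
    and \<rho>: "\<And>t. 0 \<le> \<rho> t" "\<And>t. \<rho> t \<le> R" and "R < 1"
    and \<psi>: "\<And>t. 0 \<le> \<psi> t" "\<And>t. t \<in> {0..2*pi} \<Longrightarrow> \<psi> t \<le> B"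
  defines "A \<equiv> \<lambda>s. \<integral>\<^sup>+t. ennreal (poisson (of_real (\<rho> t) * cis t) s) * ennreal (\<psi> t) \<partial>circ"
  shows "(\<integral>\<^sup>+s. (A s)\<^sup>2 \<partial>circ) \<le> ennreal ((32*pi)\<^sup>2) * (\<integral>\<^sup>+t. (ennreal (\<psi> t))\<^sup>2 \<partial>circ)"
proof -
  define K where "K t s = ennreal (poisson (of_real (\<rho> t) * cis t) s)" for t s
  define P where "P t = ennreal (\<psi> t)" for t
  have [measurable]: "P \<in> borel_measurable circ" unfolding P_def by measurable
  \<comment> \<open>Stated for composed arguments, so that measurability is found for
    \<open>K\<close> with its variables in either order and in products.\<close>
  have Km: "(\<lambda>x. K (f x) (g x)) \<in> borel_measurable N"
    if [measurable]: "f \<in> measurable N circ" "g \<in> measurable N circ" for f g and N :: "'c measure"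
    unfolding K_def poisson_def by measurable
  note [measurable] = Km
  have A: "A = (\<lambda>s. \<integral>\<^sup>+t. K t s * P t \<partial>circ)" by (simp add: A_def K_def P_def)
  have Am[measurable]: "A \<in> borel_measurable circ" unfolding A by measurable
  have z1: "cmod (of_real (\<rho> t) * cis t) < 1" "cmod (of_real (\<rho> t) * cis t) \<le> R" for t
    using \<rho>[of t] \<open>R < 1\<close> by (auto simp: norm_mult)
  have conv: "(\<integral>\<^sup>+s. K t s * K u s \<partial>circ) \<le> ennreal (16*pi) * (K t u + K u t)" for t u
  proof -
    have "(\<integral>\<^sup>+s. K t s * K u s \<partial>circ) = (\<integral>\<^sup>+s. ennreal (poisson (of_real (\<rho> t) * cis t) s * poisson (of_real (\<rho> u) * cis u) s) \<partial>circ)"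
      by (simp add: K_def ennreal_mult' poisson_nonneg z1)
    also have "\<dots> = ennreal (\<integral>s. poisson (of_real (\<rho> t) * cis t) s * poisson (of_real (\<rho> u) * cis u) s \<partial>circ)"
      by (intro nn_integral_eq_integral integrable_circ_cont continuous_on_mult continuous_poisson z1)
         (auto intro!: mult_nonneg_nonneg poisson_nonneg z1)
    also have "\<dots> \<le> ennreal (16*pi * (poisson (of_real (\<rho> t) * cis t) u + poisson (of_real (\<rho> u) * cis u) t))"
      using \<rho> \<open>R < 1\<close> by (intro ennreal_leI poisson_compare) (auto intro: order.strict_trans1)
    also have "\<dots> = ennreal (16*pi) * (K t u + K u t)"
      by (simp add: K_def ennreal_mult' ennreal_plus poisson_nonneg z1 del: ennreal_plus flip: ennreal_plus)
    finally show ?thesis .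
  qed
  define X where "X = (\<integral>\<^sup>+s. (A s)\<^sup>2 \<partial>circ)"
  define Y where "Y = (\<integral>\<^sup>+t. (P t)\<^sup>2 \<partial>circ)"
  define Z where "Z = (\<integral>\<^sup>+s. P s * A s \<partial>circ)"
  \<comment> \<open>The square of \<open>A s\<close> is written as a double integral in
    \<open>t\<close> and \<open>u\<close>; once the integration in \<open>s\<close> is moved
    innermost, \<open>conv\<close> bounds the kernel.\<close>
  have "X = (\<integral>\<^sup>+s. (\<integral>\<^sup>+t. \<integral>\<^sup>+u. (K t s * P t) * (K u s * P u) \<partial>circ \<partial>circ) \<partial>circ)"
    unfolding X_def power2_eq_square
  proof (intro nn_integral_cong)
    fix s assume [measurable]: "s \<in> space circ"
    have "(\<integral>\<^sup>+t. \<integral>\<^sup>+u. (K t s * P t) * (K u s * P u) \<partial>circ \<partial>circ) = (\<integral>\<^sup>+t. (K t s * P t) * A s \<partial>circ)"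
      unfolding A by (intro nn_integral_cong nn_integral_cmult) measurable
    also have "\<dots> = A s * A s" by (subst nn_integral_multc) (auto simp: A)
    finally show "A s * A s = (\<integral>\<^sup>+t. \<integral>\<^sup>+u. (K t s * P t) * (K u s * P u) \<partial>circ \<partial>circ)" ..
  qed
  also have "\<dots> = (\<integral>\<^sup>+t. (\<integral>\<^sup>+s. \<integral>\<^sup>+u. (K t s * P t) * (K u s * P u) \<partial>circ \<partial>circ) \<partial>circ)"
    by (rule circ2.Fubini') measurable
  also have "\<dots> = (\<integral>\<^sup>+t. \<integral>\<^sup>+u. \<integral>\<^sup>+s. (K t s * P t) * (K u s * P u) \<partial>circ \<partial>circ \<partial>circ)"
    by (intro nn_integral_cong circ2.Fubini') measurable
  also have "\<dots> = (\<integral>\<^sup>+t. \<integral>\<^sup>+u. (P t * P u) * (\<integral>\<^sup>+s. K t s * K u s \<partial>circ) \<partial>circ \<partial>circ)"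
    by (intro nn_integral_cong) (subst nn_integral_cmult[symmetric], auto simp: mult_ac)
  also have "\<dots> \<le> (\<integral>\<^sup>+t. \<integral>\<^sup>+u. (P t * P u) * (ennreal (16*pi) * (K t u + K u t)) \<partial>circ \<partial>circ)"
    by (intro nn_integral_mono mult_left_mono conv) auto
  also have "\<dots> = (\<integral>\<^sup>+t. \<integral>\<^sup>+u. ennreal (16*pi) * (P u * (K t u * P t)) + ennreal (16*pi) * (P t * (K u t * P u)) \<partial>circ \<partial>circ)"
    by (intro nn_integral_cong) (simp add: distrib_left distrib_right mult_ac)
  also have "\<dots> = (\<integral>\<^sup>+t. (\<integral>\<^sup>+u. ennreal (16*pi) * (P u * (K t u * P t)) \<partial>circ) + ennreal (16*pi) * (P t * A t) \<partial>circ)"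
    unfolding A by (intro nn_integral_cong) (simp add: nn_integral_add nn_integral_cmult)
  also have "\<dots> = (\<integral>\<^sup>+t. (\<integral>\<^sup>+u. ennreal (16*pi) * (P u * (K t u * P t)) \<partial>circ) \<partial>circ) + ennreal (16*pi) * Z"
    by (subst nn_integral_add) (auto simp: Z_def nn_integral_cmult)
  also have "(\<integral>\<^sup>+t. (\<integral>\<^sup>+u. ennreal (16*pi) * (P u * (K t u * P t)) \<partial>circ) \<partial>circ)
      = (\<integral>\<^sup>+u. (\<integral>\<^sup>+t. ennreal (16*pi) * (P u * (K t u * P t)) \<partial>circ) \<partial>circ)"
    by (rule circ2.Fubini') measurable
  also have "\<dots> = (\<integral>\<^sup>+u. ennreal (16*pi) * (P u * A u) \<partial>circ)"
    unfolding A by (intro nn_integral_cong) (simp add: nn_integral_cmult)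
  also have "\<dots> = ennreal (16*pi) * Z"
    unfolding Z_def by (rule nn_integral_cmult) measurable
  finally have XZ: "X \<le> ennreal (32*pi) * Z"
    by (simp add: distrib_right[symmetric] flip: ennreal_plus)
  have CS: "Z\<^sup>2 \<le> Y * X"
    unfolding Z_def Y_def X_def by (rule Cauchy_Schwarz_nn_integral) measurable
  \<comment> \<open>Finiteness permits cancelling one \<open>X\<close> from
    \<open>X * X \<le> C * Y * X\<close>; bounds depending on \<open>R\<close> and \<open>B\<close>
    are good enough for that.\<close>
  have "X < \<infinity>"
  proof -
    have "A s \<le> ennreal (1 / (1 - R)\<^sup>2 * B * (2*pi))" for s
    proof -
      have "A s \<le> (\<integral>\<^sup>+t. ennreal (1 / (1 - R)\<^sup>2 * B) \<partial>circ)"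
        unfolding A K_def P_def
      proof (rule nn_integral_mono)
        fix t assume "t \<in> space circ"
        then have "poisson (of_real (\<rho> t) * cis t) s * \<psi> t \<le> 1 / (1 - R)\<^sup>2 * B"
          by (intro mult_mono poisson_le z1 \<psi> \<open>R < 1\<close>) auto
        then show "ennreal (poisson (of_real (\<rho> t) * cis t) s) * ennreal (\<psi> t) \<le> ennreal (1 / (1 - R)\<^sup>2 * B)"
          by (simp add: \<psi> ennreal_leI flip: ennreal_mult'')
      qed
      also have "\<dots> = ennreal (1 / (1 - R)\<^sup>2 * B * (2*pi))"
        by (simp add: emeasure_circ_space flip: ennreal_mult'')
      finally show ?thesis .
    qed
    then have "X \<le> (\<integral>\<^sup>+s. (ennreal (1 / (1 - R)\<^sup>2 * B * (2*pi)))\<^sup>2 \<partial>circ)"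
      unfolding X_def by (intro nn_integral_mono power_mono) auto
    also have "\<dots> < \<infinity>" by (simp add: emeasure_circ_space ennreal_mult_less_top power2_eq_square)
    finally show ?thesis .
  qed
  have "X * X \<le> (ennreal (32*pi) * Z) * (ennreal (32*pi) * Z)"
    by (intro mult_mono XZ) auto
  also have "\<dots> = ennreal ((32*pi)\<^sup>2) * Z\<^sup>2"
    by (simp add: power2_eq_square mult_ac flip: ennreal_mult'')
  also have "\<dots> \<le> ennreal ((32*pi)\<^sup>2) * (Y * X)"
    by (intro mult_left_mono CS) auto
  finally have le: "X * X \<le> (ennreal ((32*pi)\<^sup>2) * Y) * X" by (simp add: mult_ac)
  have "X \<le> ennreal ((32*pi)\<^sup>2) * Y"
  proof (cases "X = 0")
    case False
    have "X * (1 / X) = 1" using False \<open>X < \<infinity>\<close> by (simp add: ennreal_times_divide ennreal_divide_self)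
    with mult_right_mono[OF le, of "1 / X"] show ?thesis by (simp add: mult.assoc)
  qed simp
  then show ?thesis by (simp add: X_def Y_def P_def)
qed

section \<open>The radial maximal function\<close>

text \<open>As \<open>g\<close> is continuous only on \<open>U\<close>, it is first extended by 0 to
  a Borel function on the plane.\<close>

lemma measurable_on_open:
  fixes g :: "complex \<Rightarrow> complex"
  assumes "continuous_on U g" "open U" "f \<in> borel_measurable N" "\<And>t. f t \<in> U"
  shows "(\<lambda>t. g (f t)) \<in> borel_measurable N"
proof -
  have "(\<lambda>z. if z \<in> U then g z else 0) \<in> borel_measurable borel"
    using assms by (intro borel_measurable_continuous_on_if) auto
  from measurable_compose[OF assms(3) this] show ?thesis using assms(4) by simp
qed

text \<open>A measurable choice \<open>\<rho>\<close> of radii linearizes the maximal function; the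
  constant must not depend on it. Pairing \<open>pt\<close> with \<open>\<psi>\<close> and
  exchanging integrals gives \<open>2 * pi * Y \<le> \<integral> q A\<close>. Cauchy-Schwarz and the
  dual bound then yield \<open>(2*pi*Y)\<^sup>2 \<le> (32*pi)\<^sup>2 * Q * Y\<close>, and
  \<open>256 = (32/2)\<^sup>2\<close>.\<close>

lemma poisson_maximal:
  fixes g :: "complex \<Rightarrow> complex" and \<rho> :: "real \<Rightarrow> real"
  assumes g: "g holomorphic_on ball 0 R'" "R' > 1"
    and \<rho>m[measurable]: "\<rho> \<in> borel_measurable circ"
    and \<rho>: "\<And>t. 0 \<le> \<rho> t" "\<And>t. \<rho> t \<le> R" and "R < 1"
  shows "(\<integral>\<^sup>+t. (ennreal (cmod (g (of_real (\<rho> t) * cis t))))\<^sup>2 \<partial>circ) \<le> 256 * (\<integral>\<^sup>+s. (ennreal (cmod (g (cis s))))\<^sup>2 \<partial>circ)"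
proof -
  define \<psi> where "\<psi> t = cmod (g (of_real (\<rho> t) * cis t))" for t
  define q where "q s = ennreal (cmod (g (cis s)))" for s
  define K where "K t s = ennreal (poisson (of_real (\<rho> t) * cis t) s)" for t s
  have \<rho>1: "\<rho> t < 1" for t using \<rho>[of t] \<open>R < 1\<close> by simp
  have cont: "continuous_on (ball 0 R') g" using g holomorphic_on_imp_continuous_on by blast
  have [measurable]: "(\<lambda>t. g (of_real (\<rho> t) * cis t)) \<in> borel_measurable circ"
  proof (rule measurable_on_open[OF cont])
    show "of_real (\<rho> t) * cis t \<in> ball 0 R'" for t
      using \<rho>[of t] \<rho>1[of t] g(2) by (simp add: norm_mult)
  qed auto
  have \<psi>m[measurable]: "\<psi> \<in> borel_measurable circ" unfolding \<psi>_def by measurable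
  have contc: "continuous_on UNIV (\<lambda>s. g (cis s))"
    by (rule continuous_on_compose2[OF cont]) (use g in \<open>auto intro: continuous_cis\<close>)
  have [measurable]: "q \<in> borel_measurable circ"
    unfolding q_def using measurable_circ_cont[OF contc] by measurable
  have Km: "(\<lambda>x. K (f x) (g x)) \<in> borel_measurable N"
    if [measurable]: "f \<in> measurable N circ" "g \<in> measurable N circ" for f g and N :: "'c measure"
    unfolding K_def poisson_def by measurable
  note [measurable] = Km
  have "bounded (g ` cball 0 1)"
    using g by (intro compact_imp_bounded compact_continuous_image continuous_on_subset[OF cont]) auto
  then obtain B where B: "\<And>z. z \<in> cball 0 1 \<Longrightarrow> cmod (g z) \<le> B"
    unfolding bounded_iff by (metis imageI)
  have \<psi>B: "\<psi> t \<le> B" for t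
    unfolding \<psi>_def using \<rho>[of t] \<rho>1[of t] by (intro B) (simp add: norm_mult)
  define A where "A s = (\<integral>\<^sup>+t. K t s * ennreal (\<psi> t) \<partial>circ)" for s
  have [measurable]: "A \<in> borel_measurable circ" unfolding A_def by measurable
  define Y where "Y = (\<integral>\<^sup>+t. (ennreal (\<psi> t))\<^sup>2 \<partial>circ)"
  define Q where "Q = (\<integral>\<^sup>+s. (q s)\<^sup>2 \<partial>circ)"
  have AY: "(\<integral>\<^sup>+s. (A s)\<^sup>2 \<partial>circ) \<le> ennreal ((32*pi)\<^sup>2) * Y"
    unfolding A_def K_def Y_def
    by (rule poisson_dual_bound[OF \<rho>m \<psi>m \<rho> \<open>R < 1\<close> _ \<psi>B]) (simp add: \<psi>_def)
  have pt: "ennreal (2*pi) * ennreal (\<psi> t) \<le> (\<integral>\<^sup>+s. K t s * q s \<partial>circ)" for t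
  proof -
    define z where "z = of_real (\<rho> t) * cis t"
    have z: "cmod z < 1" using \<rho>[of t] \<rho>1[of t] by (simp add: z_def norm_mult)
    have c: "continuous_on UNIV (\<lambda>s. complex_of_real (poisson z s) * g (cis s))"
      by (intro continuous_on_mult continuous_on_of_real continuous_poisson z contc)
    have "2 * pi * \<psi> t = norm (2 * pi * g z)" by (simp add: \<psi>_def z_def norm_mult)
    also have "\<dots> \<le> (\<integral>s. norm (of_real (poisson z s) * g (cis s)) \<partial>circ)"
      by (subst poisson_formula[OF g z, symmetric]) (rule integral_norm_bound)
    finally have "ennreal (2 * pi * \<psi> t) \<le> ennreal (\<integral>s. norm (of_real (poisson z s) * g (cis s)) \<partial>circ)"
      by (rule ennreal_leI)
    also have "\<dots> = (\<integral>\<^sup>+s. ennreal (norm (of_real (poisson z s) * g (cis s))) \<partial>circ)"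
      using c by (intro nn_integral_eq_integral[symmetric] integrable_norm integrable_circ_cont) auto
    also have "\<dots> = (\<integral>\<^sup>+s. K t s * q s \<partial>circ)"
      using poisson_nonneg[OF z] by (simp add: K_def q_def z_def[symmetric] norm_mult ennreal_mult')
    finally show ?thesis by (simp add: ennreal_mult' \<psi>_def)
  qed
  have "ennreal (2*pi) * Y = (\<integral>\<^sup>+t. ennreal (\<psi> t) * (ennreal (2*pi) * ennreal (\<psi> t)) \<partial>circ)"
    unfolding Y_def by (subst nn_integral_cmult[symmetric]) (auto simp: power2_eq_square mult_ac)
  also have "\<dots> \<le> (\<integral>\<^sup>+t. ennreal (\<psi> t) * (\<integral>\<^sup>+s. K t s * q s \<partial>circ) \<partial>circ)"
    by (intro nn_integral_mono mult_left_mono pt) auto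
  also have "\<dots> = (\<integral>\<^sup>+t. \<integral>\<^sup>+s. ennreal (\<psi> t) * (K t s * q s) \<partial>circ \<partial>circ)"
    by (intro nn_integral_cong) (simp add: nn_integral_cmult)
  also have "\<dots> = (\<integral>\<^sup>+s. \<integral>\<^sup>+t. ennreal (\<psi> t) * (K t s * q s) \<partial>circ \<partial>circ)"
    by (rule circ2.Fubini'[symmetric]) measurable
  also have "\<dots> = (\<integral>\<^sup>+s. q s * A s \<partial>circ)"
    unfolding A_def by (intro nn_integral_cong) (subst nn_integral_cmult[symmetric], auto simp: mult_ac)
  finally have 1: "ennreal (2*pi) * Y \<le> (\<integral>\<^sup>+s. q s * A s \<partial>circ)" .
  have "(ennreal (2*pi) * Y)\<^sup>2 \<le> (\<integral>\<^sup>+s. q s * A s \<partial>circ)\<^sup>2"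
    using 1 by (intro power_mono) auto
  also have "\<dots> \<le> Q * (\<integral>\<^sup>+s. (A s)\<^sup>2 \<partial>circ)"
    unfolding Q_def by (rule Cauchy_Schwarz_nn_integral) measurable
  also have "\<dots> \<le> Q * (ennreal ((32*pi)\<^sup>2) * Y)"
    by (intro mult_left_mono AY) auto
  finally have le: "(ennreal (2*pi) * Y)\<^sup>2 \<le> Q * (ennreal ((32*pi)\<^sup>2) * Y)" .
  have c1: "(ennreal (2*pi) * Y)\<^sup>2 = Y * (ennreal (4*pi\<^sup>2) * Y)"
  proof -
    have "(ennreal (2*pi) * Y)\<^sup>2 = Y * ((ennreal (2*pi) * ennreal (2*pi)) * Y)"
      by (simp only: power2_eq_square mult_ac)
    also have "ennreal (2*pi) * ennreal (2*pi) = ennreal (4*pi\<^sup>2)"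
      by (subst ennreal_mult'[symmetric]) (auto simp: power2_eq_square)
    finally show ?thesis .
  qed
  have c2: "Q * (ennreal ((32*pi)\<^sup>2) * Y) = Y * (ennreal (4*pi\<^sup>2) * (256 * Q))"
  proof -
    have "ennreal ((32*pi)\<^sup>2) = ennreal (4*pi\<^sup>2) * ennreal 256"
      by (subst ennreal_mult'[symmetric]) (auto simp: power_mult_distrib)
    then show ?thesis by (simp add: mult_ac)
  qed
  \<comment> \<open>Holds since \<open>g\<close> is bounded on the closed disc; needed to cancel
    \<open>Y\<close> from \<open>le\<close>.\<close>
  have "Y < \<infinity>"
  proof -
    have "Y \<le> (\<integral>\<^sup>+t. (ennreal B)\<^sup>2 \<partial>circ)"
      unfolding Y_def by (intro nn_integral_mono power_mono ennreal_leI \<psi>B) auto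
    also have "\<dots> < \<infinity>" by (simp add: emeasure_circ_space ennreal_mult_less_top power2_eq_square)
    finally show ?thesis .
  qed
  have "Y \<le> 256 * Q"
  proof (cases "Y = 0")
    case False
    then have "ennreal (4*pi\<^sup>2) * Y \<le> ennreal (4*pi\<^sup>2) * (256 * Q)"
      using le \<open>Y < \<infinity>\<close> unfolding c1 c2 by (subst (asm) ennreal_mult_le_mult_iff) auto
    then show ?thesis by (subst (asm) ennreal_mult_le_mult_iff) auto
  qed simp
  then show ?thesis by (simp add: Y_def Q_def \<psi>_def q_def)
qed

text \<open>The dilation of \<open>f\<close> by some \<open>\<kappa>\<close> between
  \<open>R\<close> and 1 is holomorphic past the closed disc, so the previous bound applies to it
  with radii \<open>\<rho> t / \<kappa>\<close>. The constant is
  \<open>256 * (2 * pi)\<close>.\<close>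

lemma H2_maximal:
  assumes f: "f \<in> H2" and \<rho>m: "\<rho> \<in> borel_measurable circ"
    and \<rho>: "\<And>t. 0 \<le> \<rho> t" "\<And>t. \<rho> t \<le> R" and R: "R < 1"
  shows "(\<integral>\<^sup>+t. (ennreal (cmod (f (of_real (\<rho> t) * cis t))))\<^sup>2 \<partial>circ) \<le> ennreal (512 * pi * (h2norm f)\<^sup>2)"
proof -
  define \<kappa> where "\<kappa> = (1 + R) / 2"
  have R0: "0 \<le> R" using \<rho>[of 0] by simp
  have \<kappa>: "0 < \<kappa>" "\<kappa> < 1" "R < \<kappa>" using R R0 by (auto simp: \<kappa>_def)
  define g where "g z = f (of_real \<kappa> * z)" for z
  have "g holomorphic_on ball 0 (1/\<kappa>)"
    unfolding g_def
  proof (rule holomorphic_on_compose_gen[of "\<lambda>z. of_real \<kappa> * z" _ f D, unfolded o_def])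
    show "(\<lambda>z. of_real \<kappa> * z) ` ball 0 (1/\<kappa>) \<subseteq> D"
      using \<kappa> by (auto simp: norm_mult field_simps)
  qed (auto intro: holomorphic_intros H2_holo f)
  from poisson_maximal[OF this, of "\<lambda>t. \<rho> t / \<kappa>" "R / \<kappa>"]
  have "(\<integral>\<^sup>+t. (ennreal (cmod (g (of_real (\<rho> t / \<kappa>) * cis t))))\<^sup>2 \<partial>circ) \<le> 256 * (\<integral>\<^sup>+s. (ennreal (cmod (g (cis s))))\<^sup>2 \<partial>circ)"
    using \<rho> \<rho>m \<kappa> by (simp add: divide_right_mono)
  moreover have "g (of_real (\<rho> t / \<kappa>) * cis t) = f (of_real (\<rho> t) * cis t)" for t
    using \<kappa> by (simp add: g_def)
  moreover have "(\<integral>\<^sup>+s. (ennreal (cmod (g (cis s))))\<^sup>2 \<partial>circ) \<le> ennreal (2 * pi * (h2norm f)\<^sup>2)"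
  proof -
    have "(\<integral>\<^sup>+s. (ennreal (cmod (g (cis s))))\<^sup>2 \<partial>circ) = (\<integral>\<^sup>+s. ennreal ((cmod (f (of_real \<kappa> * cis s)))\<^sup>2) \<partial>circ)"
      by (simp add: g_def ennreal_power)
    also have "\<dots> = ennreal (\<integral>s. (cmod (f (of_real \<kappa> * cis s)))\<^sup>2 \<partial>circ)"
      using \<kappa> by (intro nn_integral_eq_integral integrable_circ_cont continuous_intros continuous_circle H2_holo f) auto
    also have "\<dots> \<le> ennreal (2 * pi * (h2norm f)\<^sup>2)"
      using \<kappa> by (intro ennreal_leI circle_mean_le f) auto
    finally show ?thesis .
  qed
  ultimately have "(\<integral>\<^sup>+t. (ennreal (cmod (f (of_real (\<rho> t) * cis t))))\<^sup>2 \<partial>circ) \<le> 256 * ennreal (2 * pi * (h2norm f)\<^sup>2)"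
    by (simp add: order_trans[OF _ mult_left_mono])
  also have "\<dots> = ennreal (256 * (2 * pi * (h2norm f)\<^sup>2))"
    by (subst ennreal_mult'') auto
  also have "256 * (2 * pi * (h2norm f)\<^sup>2) = 512 * pi * (h2norm f)\<^sup>2" by simp
  finally show ?thesis .
qed

text \<open>By induction: take the newest radius wherever it exceeds the level \<open>l\<close>, and
  keep the earlier choice elsewhere. Finitely many radii stay below a common \<open>R < 1\<close>,
  as \<open>H2_maximal\<close> requires.\<close>

lemma radius_selection:
  fixes f :: "complex \<Rightarrow> complex" and q :: "nat \<Rightarrow> real"
  assumes f: "f \<in> H2" and q: "\<And>i. 0 \<le> q i" "\<And>i. q i < 1"
  shows "\<exists>\<rho> R. \<rho> \<in> borel_measurable circ \<and> R < 1 \<and> (\<forall>t. 0 \<le> \<rho> t \<and> \<rho> t \<le> R)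
    \<and> (\<forall>t. (\<exists>i\<le>k. l < cmod (f (of_real (q i) * cis t))) \<longrightarrow> l < cmod (f (of_real (\<rho> t) * cis t)))"
proof (induction k)
  case 0
  show ?case using q by (intro exI[of _ "\<lambda>t. q 0"] exI[of _ "q 0"]) auto
next
  case (Suc k)
  then obtain \<rho> R where [measurable]: "\<rho> \<in> borel_measurable circ" and R: "R < 1" "\<And>t. 0 \<le> \<rho> t" "\<And>t. \<rho> t \<le> R"
    and sel: "\<And>t i. i \<le> k \<Longrightarrow> l < cmod (f (of_real (q i) * cis t)) \<Longrightarrow> l < cmod (f (of_real (\<rho> t) * cis t))"
    by blast
  define \<rho>' where "\<rho>' t = (if l < cmod (f (of_real (q (Suc k)) * cis t)) then q (Suc k) else \<rho> t)" for t
  have [measurable]: "(\<lambda>t. f (of_real (q (Suc k)) * cis t)) \<in> borel_measurable circ"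
    by (intro measurable_circ_cont continuous_circle H2_holo f q)
  have "\<rho>' \<in> borel_measurable circ" unfolding \<rho>'_def by measurable
  moreover have "max R (q (Suc k)) < 1" using R q by simp
  moreover have "0 \<le> \<rho>' t \<and> \<rho>' t \<le> max R (q (Suc k))" for t
    using R[of] q[of "Suc k"] by (auto simp: \<rho>'_def intro: max.coboundedI1)
  moreover have "l < cmod (f (of_real (\<rho>' t) * cis t))" if "\<exists>i\<le>Suc k. l < cmod (f (of_real (q i) * cis t))" for t
    using that sel[of _ t] by (auto simp: \<rho>'_def le_Suc_eq)
  ultimately show ?case by blast
qed

text \<open>For finitely many rational radii, Chebyshev's inequality is applied to
  \<open>H2_maximal\<close> with the selected radii. The exceptional sets \<open>V k\<close>
  increase, so their union obeys the same bound, and continuity along the radius covers all other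
  radii.\<close>

lemma H2_weak_type:
  assumes f: "f \<in> H2" and l: "l > 0"
  obtains U where "U \<in> sets circ" "emeasure circ U \<le> ennreal (512 * pi * (h2norm f)\<^sup>2 / l\<^sup>2)"
    "\<And>t r. t \<in> {0..2*pi} \<Longrightarrow> 0 \<le> r \<Longrightarrow> r < 1 \<Longrightarrow> l < cmod (f (of_real r * cis t)) \<Longrightarrow> t \<in> U"
proof -
  define Q where "Q = {0..<1::real} \<inter> \<rat>"
  define q where "q = from_nat_into Q"
  have "0 \<in> Q" by (simp add: Q_def)
  then have Q0: "Q \<noteq> {}" by blast
  have cQ: "countable Q" by (auto simp: Q_def intro: countable_Int2 countable_rat)
  have q: "0 \<le> q i" "q i < 1" for i
    using from_nat_into[OF Q0, of i] by (auto simp: q_def Q_def)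
  define V where "V k = {t \<in> space circ. \<exists>i\<le>k. l < cmod (f (of_real (q i) * cis t))}" for k
  have [measurable]: "(\<lambda>t. f (of_real (q i) * cis t)) \<in> borel_measurable circ" for i
    by (intro measurable_circ_cont continuous_circle H2_holo f q)
  have V[measurable]: "V k \<in> sets circ" for k unfolding V_def by measurable
  have Vle: "emeasure circ (V k) \<le> ennreal (512 * pi * (h2norm f)\<^sup>2 / l\<^sup>2)" for k
  proof -
    obtain \<rho> R where [measurable]: "\<rho> \<in> borel_measurable circ" and R: "R < 1" "\<And>t. 0 \<le> \<rho> t" "\<And>t. \<rho> t \<le> R"
      and sel: "\<And>t. t \<in> V k \<Longrightarrow> l < cmod (f (of_real (\<rho> t) * cis t))"
      using radius_selection[of f q k l, OF f q] unfolding V_def by blast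
    have "ennreal (l\<^sup>2) * emeasure circ (V k) = (\<integral>\<^sup>+t. ennreal (l\<^sup>2) * indicator (V k) t \<partial>circ)"
      by (simp add: nn_integral_cmult_indicator)
    also have "\<dots> \<le> (\<integral>\<^sup>+t. (ennreal (cmod (f (of_real (\<rho> t) * cis t))))\<^sup>2 \<partial>circ)"
      using l by (intro nn_integral_mono) (auto simp: indicator_def ennreal_power intro!: ennreal_leI power_mono dest!: sel)
    also have "\<dots> \<le> ennreal (512 * pi * (h2norm f)\<^sup>2)"
      by (rule H2_maximal[OF f _ R(2,3,1)]) measurable
    also have "\<dots> = ennreal (l\<^sup>2) * ennreal (512 * pi * (h2norm f)\<^sup>2 / l\<^sup>2)"
      using l by (subst ennreal_mult'[symmetric]) auto
    finally show ?thesis using l by (subst (asm) ennreal_mult_le_mult_iff) auto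
  qed
  show ?thesis
  proof
    show "(\<Union>k. V k) \<in> sets circ" by auto
    have "incseq V" unfolding incseq_def V_def using order_trans by blast
    then have "emeasure circ (\<Union>k. V k) = (SUP k. emeasure circ (V k))"
      by (subst SUP_emeasure_incseq) auto
    also have "\<dots> \<le> ennreal (512 * pi * (h2norm f)\<^sup>2 / l\<^sup>2)" by (rule SUP_least) (rule Vle)
    finally show "emeasure circ (\<Union>k. V k) \<le> ennreal (512 * pi * (h2norm f)\<^sup>2 / l\<^sup>2)" .
    fix t r assume t: "t \<in> {0..2*pi}" and r: "0 \<le> r" "r < 1" and less: "l < cmod (f (of_real r * cis t))"
    have "continuous_on {0..<1} (\<lambda>r. cmod (f (of_real r * cis t)))"
      by (intro continuous_on_norm continuous_on_compose2[OF holomorphic_on_imp_continuous_on[OF H2_holo[OF f]]] continuous_intros)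
         (auto simp: norm_mult)
    moreover have "r \<in> {0..<1}" using r by auto
    ultimately obtain d where d: "d > 0" "\<And>r'. r' \<in> {0..<1} \<Longrightarrow> dist r' r < d \<Longrightarrow>
        dist (cmod (f (of_real r' * cis t))) (cmod (f (of_real r * cis t))) < cmod (f (of_real r * cis t)) - l"
      using less unfolding continuous_on_iff by (metis diff_gt_0_iff_gt)
    \<comment> \<open>A rational radius slightly above \<open>r\<close>, so close that the modulus
      still exceeds \<open>l\<close> there.\<close>
    obtain x where x: "x \<in> \<rat>" "r < x" "x < min 1 (r + d)"
      using Rats_dense_in_real[of r "min 1 (r + d)"] r d(1) by auto
    then have "x \<in> Q" using r by (auto simp: Q_def)
    then obtain i where i: "q i = x" unfolding q_def using from_nat_into_surj[OF cQ] by blast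
    have "l < cmod (f (of_real (q i) * cis t))"
      using d(2)[of x] x r i by (auto simp: dist_real_def)
    then show "t \<in> (\<Union>k. V k)" using t by (auto simp: V_def)
  qed
qed

section \<open>Radial limits\<close>

lemma H2_partial_sums_tendsto:
  assumes f: "f \<in> H2"
  shows "(\<lambda>N. h2norm (\<lambda>z. f z - (\<Sum>n<N. tcoeff f n * zpow n z))) \<longlonglongrightarrow> 0"
proof -
  define P where "P N = (\<lambda>z. \<Sum>n<N. tcoeff f n * zpow n z)" for N
  define b where "b k = (cmod (tcoeff f k))\<^sup>2" for k
  have P: "P N \<in> H2" for N unfolding P_def by auto
  have tP: "tcoeff (P N) k = (if k < N then tcoeff f k else 0)" for N k
    unfolding P_def
    by (simp add: tcoeff_sum tcoeff_cmult tcoeff_zpow if_distrib[of "\<lambda>x. _ * x"] cong: if_cong)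
  have sb: "b sums (h2norm f)\<^sup>2" unfolding b_def by (rule h2norm_sq_sums[OF f])
  have "(h2norm (\<lambda>z. f z - P N z))\<^sup>2 = (h2norm f)\<^sup>2 - (\<Sum>k<N. b k)" for N
  proof -
    have "(\<lambda>k. b k - (if k \<in> {..<N} then b k else 0)) sums ((h2norm f)\<^sup>2 - (\<Sum>k<N. b k))"
      by (intro sums_diff sb sums_If_finite_set) auto
    moreover have "(\<lambda>k. b k - (if k \<in> {..<N} then b k else 0)) = (\<lambda>k. (cmod (tcoeff (\<lambda>z. f z - P N z) k))\<^sup>2)"
      by (auto simp: tcoeff_diff f P tP b_def)
    ultimately show ?thesis using h2norm_sq_sums[OF H2_diff[OF f P]] by (auto dest: sums_unique2)
  qed
  moreover have "(\<lambda>N. (h2norm f)\<^sup>2 - (\<Sum>k<N. b k)) \<longlonglongrightarrow> (h2norm f)\<^sup>2 - (h2norm f)\<^sup>2"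
    using sb unfolding sums_def by (intro tendsto_intros)
  ultimately have "(\<lambda>N. (h2norm (\<lambda>z. f z - P N z))\<^sup>2) \<longlonglongrightarrow> 0" by simp
  from tendsto_real_sqrt[OF this] show ?thesis
    by (simp add: f P) (simp add: P_def)
qed

text \<open>Cauchy's criterion: the constant \<open>c\<close> may change with \<open>e\<close>, and
  completeness supplies the limit.\<close>

lemma tendsto_of_approx:
  fixes h :: "real \<Rightarrow> complex"
  assumes "\<And>e. e > 0 \<Longrightarrow> \<exists>c. \<forall>\<^sub>F r in at_left 1. cmod (h r - c) < e"
  shows "\<exists>l. (h \<longlongrightarrow> l) (at_left 1)"
proof -
  have "cauchy_filter (filtermap h (at_left 1))"
    unfolding cauchy_filter_metric_filtermap
  proof (intro allI impI)
    fix e :: real assume "e > 0"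
    then obtain c where c: "\<forall>\<^sub>F r in at_left 1. cmod (h r - c) < e/2" using assms[of "e/2"] by auto
    show "\<exists>P. eventually P (at_left 1) \<and> (\<forall>x y. P x \<and> P y \<longrightarrow> dist (h x) (h y) < e)"
    proof (intro exI conjI allI impI)
      show "\<forall>\<^sub>F r in at_left 1. cmod (h r - c) < e/2" by (rule c)
      fix x y assume *: "cmod (h x - c) < e/2 \<and> cmod (h y - c) < e/2"
      then show "dist (h x) (h y) < e"
        using dist_triangle_half_l[of "h x" c e "h y"] by (simp add: dist_norm)
    qed
  qed
  moreover have "filtermap h (at_left 1) \<noteq> bot" by (simp add: filtermap_bot_iff)
  ultimately show ?thesis
    using complete_UNIV[where 'a=complex] unfolding complete_uniform filterlim_def by auto
qed

text \<open>The polynomials \<open>P N\<close> are continuous up to the boundary. For fixed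
  \<open>k\<close>, the remainder \<open>g N\<close> is at most \<open>1 / Suc k\<close> along every
  radius outside \<open>U N k\<close>, whose measure tends to 0 with \<open>N\<close>. Off the null
  set of those \<open>t\<close> that lie in all \<open>U N k\<close> for some \<open>k\<close>, the
  Cauchy criterion holds.\<close>

theorem H2_radial_limits:
  assumes f: "f \<in> H2"
  shows "AE t in circ. \<exists>l. ((\<lambda>r. f (of_real r * cis t)) \<longlongrightarrow> l) (at_left 1)"
proof -
  define P where "P N = (\<lambda>z. \<Sum>n<N. tcoeff f n * zpow n z)" for N
  define g where "g N = (\<lambda>z. f z - P N z)" for N
  have g: "g N \<in> H2" for N unfolding g_def P_def using f by auto
  have g0: "(\<lambda>N. h2norm (g N)) \<longlonglongrightarrow> 0"
    unfolding g_def P_def by (rule H2_partial_sums_tendsto[OF f])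
  have "\<exists>U. U \<in> sets circ \<and> emeasure circ U \<le> ennreal (512 * pi * (h2norm (g N))\<^sup>2 / (1 / Suc k)\<^sup>2) \<and>
    (\<forall>t r. t \<in> {0..2*pi} \<longrightarrow> 0 \<le> r \<longrightarrow> r < 1 \<longrightarrow> 1 / Suc k < cmod (g N (of_real r * cis t)) \<longrightarrow> t \<in> U)" for N k
  proof -
    have l: "0 < 1 / real (Suc k)" by simp
    show ?thesis by (rule H2_weak_type[OF g[of N] l]) blast
  qed
  then obtain U where U: "\<And>N k. U N k \<in> sets circ"
      "\<And>N k. emeasure circ (U N k) \<le> ennreal (512 * pi * (h2norm (g N))\<^sup>2 / (1 / Suc k)\<^sup>2)"
      "\<And>N k t r. t \<in> {0..2*pi} \<Longrightarrow> 0 \<le> r \<Longrightarrow> r < 1 \<Longrightarrow> 1 / Suc k < cmod (g N (of_real r * cis t)) \<Longrightarrow> t \<in> U N k"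
    by metis
  have "(\<Inter>N. U N k) \<in> null_sets circ" for k
  proof (rule null_setsI)
    show "(\<Inter>N. U N k) \<in> sets circ" using U(1) by auto
    have "emeasure circ (\<Inter>N. U N k) \<le> ennreal (512 * pi * (h2norm (g N))\<^sup>2 / (1 / Suc k)\<^sup>2)" for N
      by (rule order_trans[OF emeasure_mono U(2)]) (auto intro: U(1))
    moreover have "(\<lambda>N. ennreal (512 * pi * (h2norm (g N))\<^sup>2 / (1 / Suc k)\<^sup>2)) \<longlonglongrightarrow> ennreal (512 * pi * 0\<^sup>2 / (1 / Suc k)\<^sup>2)"
      by (intro tendsto_ennrealI tendsto_intros g0) auto
    ultimately have "emeasure circ (\<Inter>N. U N k) \<le> ennreal (512 * pi * 0\<^sup>2 / (1 / Suc k)\<^sup>2)"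
      by (intro LIMSEQ_le_const) auto
    then show "emeasure circ (\<Inter>N. U N k) = 0" by simp
  qed
  then have "(\<Union>k. \<Inter>N. U N k) \<in> null_sets circ" by auto
  then show ?thesis
  proof (rule AE_I')
    show "{t \<in> space circ. \<not> (\<exists>l. ((\<lambda>r. f (of_real r * cis t)) \<longlongrightarrow> l) (at_left 1))} \<subseteq> (\<Union>k. \<Inter>N. U N k)"
    proof (rule subsetI, rule ccontr)
      fix t assume t: "t \<in> {t \<in> space circ. \<not> (\<exists>l. ((\<lambda>r. f (of_real r * cis t)) \<longlongrightarrow> l) (at_left 1))}"
        "t \<notin> (\<Union>k. \<Inter>N. U N k)"
      have "\<exists>l. ((\<lambda>r. f (of_real r * cis t)) \<longlongrightarrow> l) (at_left 1)"
      proof (rule tendsto_of_approx)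
        fix e :: real assume "e > 0"
        obtain k where k: "1 / Suc k < e/2" using nat_approx_posE[of "e/2"] \<open>e > 0\<close> by auto
        obtain N where "t \<notin> U N k" using t(2) by blast
        then have gN: "cmod (g N (of_real r * cis t)) \<le> 1 / Suc k" if "0 \<le> r" "r < 1" for r
          using U(3)[of t r k N] t(1) that by force
        define p where "p r = (\<Sum>n<N. tcoeff f n * (of_real r * cis t) ^ n)" for r
        have p: "P N (of_real r * cis t) = p r" if "0 \<le> r" "r < 1" for r
          using that by (simp add: P_def p_def zpow_apply norm_mult)
        have "(p \<longlongrightarrow> p 1) (at_left 1)"
          unfolding p_def by (intro tendsto_intros)
        then have ev: "\<forall>\<^sub>F r in at_left 1. dist (p r) (p 1) < e/2"
          using \<open>e > 0\<close> by (intro tendstoD) auto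
        have "\<forall>\<^sub>F r in at_left 1. r \<in> {0<..<1::real}" by (rule eventually_at_left_real) simp
        with ev have "\<forall>\<^sub>F r in at_left 1. cmod (f (of_real r * cis t) - p 1) < e"
        proof eventually_elim
          case (elim r)
          have "cmod (f (of_real r * cis t) - p 1) \<le> cmod (g N (of_real r * cis t)) + cmod (p r - p 1)"
            using norm_triangle_ineq[of "g N (of_real r * cis t)" "p r - p 1"] p[of r] elim by (simp add: g_def)
          also have "\<dots> < e" using gN[of r] k elim by (simp add: dist_norm)
          finally show ?case .
        qed
        then show "\<exists>c. \<forall>\<^sub>F r in at_left 1. cmod (f (of_real r * cis t) - c) < e" by blast
      qed
      then show False using t(1) by blast
    qed
  qed
qed

section \<open>Radial limits of modulus one\<close>

lemma circle_mean_tendsto: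
  assumes f: "f \<in> H2"
  shows "((\<lambda>r. \<integral>t. (cmod (f (of_real r * cis t)))\<^sup>2 \<partial>circ) \<longlongrightarrow> 2 * pi * (h2norm f)\<^sup>2) (at_left 1)"
proof -
  define m where "m r = (\<integral>t. (cmod (f (of_real r * cis t)))\<^sup>2 \<partial>circ)" for r
  have in01: "\<forall>\<^sub>F r in at_left 1. r \<in> {0<..<1::real}" by (rule eventually_at_left_real) simp
  have "((\<lambda>r. m r / (2*pi)) \<longlongrightarrow> (h2norm f)\<^sup>2) (at_left 1)"
  proof (rule order_tendstoI)
    fix y assume "y < (h2norm f)\<^sup>2"
    with h2norm_sq_sums[OF f] have "\<forall>\<^sub>F N in sequentially. y < (\<Sum>n<N. (cmod (tcoeff f n))\<^sup>2)"
      unfolding sums_def by (rule order_tendstoD)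
    then obtain N where N: "y < (\<Sum>n<N. (cmod (tcoeff f n))\<^sup>2)"
      by (auto simp: eventually_sequentially)
    have "((\<lambda>r::real. \<Sum>n<N. (cmod (tcoeff f n))\<^sup>2 * r ^ (2*n)) \<longlongrightarrow> (\<Sum>n<N. (cmod (tcoeff f n))\<^sup>2)) (at_left 1)"
      by (rule tendsto_eq_intros | simp)+
    from order_tendstoD(1)[OF this N] in01 show "\<forall>\<^sub>F r in at_left 1. y < m r / (2*pi)"
    proof eventually_elim
      case (elim r)
      then have *: "(\<lambda>n. (cmod (tcoeff f n))\<^sup>2 * r ^ (2*n)) sums (m r / (2*pi))"
        unfolding m_def by (intro circle_mean H2_holo f) auto
      have "(\<Sum>n<N. (cmod (tcoeff f n))\<^sup>2 * r ^ (2*n)) \<le> m r / (2*pi)"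
        using * elim by (subst sums_unique[OF *], intro sum_le_suminf) (auto simp: sums_iff)
      with elim show ?case by simp
    qed
  next
    fix y assume y: "(h2norm f)\<^sup>2 < y"
    from in01 show "\<forall>\<^sub>F r in at_left 1. m r / (2*pi) < y"
    proof eventually_elim
      case (elim r)
      then have "m r / (2*pi) \<le> (h2norm f)\<^sup>2"
        using circle_mean_le[OF f, of r] by (simp add: m_def field_simps)
      with y show ?case by simp
    qed
  qed
  from tendsto_mult[OF tendsto_const[of "2*pi"] this] show ?thesis by (simp add: m_def)
qed

text \<open>Along radii tending to 1, the functions \<open>1 - (cmod f)\<^sup>2\<close> lie between
  0 and 1, while their integrals tend to \<open>2 * pi - 2 * pi * (h2norm f)\<^sup>2 = 0\<close>. By
  dominated convergence the nonnegative limit has integral 0, so it vanishes almost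
  everywhere.\<close>

lemma unimodular_radial_limits:
  assumes f: "f \<in> H2" and le: "\<And>z. z \<in> D \<Longrightarrow> cmod (f z) \<le> 1" and n: "h2norm f = 1"
  shows "AE t in circ. \<exists>l. cmod l = 1 \<and> ((\<lambda>r. f (of_real r * cis t)) \<longlongrightarrow> l) (at_left 1)"
proof -
  define r where "r n = 1 - 1 / (real n + 2)" for n
  have r: "0 \<le> r n" "r n < 1" for n by (auto simp: r_def field_simps)
  have "r \<longlonglongrightarrow> 1" unfolding r_def by real_asymp
  then have rlim: "filterlim r (at_left 1) sequentially"
    unfolding filterlim_at using r by (auto simp: less_imp_neq)
  define u where "u n t = 1 - (cmod (f (of_real (r n) * cis t)))\<^sup>2" for n t
  have cf: "continuous_on UNIV (\<lambda>t. (cmod (f (of_real (r n) * cis t)))\<^sup>2)" for n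
    by (intro continuous_intros continuous_circle H2_holo f r)
  have [measurable]: "u n \<in> borel_measurable circ" for n
    unfolding u_def by (intro measurable_circ_cont continuous_on_diff continuous_on_const cf)
  have u01: "0 \<le> u n t" "u n t \<le> 1" for n t
    using le[of "of_real (r n) * cis t"] r[of n] by (auto simp: u_def norm_mult abs_square_le_1)
  \<comment> \<open>\<open>lim\<close> is total, which makes \<open>L\<close> measurable at once;
    its value matters only where the sequence converges.\<close>
  define L where "L t = lim (\<lambda>n. u n t)" for t
  have [measurable]: "L \<in> borel_measurable circ"
    unfolding L_def by (rule borel_measurable_lim_metric) measurable
  have conv: "AE t in circ. \<exists>l. ((\<lambda>r. f (of_real r * cis t)) \<longlongrightarrow> l) (at_left 1)"
    by (rule H2_radial_limits[OF f])
  have seq: "(\<lambda>n. u n t) \<longlonglongrightarrow> 1 - (cmod l)\<^sup>2"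
    if "((\<lambda>r. f (of_real r * cis t)) \<longlongrightarrow> l) (at_left 1)" for t l
    unfolding u_def by (intro tendsto_intros filterlim_compose[OF that rlim])
  have uL: "AE t in circ. (\<lambda>n. u n t) \<longlonglongrightarrow> L t"
    using conv by eventually_elim (metis L_def limI seq)
  have i1: "integrable circ (\<lambda>t. 1::real)" by simp
  have bd: "AE t in circ. norm (u n t) \<le> 1" for n
    using u01 by (intro AE_I2) simp
  have iL: "integrable circ L"
    by (rule integrable_dominated_convergence[OF _ _ i1 uL bd]) measurable
  have "(\<lambda>n. integral\<^sup>L circ (u n)) \<longlonglongrightarrow> integral\<^sup>L circ L"
    by (rule integral_dominated_convergence[OF _ _ i1 uL bd]) measurable
  moreover have "(\<lambda>n. integral\<^sup>L circ (u n)) \<longlonglongrightarrow> 2 * pi - 2 * pi * (h2norm f)\<^sup>2"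
  proof -
    have "integral\<^sup>L circ (u n) = 2 * pi - (\<integral>t. (cmod (f (of_real (r n) * cis t)))\<^sup>2 \<partial>circ)" for n
      unfolding u_def using emeasure_circ_space
      by (subst Bochner_Integration.integral_diff) (auto intro: integrable_circ_cont cf simp: measure_def)
    then show ?thesis
      using filterlim_compose[OF circle_mean_tendsto[OF f] rlim] by (auto intro!: tendsto_intros)
  qed
  ultimately have L0: "integral\<^sup>L circ L = 0"
    using n by (auto dest: LIMSEQ_unique)
  have "AE t in circ. 0 \<le> L t"
    using uL by eventually_elim (use u01 in \<open>auto intro: LIMSEQ_le_const\<close>)
  then have "AE t in circ. L t = 0"
    using integral_nonneg_eq_0_iff_AE[OF iL] L0 by simp
  with conv uL show ?thesis
  proof eventually_elim
    case (elim t)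
    then obtain l where l: "((\<lambda>r. f (of_real r * cis t)) \<longlongrightarrow> l) (at_left 1)" by blast
    have "1 - (cmod l)\<^sup>2 = 0" using LIMSEQ_unique[OF seq[OF l] elim(2)] elim(3) by simp
    then have "cmod l = 1" by (simp add: power2_eq_1_iff) (smt (verit) norm_ge_zero)
    then show ?case using l by blast
  qed
qed

text \<open>By periodicity the exceptional set lies in the union of countably many translates of a
  null set by multiples of \<open>2 * pi\<close>.\<close>

lemma AE_circ_imp_AE_lborel:
  assumes "AE t in circ. Q (cis t)"
  shows "AE t in lborel. Q (cis t)"
proof -
  have "AE t in lborel. t \<in> {0..2*pi} \<longrightarrow> Q (cis t)"
    using assms unfolding circ_def by (subst (asm) AE_restrict_space_iff) auto
  then obtain N where N: "N \<in> null_sets lborel" "{t. \<not> (t \<in> {0..2*pi} \<longrightarrow> Q (cis t))} \<subseteq> N"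
    by (auto elim: AE_E simp: null_sets_def)
  define Z where "Z = (\<Union>k::int. {x. x - 2 * pi * of_int k \<in> N})"
  have "Z \<in> null_sets lborel"
    unfolding Z_def by (intro null_sets_UN' null_sets_translation N) auto
  then show ?thesis
  proof (rule AE_I')
    show "{t \<in> space lborel. \<not> Q (cis t)} \<subseteq> Z"
    proof
      fix t assume t: "t \<in> {t \<in> space lborel. \<not> Q (cis t)}"
      define k where "k = \<lfloor>t / (2*pi)\<rfloor>"
      have "of_int k \<le> t / (2*pi)" "t / (2*pi) < of_int k + 1" by (auto simp: k_def)
      then have "t - 2 * pi * of_int k \<in> {0..2*pi}" by (auto simp: field_simps)
      moreover have "cis (t - 2 * pi * of_int k) = cis t"
        by (simp flip: cis_divide add: cis_multiple_2pi)
      ultimately have "t - 2 * pi * of_int k \<in> N" using t N(2) by auto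
      then show "t \<in> Z" by (auto simp: Z_def)
    qed
  qed
qed

theorem inner_fun_unit_norm:
  assumes "f \<in> H2" "\<And>z. z \<in> D \<Longrightarrow> cmod (f z) \<le> 1" "h2norm f = 1"
  shows "inner_fun f"
  unfolding inner_fun_def Hinf_def
  using assms AE_circ_imp_AE_lborel[of "\<lambda>c. \<exists>l. cmod l = 1 \<and> ((\<lambda>r. f (of_real r * c)) \<longlongrightarrow> l) (at_left 1)"]
    unimodular_radial_limits[OF assms] by (auto simp: H2_holo intro!: exI[of _ 1])

section \<open>Isometric vectors of multiplication operators\<close>

text \<open>With the norms fixed, the bound on sums estimates the real part of the inner product
  from above and the bound on differences from below.\<close>

lemma contraction_isometric_add:
  assumes "f \<in> H2" "g \<in> H2" "f' \<in> H2" "g' \<in> H2"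
    and "h2norm f' = h2norm f" "h2norm g' = h2norm g"
    and le: "h2norm (\<lambda>z. f' z + g' z) \<le> h2norm (\<lambda>z. f z + g z)" "h2norm (\<lambda>z. f' z - g' z) \<le> h2norm (\<lambda>z. f z - g z)"
  shows "h2norm (\<lambda>z. f' z + g' z) = h2norm (\<lambda>z. f z + g z)"
proof -
  have "(h2norm (\<lambda>z. f' z + g' z))\<^sup>2 \<le> (h2norm (\<lambda>z. f z + g z))\<^sup>2" "(h2norm (\<lambda>z. f' z - g' z))\<^sup>2 \<le> (h2norm (\<lambda>z. f z - g z))\<^sup>2"
    using le assms by (auto intro!: power_mono)
  then have "(h2norm (\<lambda>z. f' z + g' z))\<^sup>2 = (h2norm (\<lambda>z. f z + g z))\<^sup>2"
    using assms by (simp add: h2norm_add_sq h2norm_diff_sq)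
  then show ?thesis using assms by (simp add: power2_eq_iff_nonneg)
qed

lemma orthogonal_of_minimal:
  assumes u: "u \<in> H2" and h: "h \<in> H2" and min: "\<And>c. h2norm u \<le> h2norm (\<lambda>z. u z + c * h z)"
  shows "h2inner u h = 0"
proof (cases "h2norm h = 0")
  case True
  then show ?thesis using h2_cauchy_schwarz[OF u h] by simp
next
  case False
  define a where "a = h2inner u h"
  define n where "n = (h2norm h)\<^sup>2"
  have n: "n > 0" using False by (simp add: n_def)
  \<comment> \<open>The minimizer of the squared norm of \<open>u + c h\<close> as a function of
    \<open>c\<close>.\<close>
  define c where "c = - a / of_real n"
  have "(h2norm u)\<^sup>2 \<le> (h2norm (\<lambda>z. u z + c * h z))\<^sup>2" using min[of c] u by (intro power_mono) auto
  also have "\<dots> = (h2norm u)\<^sup>2 + (cmod c)\<^sup>2 * n + 2 * Re (cnj c * a)"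
    using u h by (simp add: h2norm_add_sq h2norm_cmult h2inner_cmult_right power_mult_distrib n_def a_def)
  also have "(cmod c)\<^sup>2 * n = (cmod a)\<^sup>2 / n"
    using n by (simp add: c_def norm_divide power_divide power2_eq_square)
  also have "cnj c * a = - of_real ((cmod a)\<^sup>2 / n)"
    unfolding c_def of_real_divide complex_norm_square by simp
  finally have "(cmod a)\<^sup>2 / n \<le> 0" by simp
  then show ?thesis using n by (simp add: a_def divide_le_0_iff)
qed

lemma h2inner_zero_right [simp]: "h2inner f (\<lambda>z. 0) = 0"
  by (simp add: h2inner_def)

lemma h2inner_sum_left:
  assumes "\<And>i. i \<in> I \<Longrightarrow> f i \<in> H2" "h \<in> H2"
  shows "h2inner (\<lambda>z. \<Sum>i\<in>I. f i z) h = (\<Sum>i\<in>I. h2inner (f i) h)"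
  using assms by (induction I rule: infinite_finite_induct) (auto simp: h2inner_add_left)

lemma h2inner_sum_right:
  assumes "\<And>i. i \<in> I \<Longrightarrow> f i \<in> H2" "h \<in> H2"
  shows "h2inner h (\<lambda>z. \<Sum>i\<in>I. f i z) = (\<Sum>i\<in>I. h2inner h (f i))"
  using assms by (induction I rule: infinite_finite_induct) (auto simp: h2inner_add_right)

lemma funpow_shift_H2 [simp, intro]: "u \<in> H2 \<Longrightarrow> (shift ^^ k) u \<in> H2"
  by (induction k) auto

lemma funpow_shift_apply: "u \<in> H2 \<Longrightarrow> (shift ^^ k) u z = z ^ k * u z"
  by (induction k arbitrary: z) (auto simp: shift_apply H2_off)

text \<open>A function orthogonal to its own shifts multiplies polynomials isometrically, up to its norm;
  testing on partial sums of the Szego kernel at \<open>w\<close> bounds it at \<open>w\<close>.\<close>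

lemma wandering_bounded:
  assumes u: "u \<in> H2" and orth: "\<And>k. k > 0 \<Longrightarrow> h2inner u ((shift ^^ k) u) = 0" and w: "w \<in> D"
  shows "cmod (u w) \<le> h2norm u"
proof -
  have o: "h2inner ((shift ^^ j) u) ((shift ^^ k) u) = 0" if "j < k" for j k
    using that
  proof (induction j arbitrary: k)
    case 0 then show ?case using orth by simp
  next
    case (Suc j)
    then obtain k' where "k = Suc k'" "j < k'" by (cases k) auto
    then show ?case using Suc.IH u by (simp add: h2inner_shift)
  qed
  have nS: "h2norm ((shift ^^ k) u) = h2norm u" for k
    by (induction k) (auto simp: h2norm_shift u)
  define F where "F n = (\<lambda>z. \<Sum>k<n. cnj w ^ k * (shift ^^ k) u z)" for n
  have F: "F n \<in> H2" for n unfolding F_def using u by auto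
  define s where "s n = (\<Sum>k<n. ((cmod w)\<^sup>2) ^ k)" for n
  have Fn: "(h2norm (F n))\<^sup>2 = (h2norm u)\<^sup>2 * s n" for n
  proof (induction n)
    case (Suc n)
    have "h2inner (F n) (\<lambda>z. cnj w ^ n * (shift ^^ n) u z) = 0"
      unfolding F_def using u o
      by (subst h2inner_sum_left) (auto simp: h2inner_cmult_left h2inner_cmult_right)
    moreover have "F (Suc n) = (\<lambda>z. F n z + cnj w ^ n * (shift ^^ n) u z)"
      by (simp add: F_def)
    moreover have "(cmod (cnj w ^ n))\<^sup>2 = ((cmod w)\<^sup>2) ^ n"
      by (simp add: norm_power power_swap)
    ultimately show ?case
      using Suc F u by (simp add: h2norm_add_sq h2norm_cmult nS power_mult_distrib s_def algebra_simps)
  qed (simp add: F_def s_def h2norm_zero_iff)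
  have w1: "(cmod w)\<^sup>2 < 1" using w by (simp add: abs_square_less_1)
  define S where "S = 1 / (1 - (cmod w)\<^sup>2)"
  have S: "S > 0" using w1 by (simp add: S_def)
  have sS: "s \<longlonglongrightarrow> S"
    using geometric_sums[of "(cmod w)\<^sup>2"] w1 unfolding sums_def s_def S_def by simp
  \<comment> \<open>At \<open>w\<close> the function \<open>F n\<close> has the value
    \<open>s n * u w\<close>, its norm is \<open>h2norm u * sqrt (s n)\<close>, and
    \<open>sqrt S\<close> is the constant of point evaluation at \<open>w\<close>. In the limit both
    sides carry the factor \<open>S\<close>.\<close>
  have "cmod (u w) * s n \<le> h2norm u * sqrt (s n) * sqrt S" for n
  proof -
    have s0: "s n \<ge> 0" by (auto simp: s_def intro: sum_nonneg)
    have "cnj w ^ k * w ^ k = of_real (((cmod w)\<^sup>2) ^ k)" for k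
      unfolding of_real_power[of "(cmod w)\<^sup>2" k] complex_norm_square power_mult_distrib by (rule mult.commute)
    then have "F n w = of_real (s n) * u w"
      unfolding F_def s_def of_real_sum sum_distrib_right
      by (simp add: funpow_shift_apply u mult.assoc[symmetric] del: of_real_power)
    then have "cmod (u w) * s n = cmod (F n w)" using s0 by (simp add: norm_mult)
    also have "\<dots> \<le> h2norm (F n) * sqrt S"
      using H2_point_bound[OF F w, of n] by (simp add: S_def real_sqrt_divide)
    also have "h2norm (F n) = h2norm u * sqrt (s n)"
      using arg_cong[OF Fn[of n], of sqrt] F u by (simp add: real_sqrt_mult)
    finally show ?thesis .
  qed
  then have "cmod (u w) * S \<le> h2norm u * sqrt S * sqrt S"
    by (intro LIMSEQ_le[of "\<lambda>n. cmod (u w) * s n" _ "\<lambda>n. h2norm u * sqrt (s n) * sqrt S"] tendsto_intros sS) auto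
  then have "cmod (u w) * S \<le> h2norm u * S" using S by (simp add: mult.assoc)
  then show ?thesis using S by simp
qed

text \<open>Beurling's argument: \<open>{f. \<parallel>\<theta> f\<parallel> = \<parallel>f\<parallel>}\<close> is a nonzero closed shift-invariant subspace, and its
  element of least norm with value 1 at 0 is a bounded multiple of an inner function.\<close>

theorem unit_norm_of_isometric_vector:
  assumes th: "\<theta> \<in> H2" and th1: "\<And>z. z \<in> D \<Longrightarrow> cmod (\<theta> z) \<le> 1"
    and p: "p \<in> H2" "p \<noteq> (\<lambda>z. 0)" and iso: "h2norm (pmul \<theta> p) = h2norm p"
  shows "h2norm \<theta> = 1"
proof -
  define T where "T = pmul \<theta>"
  have T: "T f \<in> H2" "h2norm (T f) \<le> h2norm f" if "f \<in> H2" for f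
    using pmul_bounded[OF H2_holo[OF th] th1 _ that] by (auto simp: T_def)
  have Tadd: "T (\<lambda>z. f z + g z) = (\<lambda>z. T f z + T g z)" for f g
    by (auto simp: T_def pmul_def distrib_left)
  have Tdiff: "T (\<lambda>z. f z - g z) = (\<lambda>z. T f z - T g z)" for f g
    by (auto simp: T_def pmul_def right_diff_distrib)
  have Tcmult: "T (\<lambda>z. c * f z) = (\<lambda>z. c * T f z)" for c f
    by (auto simp: T_def pmul_def)
  have Tshift: "T (shift f) = shift (T f)" for f
    by (auto simp: T_def pmul_def shift_apply)
  define N where "N = {f \<in> H2. h2norm (T f) = h2norm f}"
  have NH: "f \<in> H2" if "f \<in> N" for f using that by (simp add: N_def)
  \<comment> \<open>Norm equality is not a linear condition by itself; it becomes one because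
    \<open>T\<close> is a contraction.\<close>
  have Nadd: "(\<lambda>z. f z + g z) \<in> N" if "f \<in> N" "g \<in> N" for f g
  proof -
    have "h2norm (\<lambda>z. T f z + T g z) = h2norm (\<lambda>z. f z + g z)"
      by (rule contraction_isometric_add) (use that T(2)[OF H2_add, of f g] T(2)[OF H2_diff, of f g] in \<open>auto simp: N_def T Tadd Tdiff\<close>)
    then show ?thesis using that by (auto simp: N_def Tadd)
  qed
  have Ncmult: "(\<lambda>z. c * f z) \<in> N" if "f \<in> N" for f c
    using that by (auto simp: N_def Tcmult h2norm_cmult T)
  have Nshift: "shift f \<in> N" if "f \<in> N" for f
    using that by (auto simp: N_def Tshift h2norm_shift T)
  have Nbshift: "bshift f \<in> N" if "f \<in> N" "f 0 = 0" for f
  proof -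
    have f: "f \<in> H2" using that by (simp add: N_def)
    have "h2norm (T (bshift f)) = h2norm (T f)"
      using Tshift[of "bshift f"] f that by (simp add: shift_bshift h2norm_shift T)
    also have "\<dots> = h2norm (bshift f)"
      using that f h2norm_shift[of "bshift f"] by (simp add: shift_bshift N_def)
    finally show ?thesis using f by (auto simp: N_def)
  qed
  have Nlim: "f \<in> N" if "\<And>n. x n \<in> N" "f \<in> H2" "(\<lambda>n. h2norm (\<lambda>z. x n z - f z)) \<longlonglongrightarrow> 0" for x f
  proof -
    have x: "x n \<in> H2" for n using that(1) by (rule NH)
    have "(\<lambda>n. h2norm (\<lambda>z. T (x n) z - T f z)) \<longlonglongrightarrow> 0"
    proof (rule Lim_null_comparison[OF _ that(3)], intro always_eventually allI)
      show "norm (h2norm (\<lambda>z. T (x n) z - T f z)) \<le> h2norm (\<lambda>z. x n z - f z)" for n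
        using T(2)[OF H2_diff[OF x that(2)], of n] x that(2) by (simp add: Tdiff T)
    qed
    then have "(\<lambda>n. h2norm (T (x n))) \<longlonglongrightarrow> h2norm (T f)"
      by (rule tendsto_h2norm[rotated 2]) (auto simp: T x that)
    moreover have "(\<lambda>n. h2norm (x n)) \<longlonglongrightarrow> h2norm f"
      by (rule tendsto_h2norm) (use x that in auto)
    moreover have "h2norm (T (x n)) = h2norm (x n)" for n using that(1)[of n] by (simp add: N_def)
    ultimately show ?thesis using that(2) by (auto simp: N_def dest: LIMSEQ_unique)
  qed
  define A where "A = {f \<in> N. f 0 = 1}"
  \<comment> \<open>\<open>Nbshift\<close> allows removing a factor \<open>z\<close>. Doing so up to
    the first nonzero coefficient of \<open>p\<close> leaves an element of \<open>N\<close> that can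
    be normalized at 0.\<close>
  have "A \<noteq> {}"
  proof -
    have "\<exists>n. tcoeff p n \<noteq> 0" using H2_eqI[OF p(1) H2_zero] p(2) by auto
    define n where "n = (LEAST n. tcoeff p n \<noteq> 0)"
    have n: "tcoeff p n \<noteq> 0" "\<And>k. k < n \<Longrightarrow> tcoeff p k = 0"
      using LeastI_ex[OF \<open>\<exists>n. tcoeff p n \<noteq> 0\<close>] not_less_Least unfolding n_def by auto
    have pn: "(bshift ^^ k) p \<in> N \<and> (\<forall>j. tcoeff ((bshift ^^ k) p) j = tcoeff p (k + j))" if "k \<le> n" for k
      using that
    proof (induction k)
      case 0 then show ?case using p iso by (simp add: N_def T_def)
    next
      case (Suc k)
      then have *: "(bshift ^^ k) p \<in> N" "\<And>j. tcoeff ((bshift ^^ k) p) j = tcoeff p (k + j)" by auto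
      have "(bshift ^^ k) p 0 = 0" using *(2)[of 0] tcoeff_0[OF NH[OF *(1)]] n(2)[of k] Suc.prems by simp
      then show ?case using Nbshift[OF *(1)] * by (auto simp: tcoeff_bshift NH)
    qed
    define f where "f = (bshift ^^ n) p"
    have f: "f \<in> N" "f 0 \<noteq> 0" using pn[of n] n(1) tcoeff_0[of f] NH[of f] by (auto simp: f_def)
    then have "(\<lambda>z. (1 / f 0) * f z) \<in> A" using Ncmult[OF f(1), of "1 / f 0"] by (simp add: A_def)
    then show ?thesis by blast
  qed
  define d where "d = Inf (h2norm ` A)"
  have AH: "f \<in> H2" if "f \<in> A" for f using that by (simp add: A_def N_def)
  have bdd: "bdd_below (h2norm ` A)" by (rule bdd_belowI[of _ 0]) (auto simp: AH)
  have d_le: "d \<le> h2norm f" if "f \<in> A" for f unfolding d_def using that bdd by (auto intro: cInf_lower)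
  have d0: "d \<ge> 0" unfolding d_def using \<open>A \<noteq> {}\<close> by (intro cInf_greatest) (auto simp: AH)
  have "\<exists>f\<in>A. h2norm f < d + 1 / real (Suc n)" for n
    using cInf_lessD[of "h2norm ` A" "d + 1 / real (Suc n)"] \<open>A \<noteq> {}\<close> by (auto simp: d_def)
  then obtain x where x: "\<And>n. x n \<in> A" "\<And>n. h2norm (x n) < d + 1 / real (Suc n)" by metis
  have xH: "x n \<in> H2" for n using x(1) by (rule AH)
  have lim_x: "(\<lambda>n. h2norm (x n)) \<longlonglongrightarrow> d"
  proof (rule tendsto_sandwich[of "\<lambda>_. d" _ _ "\<lambda>n. d + 1 / real (Suc n)"])
    show "(\<lambda>n. d + 1 / real (Suc n)) \<longlonglongrightarrow> d"
      using tendsto_add[OF tendsto_const[of d] lim_1_over_n[THEN LIMSEQ_Suc]] by simp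
  qed (use d_le[OF x(1)] x(2)[THEN less_imp_le] in simp_all)
  \<comment> \<open>The midpoint of two elements of \<open>A\<close> is again in \<open>A\<close>,
    so its norm is at least \<open>d\<close>; the parallelogram law then makes the minimizing
    sequence Cauchy.\<close>
  have mid: "(h2norm (\<lambda>z. x m z - x n z))\<^sup>2 \<le> 2 * ((h2norm (x m))\<^sup>2 - d\<^sup>2) + 2 * ((h2norm (x n))\<^sup>2 - d\<^sup>2)" for m n
  proof -
    have "(\<lambda>z. (1/2) * (x m z + x n z)) \<in> A"
      using x(1)[of m] x(1)[of n] Ncmult[OF Nadd, of "x m" "x n" "1/2"] by (auto simp: A_def)
    from d_le[OF this] have "d \<le> h2norm (\<lambda>z. x m z + x n z) / 2"
      using h2norm_cmult[OF H2_add[OF xH[of m] xH[of n]], of "1/2"] by simp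
    then have "4 * d\<^sup>2 \<le> (h2norm (\<lambda>z. x m z + x n z))\<^sup>2"
      using power_mono[of d "h2norm (\<lambda>z. x m z + x n z) / 2" 2] d0 by (simp add: power_divide)
    then show ?thesis
      using h2norm_add_sq[OF xH[of m] xH[of n]] h2norm_diff_sq[OF xH[of m] xH[of n]] by simp
  qed
  obtain u where u: "u \<in> H2" "(\<lambda>n. h2norm (\<lambda>z. x n z - u z)) \<longlonglongrightarrow> 0"
  proof (rule H2_complete[OF xH])
    fix e :: real assume "e > 0"
    have "(\<lambda>n. 2 * ((h2norm (x n))\<^sup>2 - d\<^sup>2)) \<longlonglongrightarrow> 2 * (d\<^sup>2 - d\<^sup>2)"
      by (intro tendsto_intros lim_x)
    then have "\<forall>\<^sub>F n in sequentially. 2 * ((h2norm (x n))\<^sup>2 - d\<^sup>2) < e\<^sup>2 / 2"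
      using \<open>e > 0\<close> by (intro order_tendstoD) auto
    then obtain K where K: "\<And>n. n \<ge> K \<Longrightarrow> 2 * ((h2norm (x n))\<^sup>2 - d\<^sup>2) < e\<^sup>2 / 2"
      by (auto simp: eventually_sequentially)
    have "h2norm (\<lambda>z. x m z - x n z) < e" if "m \<ge> K" "n \<ge> K" for m n
    proof (rule power2_less_imp_less)
      show "(h2norm (\<lambda>z. x m z - x n z))\<^sup>2 < e\<^sup>2" using mid[of m n] K[OF that(1)] K[OF that(2)] by linarith
    qed (use \<open>e > 0\<close> in simp)
    then show "\<exists>K. \<forall>m\<ge>K. \<forall>n\<ge>K. h2norm (\<lambda>z. x m z - x n z) < e" by blast
  qed
  have "u \<in> N" by (rule Nlim[OF _ u]) (use x(1) in \<open>simp add: A_def\<close>)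
  moreover have u0: "u 0 = 1"
  proof -
    have "(\<lambda>n. x n 0) \<longlonglongrightarrow> u 0" by (rule H2_pointwise_limit[OF xH u])
    moreover have "x n 0 = 1" for n using x(1)[of n] by (simp add: A_def)
    ultimately show ?thesis by (simp add: LIMSEQ_const_iff)
  qed
  ultimately have uA: "u \<in> A" by (simp add: A_def)
  have ud: "h2norm u = d" using LIMSEQ_unique[OF tendsto_h2norm[OF xH u] lim_x] .
  have dpos: "d > 0" using h2norm_ge_coeff[OF u(1), of 0] tcoeff_0[OF u(1)] u0 ud by simp
  have orthN: "h2inner u (shift g) = 0" if "g \<in> N" for g
  proof (rule orthogonal_of_minimal)
    fix c
    have "(\<lambda>z. u z + c * shift g z) \<in> A"
      using Nadd[OF \<open>u \<in> N\<close> Ncmult[OF Nshift[OF that]], of c] u0 by (simp add: A_def shift_apply)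
    then show "h2norm u \<le> h2norm (\<lambda>z. u z + c * shift g z)" using d_le ud by simp
  qed (use u that NH in auto)
  have SN: "(shift ^^ k) u \<in> N" for k by (induction k) (auto simp: \<open>u \<in> N\<close> Nshift)
  have "h2inner u ((shift ^^ k) u) = 0" if "k > 0" for k
    using that orthN[OF SN[of "k - 1"]] by (cases k) auto
  then have ub: "cmod (u w) \<le> d" if "w \<in> D" for w
    using wandering_bounded[OF u(1) _ that] ud by simp
  \<comment> \<open>Now the roles are exchanged: \<open>u\<close> is regarded as a multiplier
    bounded by \<open>d\<close> acting on \<open>\<theta>\<close>, so
    \<open>d \<le> d * h2norm \<theta>\<close>.\<close>
  have "d = h2norm (T u)" using \<open>u \<in> N\<close> ud by (simp add: N_def)
  also have "T u = pmul u \<theta>" by (auto simp: T_def pmul_def mult.commute)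
  also have "h2norm (pmul u \<theta>) \<le> d * h2norm \<theta>"
    by (rule pmul_bounded(2)[OF H2_holo[OF u(1)] ub _ th]) (use d0 in auto)
  finally have "1 \<le> h2norm \<theta>" using dpos by simp
  moreover have "T one_H2 = \<theta>" using th by (auto simp: T_def pmul_def one_H2_def H2_off)
  with T(2)[OF one_H2_H2] have "h2norm \<theta> \<le> 1" by (simp add: h2norm_one)
  ultimately show ?thesis by simp
qed

section \<open>The subspace M\<close>

text \<open>The Schwarz lemma for \<open>z * \<theta> z\<close>. It asks for values strictly inside
  the disc, hence the factor \<open>c < 1\<close>, which tends to 1 at the end; at
  \<open>z = 0\<close> the bound on the derivative takes over.\<close>

lemma bounded_factor_by_one:
  assumes hol: "\<theta> holomorphic_on D" and le: "\<And>z. z \<in> D \<Longrightarrow> cmod (z * \<theta> z) \<le> 1" and z: "z \<in> D"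
  shows "cmod (\<theta> z) \<le> 1"
proof -
  have scaled: "c * cmod (\<theta> z) \<le> 1" if c: "0 \<le> c" "c < 1" for c :: real
  proof -
    define f where "f = (\<lambda>z. of_real c * (z * \<theta> z))"
    have f: "f holomorphic_on D" unfolding f_def using hol by (auto intro!: holomorphic_intros)
    have f1: "norm (f z) < 1" if "norm z < 1" for z
    proof -
      have "norm (f z) \<le> c * 1"
        unfolding f_def norm_mult[of "of_real c"] using c le[of z] that by (intro mult_mono) auto
      then show ?thesis using c by simp
    qed
    have S: "norm (f \<xi>) \<le> norm \<xi>" "norm (deriv f 0) \<le> 1" if "norm \<xi> < 1" for \<xi>
      using Schwarz_Lemma[OF f _ f1 that] by (auto simp: f_def)
    show ?thesis
    proof (cases "z = 0")
      case True
      have "(\<theta> has_field_derivative deriv \<theta> 0) (at 0)"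
        by (rule holomorphic_derivI[OF hol]) auto
      then have "(f has_field_derivative of_real c * \<theta> 0) (at 0)"
        unfolding f_def by (auto intro!: derivative_eq_intros)
      then have "deriv f 0 = of_real c * \<theta> 0" by (rule DERIV_imp_deriv)
      then show ?thesis using S(2)[of 0] c True by (simp add: norm_mult)
    next
      case False
      have "cmod z * (c * cmod (\<theta> z)) \<le> cmod z * 1"
        using S(1)[of z] z c by (simp add: f_def norm_mult mult_ac)
      then show ?thesis using False by simp
    qed
  qed
  show ?thesis
  proof (rule tendsto_upperbound)
    show "((\<lambda>c. c * cmod (\<theta> z)) \<longlongrightarrow> cmod (\<theta> z)) (at_left 1)"
      by (rule tendsto_eq_intros | simp)+
    show "\<forall>\<^sub>F c in at_left 1. c * cmod (\<theta> z) \<le> 1"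
      by (rule eventually_mono[OF eventually_at_left_real[of 0 1]]) (use scaled in auto)
  qed simp
qed

lemma h2inner_shift_right: "f \<in> H2 \<Longrightarrow> g \<in> H2 \<Longrightarrow> h2inner f (shift g) = h2inner (bshift f) g"
  using sums_Suc[of "\<lambda>n. tcoeff f n * cnj (tcoeff (shift g) n)" "h2inner (bshift f) g"]
    h2inner_sums[of "bshift f" g]
  by (auto simp: tcoeff_shift tcoeff_bshift intro: h2inner_eqI)

lemma pmul_commute: "pmul f g = pmul g f"
  by (auto simp: pmul_def mult.commute)

lemma RanH_H2: "f \<in> RanH \<theta> \<Longrightarrow> f \<in> H2"
  by (simp add: RanH_def)

locale shifted_subspace =
  fixes M :: "(complex \<Rightarrow> complex) set" and p q :: "complex \<Rightarrow> complex"
  assumes M: "closed_subspace_H2 M"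
    and p: "p \<in> M" and q: "q \<in> M" and p1: "h2norm p = 1" and q1: "h2norm q = 1"
    and shifted: "perp_in M p = shift ` (perp_in M q)"
begin

lemma M_H2 [simp]: "f \<in> M \<Longrightarrow> f \<in> H2"
  and M_add [simp]: "f \<in> M \<Longrightarrow> g \<in> M \<Longrightarrow> (\<lambda>z. f z + g z) \<in> M"
  and M_cmult [simp]: "f \<in> M \<Longrightarrow> (\<lambda>z. c * f z) \<in> M"
  and M_zero [simp]: "(\<lambda>z. 0) \<in> M"
  using M by (auto simp: closed_subspace_H2_def)

lemma M_diff [simp]: "f \<in> M \<Longrightarrow> g \<in> M \<Longrightarrow> (\<lambda>z. f z - g z) \<in> M"
  using M_add[OF _ M_cmult, of f g "-1"] by simp

lemmas pq [simp] = p q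

section \<open>The operator \<open>V\<close>\<close>

lemma inner_pp: "h2inner p p = 1" and inner_qq: "h2inner q q = 1"
  by (simp_all add: h2inner_self p1 q1)

text \<open>\<open>bshift\<close> stands for division by \<open>z\<close>; on \<open>M\<close> the
  division is exact, see \<open>shift_V\<close>.\<close>

definition V :: "(complex \<Rightarrow> complex) \<Rightarrow> complex \<Rightarrow> complex" where
  "V f = bshift (\<lambda>z. f z - h2inner f p * p z)"

text \<open>Removing the component along \<open>p\<close> leads into \<open>perp_in M p\<close>, so
  by \<open>shifted\<close> the result is the shift of some \<open>g\<close> in \<open>M\<close>
  orthogonal to \<open>q\<close>, and \<open>bshift\<close> recovers that \<open>g\<close>.\<close>

lemma V_props:
  assumes f: "f \<in> M"
  shows V_M [simp]: "V f \<in> M" and V_perp: "h2inner (V f) q = 0"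
    and shift_V: "shift (V f) = (\<lambda>z. f z - h2inner f p * p z)"
proof -
  have "(\<lambda>z. f z - h2inner f p * p z) \<in> perp_in M p"
    using f by (simp add: perp_in_def h2inner_diff_left h2inner_cmult_left inner_pp)
  then obtain g where g: "g \<in> M" "h2inner g q = 0" "(\<lambda>z. f z - h2inner f p * p z) = shift g"
    unfolding shifted by (auto simp: perp_in_def)
  then have "V f = g" by (simp add: V_def bshift_shift)
  with g show "V f \<in> M" "h2inner (V f) q = 0" "shift (V f) = (\<lambda>z. f z - h2inner f p * p z)" by simp_all
qed

lemma V_decomp: "f \<in> M \<Longrightarrow> f z = h2inner f p * p z + shift (V f) z"
  by (simp add: shift_V)

lemma inner_shift_V: "f \<in> M \<Longrightarrow> h2inner (shift (V f)) p = 0"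
  by (simp add: shift_V h2inner_diff_left h2inner_cmult_left inner_pp)

text \<open>The two parts of the decomposition are orthogonal, and the shift is isometric.\<close>

lemma inner_V:
  assumes f: "f \<in> M" and g: "g \<in> M"
  shows "h2inner f g = h2inner f p * cnj (h2inner g p) + h2inner (V f) (V g)"
proof -
  have "h2inner (V f) (V g) = h2inner (shift (V f)) (shift (V g))"
    using f g by (simp add: h2inner_shift)
  also have "\<dots> = h2inner (shift (V f)) g"
    using f g inner_shift_V[OF f] by (subst (2) shift_V) (simp_all add: h2inner_diff_right h2inner_cmult_right)
  also have "\<dots> = h2inner f g - h2inner f p * cnj (h2inner g p)"
    using f g by (simp add: shift_V h2inner_diff_left h2inner_cmult_left flip: h2inner_commute)
  finally show ?thesis by simp
qed

lemma norm_V: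
  assumes "f \<in> M"
  shows "(h2norm f)\<^sup>2 = (cmod (h2inner f p))\<^sup>2 + (h2norm (V f))\<^sup>2"
proof -
  have "complex_of_real ((h2norm f)\<^sup>2) = of_real ((cmod (h2inner f p))\<^sup>2 + (h2norm (V f))\<^sup>2)"
    using inner_V[OF assms assms] assms
    by (simp only: h2inner_self M_H2 V_M complex_norm_square of_real_add)
  then show ?thesis by (simp only: of_real_eq_iff)
qed

lemma V_add: "f \<in> M \<Longrightarrow> g \<in> M \<Longrightarrow> V (\<lambda>z. f z + g z) = (\<lambda>z. V f z + V g z)"
proof -
  assume f: "f \<in> M" and g: "g \<in> M"
  have "(\<lambda>z. (f z + g z) - h2inner (\<lambda>z. f z + g z) p * p z)
      = (\<lambda>z. (f z - h2inner f p * p z) + (g z - h2inner g p * p z))"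
    using f g by (simp add: h2inner_add_left algebra_simps)
  then show ?thesis
    unfolding V_def using bshift_add[of "\<lambda>z. f z - h2inner f p * p z" "\<lambda>z. g z - h2inner g p * p z"] f g by simp
qed

lemma V_cmult: "f \<in> M \<Longrightarrow> V (\<lambda>z. c * f z) = (\<lambda>z. c * V f z)"
proof -
  assume f: "f \<in> M"
  have "(\<lambda>z. c * f z - h2inner (\<lambda>z. c * f z) p * p z) = (\<lambda>z. c * (f z - h2inner f p * p z))"
    using f by (simp add: h2inner_cmult_left algebra_simps)
  then show ?thesis
    unfolding V_def using bshift_cmult[of "\<lambda>z. f z - h2inner f p * p z" c] f by simp
qed

lemma Vn_M [simp]: "f \<in> M \<Longrightarrow> (V ^^ n) f \<in> M"
  by (induction n) auto

lemma Vn_add: "f \<in> M \<Longrightarrow> g \<in> M \<Longrightarrow> (V ^^ n) (\<lambda>z. f z + g z) = (\<lambda>z. (V ^^ n) f z + (V ^^ n) g z)"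
  by (induction n) (auto simp: V_add)

lemma Vn_cmult: "f \<in> M \<Longrightarrow> (V ^^ n) (\<lambda>z. c * f z) = (\<lambda>z. c * (V ^^ n) f z)"
  by (induction n) (auto simp: V_cmult)

section \<open>Quotients by \<open>p\<close>\<close>

definition coef :: "(complex \<Rightarrow> complex) \<Rightarrow> nat \<Rightarrow> complex" where
  "coef f n = h2inner ((V ^^ n) f) p"

text \<open>The function \<open>c\<^sub>f\<close> of the overview; \<open>pmul_quot\<close> shows
  that it is a quotient.\<close>

definition quot :: "(complex \<Rightarrow> complex) \<Rightarrow> complex \<Rightarrow> complex" where
  "quot f = pseries (coef f)"

lemma coef_add: "f \<in> M \<Longrightarrow> g \<in> M \<Longrightarrow> coef (\<lambda>z. f z + g z) n = coef f n + coef g n"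
  by (simp add: coef_def Vn_add h2inner_add_left)

lemma coef_cmult: "f \<in> M \<Longrightarrow> coef (\<lambda>z. c * f z) n = c * coef f n"
  by (simp add: coef_def Vn_cmult h2inner_cmult_left)

lemma coef_V: "coef (V f) n = coef f (Suc n)"
  by (simp add: coef_def funpow_swap1)

lemma inner_Vn:
  assumes "f \<in> M" "g \<in> M"
  shows "h2inner f g = (\<Sum>k<n. coef f k * cnj (coef g k)) + h2inner ((V ^^ n) f) ((V ^^ n) g)"
proof (induction n)
  case (Suc n)
  then show ?case using inner_V[of "(V ^^ n) f" "(V ^^ n) g"] assms by (simp add: coef_def)
qed simp

lemma norm_Vn:
  assumes "f \<in> M"
  shows "(h2norm f)\<^sup>2 = (\<Sum>k<n. (cmod (coef f k))\<^sup>2) + (h2norm ((V ^^ n) f))\<^sup>2"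
proof (induction n)
  case (Suc n)
  then show ?case using norm_V[of "(V ^^ n) f"] assms by (simp add: coef_def)
qed simp

lemma norm_Vn_le:
  assumes "f \<in> M"
  shows "h2norm ((V ^^ n) f) \<le> h2norm f"
proof (rule power2_le_imp_le)
  have "0 \<le> (\<Sum>k<n. (cmod (coef f k))\<^sup>2)" by (intro sum_nonneg) simp
  then show "(h2norm ((V ^^ n) f))\<^sup>2 \<le> (h2norm f)\<^sup>2"
    using norm_Vn[OF assms, of n] by linarith
qed (use assms in simp)

lemma coef_summable: "f \<in> M \<Longrightarrow> summable (\<lambda>n. (cmod (coef f n))\<^sup>2)"
proof (rule summableI_nonneg_bounded[where x = "(h2norm f)\<^sup>2"])
  show "(\<Sum>k<n. (cmod (coef f k))\<^sup>2) \<le> (h2norm f)\<^sup>2" if "f \<in> M" for n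
    using norm_Vn[OF that, of n] zero_le_power2[of "h2norm ((V ^^ n) f)"] by linarith
qed auto

lemma quot_H2 [simp]: "f \<in> M \<Longrightarrow> quot f \<in> H2" and tcoeff_quot: "f \<in> M \<Longrightarrow> tcoeff (quot f) n = coef f n"
  by (simp_all add: quot_def pseries_H2 tcoeff_pseries coef_summable)

lemma quot_add: "f \<in> M \<Longrightarrow> g \<in> M \<Longrightarrow> quot (\<lambda>z. f z + g z) = (\<lambda>z. quot f z + quot g z)"
  by (rule H2_eqI) (simp_all add: tcoeff_quot tcoeff_add coef_add)

lemma quot_cmult: "f \<in> M \<Longrightarrow> quot (\<lambda>z. c * f z) = (\<lambda>z. c * quot f z)"
  by (rule H2_eqI) (simp_all add: tcoeff_quot tcoeff_cmult coef_cmult)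

lemma quot_diff: "f \<in> M \<Longrightarrow> g \<in> M \<Longrightarrow> quot (\<lambda>z. f z - g z) = (\<lambda>z. quot f z - quot g z)"
  using quot_add[OF _ M_cmult, of f g "-1"] quot_cmult[of g "-1"] by simp

lemma quot_V: "f \<in> M \<Longrightarrow> quot (V f) = bshift (quot f)"
  by (rule H2_eqI) (simp_all add: tcoeff_quot tcoeff_bshift coef_V)

text \<open>The limit of \<open>norm_Vn\<close>: \<open>quot\<close> preserves the norm of
  \<open>f\<close> exactly when the iterates of \<open>V\<close> on \<open>f\<close> tend to 0 in
  norm.\<close>

lemma norm_Vn_tendsto:
  assumes "f \<in> M"
  shows "(\<lambda>n. (h2norm ((V ^^ n) f))\<^sup>2) \<longlonglongrightarrow> (h2norm f)\<^sup>2 - (h2norm (quot f))\<^sup>2"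
proof -
  have "(\<lambda>n. (h2norm f)\<^sup>2 - (\<Sum>k<n. (cmod (coef f k))\<^sup>2)) \<longlonglongrightarrow> (h2norm f)\<^sup>2 - (h2norm (quot f))\<^sup>2"
    using h2norm_sq_sums[OF quot_H2[OF assms]] unfolding sums_def
    by (intro tendsto_intros) (simp add: tcoeff_quot assms)
  moreover have "(h2norm f)\<^sup>2 - (\<Sum>k<n. (cmod (coef f k))\<^sup>2) = (h2norm ((V ^^ n) f))\<^sup>2" for n
    using norm_Vn[OF assms, of n] by simp
  ultimately show ?thesis by simp
qed

text \<open>After \<open>n\<close> decompositions the remainder at \<open>z\<close> is
  \<open>z ^ n * (V ^^ n) f z\<close>; the iterates are bounded in norm, hence at \<open>z\<close>,
  so it tends to 0.\<close>

lemma pmul_quot: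
  assumes f: "f \<in> M"
  shows "f = pmul p (quot f)"
proof
  fix z
  show "f z = pmul p (quot f) z"
  proof (cases "z \<in> D")
    case True
    have part: "f z = p z * (\<Sum>k<n. coef f k * z ^ k) + z ^ n * (V ^^ n) f z" for n
    proof (induction n)
      case (Suc n)
      then show ?case
        using V_decomp[of "(V ^^ n) f" z] f True by (simp add: coef_def shift_apply algebra_simps)
    qed simp
    define B where "B = h2norm f / sqrt (1 - (cmod z)\<^sup>2)"
    have b: "cmod ((V ^^ n) f z) \<le> B" for n
    proof -
      have "cmod ((V ^^ n) f z) \<le> h2norm ((V ^^ n) f) / sqrt (1 - (cmod z)\<^sup>2)"
        using f by (intro H2_point_bound True) auto
      also have "\<dots> \<le> B" unfolding B_def using True f
        by (intro divide_right_mono norm_Vn_le) (auto simp: abs_square_le_1)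
      finally show ?thesis .
    qed
    have "(\<lambda>n. cmod z ^ n * B) \<longlonglongrightarrow> 0 * B"
      using True by (intro tendsto_intros LIMSEQ_realpow_zero) auto
    then have "(\<lambda>n. z ^ n * (V ^^ n) f z) \<longlonglongrightarrow> 0"
      by (intro Lim_null_comparison[of "\<lambda>n. z ^ n * (V ^^ n) f z" "\<lambda>n. cmod z ^ n * B"])
         (auto simp: norm_mult norm_power intro!: always_eventually mult_left_mono b)
    moreover have "(\<lambda>n. p z * (\<Sum>k<n. coef f k * z ^ k)) \<longlonglongrightarrow> p z * quot f z"
      using pseries_sums[OF coef_summable[OF f] True] unfolding sums_def quot_def by (intro tendsto_intros)
    ultimately have "(\<lambda>n. p z * (\<Sum>k<n. coef f k * z ^ k) + z ^ n * (V ^^ n) f z) \<longlonglongrightarrow> p z * quot f z + 0"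
      by (intro tendsto_add)
    then have "(\<lambda>n. f z) \<longlonglongrightarrow> p z * quot f z" using part by simp
    then show ?thesis using True by (simp add: LIMSEQ_const_iff pmul_def)
  qed (use f in \<open>simp add: pmul_def H2_off\<close>)
qed

section \<open>The inner function \<open>\<theta>\<close>\<close>

definition \<theta> :: "complex \<Rightarrow> complex" where
  "\<theta> = quot q"

lemma th_H2 [simp]: "\<theta> \<in> H2"
  by (simp add: \<theta>_def)

lemma q_eq: "q = pmul \<theta> p"
  using pmul_quot[OF q] by (simp add: \<theta>_def pmul_commute)

text \<open>With \<open>x\<^sub>n = \<Sum>\<^sub>k\<^sub><\<^sub>n w\<^sup>k V\<^sup>k q\<close> one has \<open>x\<^sub>n\<^sub>+\<^sub>1 = q + w V x\<^sub>n\<close> and \<open>\<langle>x\<^sub>n, p\<rangle> \<longrightarrow> \<theta>(w)\<close>. If \<open>\<bar>w \<theta>(w)\<bar> > 1\<close>, then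
  \<open>\<parallel>x\<^sub>n\<parallel>\<^sup>2\<close> eventually decreases by a fixed amount in each step.\<close>

lemma th_factor_bound:
  assumes w: "w \<in> D"
  shows "cmod (w * \<theta> w) \<le> 1"
proof (rule ccontr)
  assume "\<not> cmod (w * \<theta> w) \<le> 1"
  then have big: "1 < (cmod (w * \<theta> w))\<^sup>2" by (simp add: one_less_power)
  define x where "x n = (\<lambda>z. \<Sum>k<n. w ^ k * (V ^^ k) q z)" for n
  have x0: "x 0 = (\<lambda>z. 0)" and xS: "x (Suc n) = (\<lambda>z. x n z + w ^ n * (V ^^ n) q z)" for n
    by (simp_all add: x_def)
  have xM [simp]: "x n \<in> M" for n by (induction n) (simp_all add: x0 xS)
  have V0: "V (\<lambda>z. 0) = (\<lambda>z. 0)" using V_cmult[of "\<lambda>z. 0" 0] by simp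
  have rec: "x (Suc n) = (\<lambda>z. q z + w * V (x n) z)" for n
  proof (induction n)
    case 0 show ?case by (simp add: x0 V0 xS)
  next
    case (Suc n)
    have "V (x (Suc n)) = (\<lambda>z. V (x n) z + w ^ n * (V ^^ Suc n) q z)"
      by (simp add: xS V_add V_cmult)
    then have "(\<lambda>z. q z + w * V (x (Suc n)) z) = (\<lambda>z. (q z + w * V (x n) z) + w ^ Suc n * (V ^^ Suc n) q z)"
      by (simp add: algebra_simps)
    also have "\<dots> = (\<lambda>z. x (Suc n) z + w ^ Suc n * (V ^^ Suc n) q z)"
      using fun_cong[OF Suc.IH] by simp
    finally show ?case by (subst xS) simp
  qed
  have inner: "h2inner (x n) p = (\<Sum>k<n. coef q k * w ^ k)" for n
    by (induction n) (simp_all add: x0 xS h2inner_add_left h2inner_cmult_left coef_def mult.commute)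
  define a where "a n = (h2norm (x n))\<^sup>2" for n
  define s where "s n = (cmod (w * h2inner (x n) p))\<^sup>2" for n
  \<comment> \<open>In the recursion for \<open>x\<close>, the vectors \<open>q\<close> and
    \<open>V (x n)\<close> are orthogonal, so Pythagoras combines with \<open>norm_V\<close>;
    finally \<open>cmod w\<close> is estimated by 1.\<close>
  have step: "a (Suc n) + s n \<le> 1 + a n" for n
  proof -
    have "h2inner q (V (x n)) = 0" using V_perp[OF xM, of n] h2inner_commute[of "V (x n)" q] by simp
    then have "a (Suc n) = 1 + (cmod w)\<^sup>2 * (h2norm (V (x n)))\<^sup>2"
      by (simp add: a_def rec h2norm_add_sq h2norm_cmult q1 h2inner_cmult_right power_mult_distrib)
    moreover have "(h2norm (V (x n)))\<^sup>2 = a n - (cmod (h2inner (x n) p))\<^sup>2"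
      using norm_V[OF xM, of n] by (simp add: a_def)
    ultimately have "a (Suc n) + s n = 1 + (cmod w)\<^sup>2 * a n"
      by (simp add: s_def norm_mult power_mult_distrib algebra_simps)
    also have "(cmod w)\<^sup>2 * a n \<le> 1 * a n"
      using w by (intro mult_right_mono) (auto simp: a_def abs_square_le_1)
    finally show ?thesis by simp
  qed
  have "(\<lambda>n. h2inner (x n) p) \<longlonglongrightarrow> \<theta> w"
    using pseries_sums[OF coef_summable[OF q] w] unfolding inner sums_def \<theta>_def quot_def .
  then have "s \<longlonglongrightarrow> (cmod (w * \<theta> w))\<^sup>2"
    unfolding s_def by (intro tendsto_intros)
  \<comment> \<open>Half the excess over 1: eventually \<open>s n > 1 + e\<close>, so each further
    step lowers \<open>a\<close> by at least \<open>e\<close>.\<close>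
  define e where "e = ((cmod (w * \<theta> w))\<^sup>2 - 1) / 2"
  have e: "e > 0" "1 + e < (cmod (w * \<theta> w))\<^sup>2" using big by (auto simp: e_def field_simps)
  from order_tendstoD(1)[OF \<open>s \<longlonglongrightarrow> _\<close> e(2)] obtain K where K: "\<And>n. n \<ge> K \<Longrightarrow> 1 + e < s n"
    by (auto simp: eventually_sequentially)
  have dec: "a (K + n) \<le> a K - real n * e" for n
  proof (induction n)
    case (Suc n)
    then show ?case using step[of "K + n"] K[of "K + n"] by (simp add: algebra_simps)
  qed simp
  obtain n where "a K < real n * e" using reals_Archimedean3[OF e(1)] by blast
  then have "a (K + n) < 0" using dec[of n] by simp
  then show False by (simp add: a_def)
qed

lemma th_le_1: "z \<in> D \<Longrightarrow> cmod (\<theta> z) \<le> 1"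
  by (rule bounded_factor_by_one[OF H2_holo[OF th_H2] th_factor_bound])

lemma p_nonzero: "p \<noteq> (\<lambda>z. 0)"
  using p1 h2norm_zero_iff[of p] by auto

text \<open>Multiplication by \<open>\<theta>\<close> carries the unit vector \<open>p\<close> to
  the unit vector \<open>q\<close>, so \<open>p\<close> is the required isometric vector.\<close>

lemma th_norm: "h2norm \<theta> = 1"
proof (rule unit_norm_of_isometric_vector[OF th_H2 th_le_1 M_H2[OF p] p_nonzero])
  show "h2norm (pmul \<theta> p) = h2norm p" using p1 q1 by (simp flip: q_eq)
qed

lemma th_inner: "inner_fun \<theta>"
  by (rule inner_fun_unit_norm[OF th_H2 th_le_1 th_norm])

text \<open>Where the two functions differ, \<open>p\<close> vanishes. This set is open, so if it
  were nonempty, the identity theorem would make \<open>p\<close> zero. It transfers the results to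
  every inner function relating \<open>p\<close> and \<open>q\<close>.\<close>

lemma th_unique:
  assumes hol: "\<theta>' holomorphic_on D" and eq: "q = pmul \<theta>' p" and z: "z \<in> D"
  shows "\<theta>' z = \<theta> z"
proof (rule ccontr)
  assume ne: "\<theta>' z \<noteq> \<theta> z"
  define U where "U = {w \<in> D. \<theta>' w - \<theta> w \<in> - {0}}"
  have "continuous_on D (\<lambda>w. \<theta>' w - \<theta> w)"
    using hol H2_holo[OF th_H2] by (intro continuous_intros holomorphic_on_imp_continuous_on)
  then have "open (D \<inter> (\<lambda>w. \<theta>' w - \<theta> w) -` (- {0}))"
    by (rule continuous_open_preimage) auto
  then have "open U" by (simp add: U_def vimage_def Int_def)
  have pU: "p w = 0" if "w \<in> U" for w
  proof -
    have "w \<in> D" using that by (simp add: U_def)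
    then have "\<theta>' w * p w = \<theta> w * p w" using fun_cong[OF eq, of w] fun_cong[OF q_eq, of w] by (auto simp: pmul_def)
    then show ?thesis using that by (simp add: U_def)
  qed
  have "z \<in> U" "U \<subseteq> D" using z ne by (auto simp: U_def)
  then have "p w = 0" if "w \<in> D" for w
    using analytic_continuation_open[of U D p "\<lambda>_. 0" w] \<open>open U\<close> pU H2_holo[OF M_H2[OF p]] that
    by auto
  then have "p = (\<lambda>z. 0)" using H2_off[OF M_H2[OF p]] by blast
  then show False using p_nonzero by simp
qed

text \<open>The equality \<open>h2norm \<theta> = h2norm q\<close> leaves no mass in the limit of
  the iterates.\<close>

lemma Vn_q: "(\<lambda>n. h2norm ((V ^^ n) q)) \<longlonglongrightarrow> 0"
proof -
  have "(\<lambda>n. (h2norm ((V ^^ n) q))\<^sup>2) \<longlonglongrightarrow> 0"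
    using norm_Vn_tendsto[OF q] th_norm q1 by (simp add: \<theta>_def)
  from tendsto_real_sqrt[OF this] show ?thesis by simp
qed

text \<open>The remainder in \<open>inner_Vn\<close> vanishes in the limit because the iterates of
  \<open>V\<close> on \<open>q\<close> tend to 0 while those on \<open>f\<close> stay
  bounded.\<close>

lemma inner_quot_th:
  assumes f: "f \<in> M"
  shows "h2inner (quot f) \<theta> = h2inner f q"
proof -
  have lim: "(\<lambda>n. h2norm f * h2norm ((V ^^ n) q)) \<longlonglongrightarrow> 0"
    using tendsto_mult[OF tendsto_const[of "h2norm f"] Vn_q] by simp
  have "(\<lambda>n. h2inner ((V ^^ n) f) ((V ^^ n) q)) \<longlonglongrightarrow> 0"
  proof (rule Lim_null_comparison[OF _ lim], rule always_eventually, rule allI)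
    fix n
    have "norm (h2inner ((V ^^ n) f) ((V ^^ n) q)) \<le> h2norm ((V ^^ n) f) * h2norm ((V ^^ n) q)"
      using f by (intro h2_cauchy_schwarz) auto
    also have "\<dots> \<le> h2norm f * h2norm ((V ^^ n) q)"
      using f by (intro mult_right_mono norm_Vn_le) auto
    finally show "norm (h2inner ((V ^^ n) f) ((V ^^ n) q)) \<le> h2norm f * h2norm ((V ^^ n) q)" .
  qed
  then have "(\<lambda>n. h2inner f q - h2inner ((V ^^ n) f) ((V ^^ n) q)) \<longlonglongrightarrow> h2inner f q - 0"
    by (intro tendsto_intros)
  moreover have "h2inner f q - h2inner ((V ^^ n) f) ((V ^^ n) q) = (\<Sum>k<n. coef f k * cnj (coef q k))" for n
    using inner_Vn[OF f q, of n] by simp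
  ultimately have "(\<lambda>k. coef f k * cnj (coef q k)) sums h2inner f q"
    by (simp add: sums_def)
  then show ?thesis by (intro h2inner_eqI) (simp add: tcoeff_quot f \<theta>_def)
qed

lemma th_mult: "f \<in> H2 \<Longrightarrow> pmul \<theta> f \<in> H2" "f \<in> H2 \<Longrightarrow> h2norm (pmul \<theta> f) \<le> h2norm f"
  using pmul_bounded[OF H2_holo[OF th_H2] th_le_1, of f] by auto

text \<open>Moving all shifts to the left side turns \<open>quot f\<close> into the quotient of
  \<open>(V ^^ Suc m) f\<close>. Its inner product with \<open>\<theta>\<close> is that of
  \<open>(V ^^ Suc m) f\<close> with \<open>q\<close>, and the range of \<open>V\<close> is
  orthogonal to \<open>q\<close>.\<close>

lemma quot_orth_zpow:
  assumes f: "f \<in> M"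
  shows "h2inner (quot f) (shift (pmul \<theta> (zpow m))) = 0"
proof -
  have *: "h2inner (quot f) (pmul \<theta> (zpow m)) = h2inner ((V ^^ m) f) q" if "f \<in> M" for f
    using that
  proof (induction m arbitrary: f)
    case 0
    have "pmul \<theta> (zpow 0) = \<theta>" by (auto simp: pmul_def zpow_0 one_H2_def H2_off)
    then show ?case using inner_quot_th[OF 0] by simp
  next
    case (Suc m)
    have "pmul \<theta> (zpow (Suc m)) = shift (pmul \<theta> (zpow m))"
      by (auto simp: pmul_def zpow_Suc shift_apply)
    then have "h2inner (quot f) (pmul \<theta> (zpow (Suc m))) = h2inner (quot (V f)) (pmul \<theta> (zpow m))"
      using Suc.prems by (simp add: h2inner_shift_right th_mult quot_V)
    also have "\<dots> = h2inner ((V ^^ Suc m) f) q"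
      using Suc by (simp add: funpow_swap1)
    finally show ?case .
  qed
  have "h2inner (quot f) (shift (pmul \<theta> (zpow m))) = h2inner ((V ^^ m) (V f)) q"
    using *[of "V f"] f by (simp add: h2inner_shift_right th_mult quot_V)
  also have "\<dots> = 0" using V_perp[of "(V ^^ m) f"] f by (simp add: funpow_swap1)
  finally show ?thesis .
qed

text \<open>Orthogonality on monomials extends to \<open>H2\<close> since polynomials are dense and
  multiplication by \<open>\<theta>\<close> is a contraction.\<close>

lemma quot_RanH:
  assumes f: "f \<in> M"
  shows "quot f \<in> RanH \<theta>"
  unfolding RanH_def
proof (intro CollectI conjI ballI)
  fix g assume g: "g \<in> H2"
  define P where "P N = (\<lambda>z. \<Sum>n<N. tcoeff g n * zpow n z)" for N
  have P: "P N \<in> H2" for N unfolding P_def by auto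
  define c where "c = h2inner (quot f) (shift (pmul \<theta> g))"
  have "norm c \<le> h2norm (quot f) * h2norm (\<lambda>z. g z - P N z)" for N
  proof -
    have "shift (pmul \<theta> (P N)) = (\<lambda>z. \<Sum>n<N. tcoeff g n * shift (pmul \<theta> (zpow n)) z)"
      by (auto simp: P_def shift_apply pmul_def sum_distrib_left mult_ac)
    then have "h2inner (quot f) (shift (pmul \<theta> (P N))) = 0"
      using f by (simp add: h2inner_sum_right h2inner_cmult_right th_mult quot_orth_zpow)
    moreover have "shift (pmul \<theta> (\<lambda>z. g z - P N z)) = (\<lambda>z. shift (pmul \<theta> g) z - shift (pmul \<theta> (P N)) z)"
      by (auto simp: shift_apply pmul_def algebra_simps)
    ultimately have c: "c = h2inner (quot f) (shift (pmul \<theta> (\<lambda>z. g z - P N z)))"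
      using f g P by (simp add: c_def h2inner_diff_right th_mult)
    have "norm c \<le> h2norm (quot f) * h2norm (shift (pmul \<theta> (\<lambda>z. g z - P N z)))"
      unfolding c using f g P by (intro h2_cauchy_schwarz) (auto simp: th_mult)
    also have "\<dots> \<le> h2norm (quot f) * h2norm (\<lambda>z. g z - P N z)"
      using f g P by (intro mult_left_mono) (auto simp: h2norm_shift th_mult)
    finally show ?thesis .
  qed
  moreover have "(\<lambda>N. h2norm (quot f) * h2norm (\<lambda>z. g z - P N z)) \<longlonglongrightarrow> h2norm (quot f) * 0"
    unfolding P_def by (intro tendsto_intros H2_partial_sums_tendsto g)
  ultimately have "norm c \<le> h2norm (quot f) * 0"
    by (intro LIMSEQ_le_const) auto
  then show "h2inner (quot f) (shift (pmul \<theta> g)) = 0" by (simp add: c_def)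
qed (use f in simp)

section \<open>Vectors whose iterates under \<open>V\<close> tend to 0; \<open>quot\<close> is
  isometric on them\<close>

definition M0 :: "(complex \<Rightarrow> complex) set" where
  "M0 = {f \<in> M. (\<lambda>n. h2norm ((V ^^ n) f)) \<longlonglongrightarrow> 0}"

lemma M0_M [simp]: "f \<in> M0 \<Longrightarrow> f \<in> M"
  and M0_lim: "f \<in> M0 \<Longrightarrow> (\<lambda>n. h2norm ((V ^^ n) f)) \<longlonglongrightarrow> 0"
  and M0I: "f \<in> M \<Longrightarrow> (\<lambda>n. h2norm ((V ^^ n) f)) \<longlonglongrightarrow> 0 \<Longrightarrow> f \<in> M0"
  by (simp_all add: M0_def)

lemma M0_add:
  assumes "f \<in> M0" "g \<in> M0"
  shows "(\<lambda>z. f z + g z) \<in> M0"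
proof -
  have lim: "(\<lambda>n. h2norm ((V ^^ n) f) + h2norm ((V ^^ n) g)) \<longlonglongrightarrow> 0"
    using tendsto_add[OF M0_lim[OF assms(1)] M0_lim[OF assms(2)]] by simp
  have "(\<lambda>n. h2norm (\<lambda>z. (V ^^ n) f z + (V ^^ n) g z)) \<longlonglongrightarrow> 0"
  proof (rule Lim_null_comparison[OF _ lim], rule always_eventually, rule allI)
    show "norm (h2norm (\<lambda>z. (V ^^ n) f z + (V ^^ n) g z)) \<le> h2norm ((V ^^ n) f) + h2norm ((V ^^ n) g)" for n
      using assms h2norm_triangle[of "(V ^^ n) f" "(V ^^ n) g"] by simp
  qed
  then show ?thesis using assms by (intro M0I) (simp_all add: Vn_add)
qed

lemma M0_cmult: "f \<in> M0 \<Longrightarrow> (\<lambda>z. c * f z) \<in> M0"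
  using tendsto_mult[OF tendsto_const[of "cmod c"] M0_lim[of f]]
  by (intro M0I) (simp_all add: Vn_cmult h2norm_cmult)

lemma M0_diff: "f \<in> M0 \<Longrightarrow> g \<in> M0 \<Longrightarrow> (\<lambda>z. f z - g z) \<in> M0"
  using M0_add[OF _ M0_cmult, of f g "-1"] by simp

lemma M0_zero: "(\<lambda>z. 0) \<in> M0"
proof -
  have "(V ^^ n) (\<lambda>z. 0) = (\<lambda>z. 0)" for n using Vn_cmult[of "\<lambda>z. 0" n 0] by simp
  then show ?thesis by (intro M0I) (simp_all add: h2norm_def)
qed

lemma M0_of_V:
  assumes "f \<in> M" "V f \<in> M0"
  shows "f \<in> M0"
proof (rule M0I[OF assms(1)])
  show "(\<lambda>n. h2norm ((V ^^ n) f)) \<longlonglongrightarrow> 0"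
    by (rule LIMSEQ_imp_Suc) (use M0_lim[OF assms(2)] in \<open>simp add: funpow_swap1\<close>)
qed

lemma quot_isometric:
  assumes "f \<in> M0"
  shows "h2norm (quot f) = h2norm f"
proof -
  have "(\<lambda>n. (h2norm ((V ^^ n) f))\<^sup>2) \<longlonglongrightarrow> 0"
    using tendsto_power[OF M0_lim[OF assms], of 2] by simp
  from LIMSEQ_unique[OF norm_Vn_tendsto[OF M0_M[OF assms]] this]
  have "(h2norm f)\<^sup>2 - (h2norm (quot f))\<^sup>2 = 0" .
  then show ?thesis using assms by (simp add: power2_eq_iff_nonneg)
qed

text \<open>The component of \<open>p\<close> along itself exhausts its norm, so Pythagoras leaves
  nothing for \<open>V p\<close>.\<close>

lemma V_p: "V p = (\<lambda>z. 0)"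
  using norm_V[OF p] p1 h2norm_zero_iff[of "V p"] by (simp add: inner_pp)

lemma p_M0: "p \<in> M0"
  by (rule M0_of_V) (simp_all add: V_p M0_zero)

lemma quot_p: "quot p = one_H2"
proof (rule H2_eqI)
  fix n
  have "coef p (Suc k) = 0" for k
    using coef_V[of p k] coef_cmult[of "\<lambda>z. 0" 0 k] by (simp add: V_p)
  then show "tcoeff (quot p) n = tcoeff one_H2 n"
    by (cases n) (simp_all add: tcoeff_quot tcoeff_one, simp add: coef_def inner_pp)
qed simp_all

text \<open>The adjoint of \<open>V\<close>.\<close>

definition W :: "(complex \<Rightarrow> complex) \<Rightarrow> complex \<Rightarrow> complex" where
  "W g = shift (\<lambda>z. g z - h2inner g q * q z)"

lemma
  assumes g: "g \<in> M"
  shows W_M: "W g \<in> M" and V_W: "V (W g) = (\<lambda>z. g z - h2inner g q * q z)" and W_0: "h2inner (W g) p = 0"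
proof -
  have "(\<lambda>z. g z - h2inner g q * q z) \<in> perp_in M q"
    using g by (simp add: perp_in_def h2inner_diff_left h2inner_cmult_left inner_qq)
  then have "W g \<in> perp_in M p" unfolding shifted W_def by (rule imageI)
  then show "W g \<in> M" "h2inner (W g) p = 0" by (auto simp: perp_in_def)
  then show "V (W g) = (\<lambda>z. g z - h2inner g q * q z)"
    using g by (simp add: V_def) (simp add: W_def bshift_shift)
qed

text \<open>Applying \<open>V\<close> undoes \<open>W\<close> up to a multiple of \<open>q\<close>,
  and \<open>q\<close> lies in \<open>M0\<close> by \<open>Vn_q\<close>.\<close>

lemma W_M0:
  assumes "g \<in> M0"
  shows "W g \<in> M0"
proof (rule M0_of_V)
  have "q \<in> M0" by (rule M0I[OF q Vn_q])
  then show "V (W g) \<in> M0" using assms by (simp add: V_W M0_diff M0_cmult)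
qed (simp add: W_M assms)

text \<open>\<open>W g\<close> is orthogonal to \<open>p\<close>, so its quotient vanishes at 0 and
  the backward shift in \<open>quot_V\<close> can be undone.\<close>

lemma quot_W:
  assumes g: "g \<in> M"
  shows "quot (W g) = shift (\<lambda>z. quot g z - h2inner g q * \<theta> z)"
proof -
  have "quot (W g) 0 = 0"
    using tcoeff_0[of "quot (W g)"] g by (simp add: W_M tcoeff_quot) (simp add: coef_def W_0)
  then have "quot (W g) = shift (quot (V (W g)))"
    using g by (simp add: quot_V W_M shift_bshift)
  then show ?thesis using g by (simp add: V_W quot_diff quot_cmult \<theta>_def)
qed

text \<open>\<open>quot (W\<^sup>n p)\<close> is the orthogonal projection of \<open>z\<^sup>n\<close> to the range of the Hankel operator.\<close>

lemma quot_Wn_p: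
  shows "(W ^^ n) p \<in> M0 \<and> (\<exists>h\<in>H2. quot ((W ^^ n) p) = (\<lambda>z. zpow n z + shift (pmul \<theta> h) z))"
proof (induction n)
  case 0
  show ?case
    by (auto simp: p_M0 quot_p zpow_0 shift_apply pmul_def intro!: bexI[of _ "\<lambda>z. 0"])
next
  case (Suc n)
  then obtain h where h: "h \<in> H2" "quot ((W ^^ n) p) = (\<lambda>z. zpow n z + shift (pmul \<theta> h) z)" by blast
  have G: "(W ^^ n) p \<in> M0" using Suc by simp
  define a where "a = h2inner ((W ^^ n) p) q"
  \<comment> \<open>The multiple of \<open>\<theta>\<close> subtracted in \<open>quot_W\<close> is
    absorbed as the constant term of the new \<open>h\<close>.\<close>
  have "quot ((W ^^ Suc n) p) = (\<lambda>z. zpow (Suc n) z + shift (pmul \<theta> (\<lambda>z. shift h z - a * one_H2 z)) z)"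
    using quot_W[OF M0_M[OF G]] h(2)
    by (auto simp: a_def[symmetric] zpow_Suc shift_apply pmul_def one_H2_def algebra_simps)
  moreover have "(\<lambda>z. shift h z - a * one_H2 z) \<in> H2" using h(1) by auto
  ultimately show ?case using W_M0[OF G] by auto
qed

text \<open>\<open>quot (G N)\<close> differs from the Taylor polynomial \<open>P N\<close> of
  \<open>h\<close> by a vector of the form \<open>shift (pmul \<theta> (K N))\<close>, to which both
  \<open>h\<close> and \<open>quot (G N)\<close> are orthogonal. Hence it is at least as close to
  \<open>h\<close> as \<open>P N\<close> is.\<close>

lemma RanH_approx:
  assumes h: "h \<in> RanH \<theta>"
  obtains G where "\<And>N. G N \<in> M0" "(\<lambda>N. h2norm (\<lambda>z. quot (G N) z - h z)) \<longlonglongrightarrow> 0"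
proof -
  obtain k where k: "\<And>n. k n \<in> H2" "\<And>n. quot ((W ^^ n) p) = (\<lambda>z. zpow n z + shift (pmul \<theta> (k n)) z)"
    using quot_Wn_p by metis
  have Wp: "(W ^^ n) p \<in> M0" for n using quot_Wn_p by blast
  have hH: "h \<in> H2" using h by (rule RanH_H2)
  define G where "G N = (\<lambda>z. \<Sum>n<N. tcoeff h n * (W ^^ n) p z)" for N
  define P where "P N = (\<lambda>z. \<Sum>n<N. tcoeff h n * zpow n z)" for N
  define K where "K N = (\<lambda>z. \<Sum>n<N. tcoeff h n * k n z)" for N
  have PH: "P N \<in> H2" and KH: "K N \<in> H2" for N unfolding P_def K_def using k by auto
  have G: "G N \<in> M0" for N
    by (induction N) (auto simp: G_def M0_zero intro!: M0_add M0_cmult Wp)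
  have qG: "quot (G N) = (\<lambda>z. P N z + shift (pmul \<theta> (K N)) z)" for N
  proof (induction N)
    case 0
    show ?case using quot_cmult[of "\<lambda>z. 0" 0] by (auto simp: G_def P_def K_def shift_apply pmul_def)
  next
    case (Suc N)
    have "G (Suc N) = (\<lambda>z. G N z + tcoeff h N * (W ^^ N) p z)" by (simp add: G_def)
    then have "quot (G (Suc N)) = (\<lambda>z. quot (G N) z + tcoeff h N * quot ((W ^^ N) p) z)"
      using G Wp by (simp add: quot_add quot_cmult)
    then show ?case unfolding Suc k(2)
      by (auto simp: P_def K_def shift_apply pmul_def algebra_simps)
  qed
  have le: "h2norm (\<lambda>z. h z - quot (G N) z) \<le> h2norm (\<lambda>z. h z - P N z)" for N
  proof -
    define d where "d = (\<lambda>z. h z - quot (G N) z)"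
    have dH: "d \<in> H2" unfolding d_def using hH G by auto
    have orth: "h2inner d (shift (pmul \<theta> (K N))) = 0"
      unfolding d_def using h quot_RanH[OF M0_M[OF G, of N]] KH[of N] hH G
      by (subst h2inner_diff_left) (auto simp: RanH_def th_mult)
    have "d = (\<lambda>z. (h z - P N z) - shift (pmul \<theta> (K N)) z)"
      by (auto simp: d_def qG)
    then have "h2inner d d = h2inner d (\<lambda>z. (h z - P N z) - shift (pmul \<theta> (K N)) z)" by simp
    then have "h2inner d d = h2inner d (\<lambda>z. h z - P N z)"
      using orth dH hH PH KH by (simp add: h2inner_diff_right th_mult)
    moreover have "(h2norm d)\<^sup>2 = cmod (h2inner d d)" by (simp add: h2inner_self dH norm_power)
    ultimately have "(h2norm d)\<^sup>2 \<le> h2norm d * h2norm (\<lambda>z. h z - P N z)"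
      using h2_cauchy_schwarz[OF dH H2_diff[OF hH PH], of N] by simp
    then show ?thesis
      using dH hH PH h2norm_nonneg[OF dH] by (cases "h2norm d = 0") (auto simp: power2_eq_square d_def[symmetric] mult_le_cancel_left)
  qed
  have "(\<lambda>N. h2norm (\<lambda>z. quot (G N) z - h z)) \<longlonglongrightarrow> 0"
  proof (rule Lim_null_comparison)
    show "(\<lambda>N. h2norm (\<lambda>z. h z - P N z)) \<longlonglongrightarrow> 0"
      unfolding P_def by (rule H2_partial_sums_tendsto[OF hH])
    show "\<forall>\<^sub>F N in sequentially. norm (h2norm (\<lambda>z. quot (G N) z - h z)) \<le> h2norm (\<lambda>z. h z - P N z)"
      using le hH G by (auto simp: h2norm_minus_commute[of "quot _" h])
  qed
  with G show ?thesis by (rule that)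
qed

text \<open>Isometry of \<open>quot\<close> on \<open>M0\<close> makes the approximants
  \<open>G N\<close> Cauchy along with their quotients. Their limit lies in the closed subspace
  \<open>M\<close>, has the norm of \<open>h\<close>, and equals \<open>pmul p h\<close> by
  pointwise convergence.\<close>

lemma RanH_mult:
  assumes h: "h \<in> RanH \<theta>"
  shows "pmul p h \<in> M" "h2norm (pmul p h) = h2norm h"
proof -
  have hH: "h \<in> H2" using h by (rule RanH_H2)
  obtain G where G: "\<And>N. G N \<in> M0" and lim: "(\<lambda>N. h2norm (\<lambda>z. quot (G N) z - h z)) \<longlonglongrightarrow> 0"
    by (rule RanH_approx[OF h]) blast
  have GM: "G N \<in> M" and GH: "G N \<in> H2" and QH: "quot (G N) \<in> H2" for N using G[of N] by simp_all
  obtain f where f: "f \<in> H2" "(\<lambda>N. h2norm (\<lambda>z. G N z - f z)) \<longlonglongrightarrow> 0"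
  proof (rule H2_complete[OF GH])
    fix e :: real assume "e > 0"
    then obtain K where K: "\<And>n. n \<ge> K \<Longrightarrow> h2norm (\<lambda>z. quot (G n) z - h z) < e / 2"
      using order_tendstoD(2)[OF lim, of "e / 2"] by (auto simp: eventually_sequentially)
    have "h2norm (\<lambda>z. G m z - G n z) < e" if "m \<ge> K" "n \<ge> K" for m n
    proof -
      have "h2norm (\<lambda>z. G m z - G n z) = h2norm (\<lambda>z. quot (G m) z - quot (G n) z)"
        using quot_isometric[OF M0_diff[OF G G], of m n] GM by (simp add: quot_diff)
      also have "\<dots> \<le> h2norm (\<lambda>z. quot (G m) z - h z) + h2norm (\<lambda>z. h z - quot (G n) z)"
        by (rule h2norm_diff_triangle[OF QH hH QH])
      also have "\<dots> < e"
        using K[OF that(1)] K[OF that(2)] h2norm_minus_commute[OF hH QH, of n] by simp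
      finally show ?thesis .
    qed
    then show "\<exists>K. \<forall>m\<ge>K. \<forall>n\<ge>K. h2norm (\<lambda>z. G m z - G n z) < e" by blast
  qed
  have "f = pmul p h"
  proof
    fix z
    have "(\<lambda>N. pmul p (quot (G N)) z) \<longlonglongrightarrow> pmul p h z"
      unfolding pmul_def using H2_pointwise_limit[OF QH hH lim, of z]
      by (cases "z \<in> D") (auto intro: tendsto_intros)
    moreover have "pmul p (quot (G N)) = G N" for N using pmul_quot[OF GM] by simp
    moreover have "(\<lambda>N. G N z) \<longlonglongrightarrow> f z" by (rule H2_pointwise_limit[OF GH f])
    ultimately show "f z = pmul p h z" by (simp add: LIMSEQ_unique)
  qed
  moreover have "f \<in> M" using M f GM unfolding closed_subspace_H2_def by blast
  moreover have "h2norm f = h2norm h"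
  proof -
    have "(\<lambda>N. h2norm (quot (G N))) \<longlonglongrightarrow> h2norm h" by (rule tendsto_h2norm[OF QH hH lim])
    then have "(\<lambda>N. h2norm (G N)) \<longlonglongrightarrow> h2norm h" by (simp add: quot_isometric G)
    then show ?thesis using tendsto_h2norm[OF GH f] LIMSEQ_unique by blast
  qed
  ultimately show "pmul p h \<in> M" "h2norm (pmul p h) = h2norm h" by simp_all
qed

lemma isometric_multiplier_RanH: "isometric_multiplier p (RanH \<theta>)"
  using RanH_mult H2_holo[OF M_H2[OF p]] by (simp add: isometric_multiplier_def)

lemma M_eq: "M = pmul p ` RanH \<theta>"
  using RanH_mult(1) pmul_quot quot_RanH by blast

end

theorem mainTheorem7:
  fixes M :: "(complex \<Rightarrow> complex) set" and p q :: "complex \<Rightarrow> complex"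
  assumes "closed_subspace_H2 M"
    and "p \<in> M" and "q \<in> M" and "h2norm p = 1" and "h2norm q = 1"
    and "perp_in M p = shift ` (perp_in M q)"
  shows "(\<exists>\<theta>. inner_fun \<theta> \<and> q = pmul \<theta> p)
       \<and> (\<forall>\<theta>. inner_fun \<theta> \<and> q = pmul \<theta> p \<longrightarrow>
             (\<forall>f \<in> RanH \<theta> \<inter> Hinf.
                 pmul p f \<in> M \<and> h2inner f one_H2 = 0 \<longrightarrow> h2inner (pmul p f) p = 0) \<longrightarrow>
             isometric_multiplier p (RanH \<theta>) \<and> M = pmul p ` RanH \<theta>)"
proof -
  interpret shifted_subspace M p q using assms by unfold_locales
  have "isometric_multiplier p (RanH \<theta>') \<and> M = pmul p ` RanH \<theta>'"
    if "inner_fun \<theta>'" "q = pmul \<theta>' p" for \<theta>'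
  proof -
    have "\<theta>' holomorphic_on D" using that(1) by (simp add: inner_fun_def Hinf_def)
    \<comment> \<open>\<open>inner_fun\<close> leaves the values outside \<open>D\<close> open;
      \<open>RanH\<close> sees the function only through \<open>pmul\<close>, so agreement on
      \<open>D\<close> suffices.\<close>
    then have "pmul \<theta>' g = pmul \<theta> g" for g
      using th_unique[OF _ that(2)] by (auto simp: pmul_def)
    then have "RanH \<theta>' = RanH \<theta>" by (simp add: RanH_def)
    then show ?thesis using isometric_multiplier_RanH M_eq by simp
  qed
  then show ?thesis using th_inner q_eq by blast
qed

end
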